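(* Let $S$ be a $\sigma$-compact metric space. Then, for $i=1,2$, the following maps are Borel measurable: $$(q,\mu_1,\mu_2)\mapsto\int_S f(x)\,\nu_i(dx;q,\mu_1,\mu_2),\qquad C(S\times S;(0,\infty))\times\mathcal{P}(S)\times\mathcal{P}(S)\to\mathbf{R},$$ for every $f\in C_0(S)$, and $$(x,q,\mu_1,\mu_2)\mapsto u_i(x;q,\mu_1,\mu_2),\qquad S\times C(S\times S;(0,\infty))\times\mathcal{P}(S)\times\mathcal{P}(S)\to\mathbf{R}\cup\{\infty\}.$$
   Context: $C(S\times S)$ carries the topology of uniform convergence on compact subsets, and $C(S\times S;(0,\infty))$ is its subset of positive functions. $\mathcal{P}(S)$ is the set of Borel probability measures on $S$ with the strong topology, i.e. that of the norm $\|\mu\|:=\sup\{\int_S\phi\,d\mu:\phi\in C(S),\ \sup|\phi|\le1\}$ applied to differences of measures. $C_0(S)$ is the space of continuous real functions on $S$ with compact support. Schrödinger's functional equation: for $\mu_1,\mu_2\in\mathcal{P}(S)$ and positive $q\in C(S\times S)$, find nonnegative $\sigma$-finite Borel measures $\nu_1,\nu_2$ on $S$ such that $$\mu_1(dx_1)=\nu_1(dx_1)\int_S q(x_1,x_2)\nu_2(dx_2),\qquad \mu_2(dx_2)=\nu_2(dx_2)\int_S q(x_1,x_2)\nu_1(dx_1).$$ It is known that the product measure $\nu_1(dx_1)\nu_2(dx_2)$ solving this exists and is unique. To make $\nu_1,\nu_2$ individually unique, fix a nondecreasing sequence $\{A_n\}_{n\ge1}$ of compact subsets of $S$ with $S=\bigcup_{n\ge1}A_n$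 (with $A_1:=S$ if $S$ is compact), put $n_0(\mu_1,\mu_2):=\min\{n\ge1:\mu_1(A_n)\mu_2(A_n)>0\}$, and impose the normalization $$\nu_1(A_{n_0(\mu_1,\mu_2)})=\nu_2(A_{n_0(\mu_1,\mu_2)}).$$ The resulting measures are denoted $\nu_i(dx;q,\mu_1,\mu_2)$, $i=1,2$. For $i,j\in\{1,2\}$, $i\neq j$, $$u_i(x_i;q,\mu_1,\mu_2):=\log\Bigl(\int_S q(x_1,x_2)\,\nu_j(dx_j;q,\mu_1,\mu_2)\Bigr)\in\mathbf{R}\cup\{\infty\},\qquad x_i\in S.$$ *)

theory Defs
  imports "HOL-Probability.Probability"
begin

definition borel_of :: "'b topology \<Rightarrow> 'b measure" where
  "borel_of X = sigma (topspace X) {U. openin X U}"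

definition cont_functions :: "('b::topological_space \<Rightarrow> real) set" where
  "cont_functions = {q. continuous_on UNIV q}"

text \<open>
  The topology of uniform convergence on compact sets on the continuous real functions.
  A finite union of compact sets is compact, so the sets
  \<open>{p. \<forall>z\<in>K. \<bar>p z - q z\<bar> < e}\<close> form a neighbourhood base at \<open>q\<close>.
\<close>

definition ucc_open :: "('b::topological_space \<Rightarrow> real) set \<Rightarrow> bool" where
  "ucc_open U \<longleftrightarrow> U \<subseteq> cont_functions \<and>
     (\<forall>q\<in>U. \<exists>K e. compact K \<and> 0 < e \<and> {p\<in>cont_functions. \<forall>z\<in>K. \<bar>p z - q z\<bar> < e} \<subseteq> U)"

lemma istopology_ucc_open:
  "istopology (ucc_open :: ('b::topological_space \<Rightarrow> real) set \<Rightarrow> bool)"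
  unfolding istopology_def
proof (intro conjI allI impI)
  fix U V :: "('b \<Rightarrow> real) set"
  assume U: "ucc_open U" and V: "ucc_open V"
  show "ucc_open (U \<inter> V)"
    unfolding ucc_open_def
  proof (intro conjI ballI)
    show "U \<inter> V \<subseteq> cont_functions"
      using U by (auto simp: ucc_open_def)
    fix q assume q: "q \<in> U \<inter> V"
    obtain K e where K: "compact K" "0 < e" "{p\<in>cont_functions. \<forall>z\<in>K. \<bar>p z - q z\<bar> < e} \<subseteq> U"
      using U q unfolding ucc_open_def by blast
    obtain L d where L: "compact L" "0 < d" "{p\<in>cont_functions. \<forall>z\<in>L. \<bar>p z - q z\<bar> < d} \<subseteq> V"
      using V q unfolding ucc_open_def by blast
    have "{p\<in>cont_functions. \<forall>z\<in>K \<union> L. \<bar>p z - q z\<bar> < min e d} \<subseteq> U \<inter> V"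
      using K(3) L(3) by auto
    moreover have "compact (K \<union> L)" "0 < min e d"
      using K L by auto
    ultimately show "\<exists>K e. compact K \<and> 0 < e \<and>
        {p\<in>cont_functions. \<forall>z\<in>K. \<bar>p z - q z\<bar> < e} \<subseteq> U \<inter> V"
      by blast
  qed
next
  fix \<K> :: "('b \<Rightarrow> real) set set"
  assume *: "\<forall>U\<in>\<K>. ucc_open U"
  show "ucc_open (\<Union>\<K>)"
    unfolding ucc_open_def
  proof (intro conjI ballI)
    show "\<Union>\<K> \<subseteq> cont_functions"
      using * by (auto simp: ucc_open_def)
    fix q assume "q \<in> \<Union>\<K>"
    then obtain U where U: "U \<in> \<K>" "q \<in> U" by blast
    from * U(1) have "ucc_open U" by (rule bspec)
    then obtain K e where K: "compact K" "0 < e" "{p\<in>cont_functions. \<forall>z\<in>K. \<bar>p z - q z\<bar> < e} \<subseteq> U"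
      using U(2) unfolding ucc_open_def by blast
    have "{p\<in>cont_functions. \<forall>z\<in>K. \<bar>p z - q z\<bar> < e} \<subseteq> \<Union>\<K>"
      using K(3) Union_upper[OF U(1)] by (rule order_trans)
    with K(1,2) show "\<exists>K e. compact K \<and> 0 < e \<and>
        {p\<in>cont_functions. \<forall>z\<in>K. \<bar>p z - q z\<bar> < e} \<subseteq> \<Union>\<K>"
      by blast
  qed
qed

definition ucc_topology :: "('b::topological_space \<Rightarrow> real) topology" where
  "ucc_topology = topology ucc_open"

lemma openin_ucc_topology: "openin ucc_topology U \<longleftrightarrow> ucc_open U"
  unfolding ucc_topology_def topology_inverse'[OF istopology_ucc_open] ..

lemma topspace_ucc_topology:
  "topspace ucc_topology = (cont_functions :: ('b::topological_space \<Rightarrow> real) set)"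
proof
  show "topspace ucc_topology \<subseteq> (cont_functions :: ('b \<Rightarrow> real) set)"
    using openin_topspace[of ucc_topology] unfolding openin_ucc_topology ucc_open_def by (rule conjunct1)
  have "ucc_open (cont_functions :: ('b \<Rightarrow> real) set)"
    unfolding ucc_open_def by (auto intro!: exI[of _ "{}"] exI[of _ "1::real"])
  then show "(cont_functions :: ('b \<Rightarrow> real) set) \<subseteq> topspace ucc_topology"
    unfolding openin_ucc_topology[symmetric] by (rule openin_subset)
qed

definition positive_ucc_topology :: "('b::topological_space \<Rightarrow> real) topology" where
  "positive_ucc_topology = subtopology ucc_topology {q. \<forall>z. 0 < q z}"

definition prob_measures :: "'a::topological_space measure set" where
  "prob_measures = {\<mu>. sets \<mu> = sets borel \<and> prob_space \<mu>}"

text \<open>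
  The norm of the difference of two probability measures,
  \<open>\<integral>\<phi> d(\<mu> - \<mu>') = \<integral>\<phi> d\<mu> - \<integral>\<phi> d\<mu>'\<close>. The value \<open>0\<close> off
  \<open>prob_measures\<close> merely suits the locale \<open>Metric_space\<close>, which wants symmetry and
  nonnegativity on the whole type.
\<close>

definition strong_dist :: "'a::topological_space measure \<Rightarrow> 'a measure \<Rightarrow> real" where
  "strong_dist \<mu> \<mu>' =
     (if \<mu> \<in> prob_measures \<and> \<mu>' \<in> prob_measures
      then SUP \<phi>\<in>{\<phi>. continuous_on UNIV \<phi> \<and> (\<forall>x. \<bar>\<phi> x\<bar> \<le> 1)}. (\<integral>x. \<phi> x \<partial>\<mu>) - (\<integral>x. \<phi> x \<partial>\<mu>')
      else 0)"

lemma integrable_test_function: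
  assumes "\<mu> \<in> prob_measures" "continuous_on UNIV \<phi>" "\<forall>x. \<bar>\<phi> x\<bar> \<le> (1::real)"
  shows "integrable \<mu> \<phi>" "\<bar>\<integral>x. \<phi> x \<partial>\<mu>\<bar> \<le> 1"
proof -
  interpret prob_space \<mu> using assms by (simp add: prob_measures_def)
  have [measurable_cong]: "sets \<mu> = sets borel" using assms by (simp add: prob_measures_def)
  have [measurable]: "\<phi> \<in> borel_measurable borel"
    using assms(2) by (rule borel_measurable_continuous_onI)
  have "\<phi> \<in> borel_measurable \<mu>" by measurable
  then show i: "integrable \<mu> \<phi>"
    by (rule integrable_const_bound[where B=1, rotated]) (use assms in auto)
  have "\<bar>\<integral>x. \<phi> x \<partial>\<mu>\<bar> \<le> (\<integral>x. \<bar>\<phi> x\<bar> \<partial>\<mu>)"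
    by (rule integral_abs_bound)
  also have "\<dots> \<le> (\<integral>x. 1 \<partial>\<mu>)"
    by (rule integral_mono) (use assms i in auto)
  finally show "\<bar>\<integral>x. \<phi> x \<partial>\<mu>\<bar> \<le> 1" by (simp add: prob_space)
qed

lemma bdd_above_strong_dist:
  assumes "\<mu> \<in> prob_measures" "\<mu>' \<in> prob_measures"
  shows "bdd_above ((\<lambda>\<phi>. (\<integral>x. \<phi> x \<partial>\<mu>) - (\<integral>x. \<phi> x \<partial>\<mu>'))
           ` {\<phi>. continuous_on UNIV \<phi> \<and> (\<forall>x. \<bar>\<phi> x\<bar> \<le> (1::real))})"
proof (rule bdd_aboveI2[where M=2], safe)
  fix \<phi> :: "'a \<Rightarrow> real"
  assume "continuous_on UNIV \<phi>" "\<forall>x. \<bar>\<phi> x\<bar> \<le> 1"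
  then show "(\<integral>x. \<phi> x \<partial>\<mu>) - (\<integral>x. \<phi> x \<partial>\<mu>') \<le> 2"
    using integrable_test_function(2)[OF assms(1), of \<phi>] integrable_test_function(2)[OF assms(2), of \<phi>]
    by auto
qed

lemma strong_dist_upper:
  assumes "\<mu> \<in> prob_measures" "\<mu>' \<in> prob_measures"
    and "continuous_on UNIV \<phi>" "\<forall>x. \<bar>\<phi> x\<bar> \<le> (1::real)"
  shows "(\<integral>x. \<phi> x \<partial>\<mu>) - (\<integral>x. \<phi> x \<partial>\<mu>') \<le> strong_dist \<mu> \<mu>'"
proof -
  have "(\<integral>x. \<phi> x \<partial>\<mu>) - (\<integral>x. \<phi> x \<partial>\<mu>') \<le>
      (SUP \<phi>\<in>{\<phi>. continuous_on UNIV \<phi> \<and> (\<forall>x. \<bar>\<phi> x\<bar> \<le> (1::real))}. (\<integral>x. \<phi> x \<partial>\<mu>) - (\<integral>x. \<phi> x \<partial>\<mu>'))"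
    by (rule cSUP_upper[OF _ bdd_above_strong_dist[OF assms(1,2)]]) (use assms(3,4) in simp)
  then show ?thesis
    unfolding strong_dist_def if_P[OF conjI[OF assms(1,2)]] .
qed

lemma strong_dist_least:
  assumes \<mu>: "\<mu> \<in> prob_measures" "\<mu>' \<in> prob_measures"
    and le: "\<And>\<phi>. continuous_on UNIV \<phi> \<Longrightarrow> \<forall>x. \<bar>\<phi> x\<bar> \<le> (1::real) \<Longrightarrow>
             (\<integral>x. \<phi> x \<partial>\<mu>) - (\<integral>x. \<phi> x \<partial>\<mu>') \<le> c"
  shows "strong_dist \<mu> \<mu>' \<le> c"
  unfolding strong_dist_def if_P[OF conjI[OF \<mu>]]
proof (rule cSUP_least)
  show "{\<phi>. continuous_on UNIV \<phi> \<and> (\<forall>x. \<bar>\<phi> x\<bar> \<le> (1::real))} \<noteq> {}"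
    by (auto intro!: exI[of _ "\<lambda>_. 0"])
qed (use le in auto)

lemma prob_measures_eqI:
  fixes \<mu> \<mu>' :: "'a::metric_space measure"
  assumes \<mu>: "\<mu> \<in> prob_measures" "\<mu>' \<in> prob_measures"
    and eq: "\<And>\<phi>. continuous_on UNIV \<phi> \<Longrightarrow> \<forall>x. \<bar>\<phi> x\<bar> \<le> (1::real) \<Longrightarrow>
             (\<integral>x. \<phi> x \<partial>\<mu>) = (\<integral>x. \<phi> x \<partial>\<mu>')"
  shows "\<mu> = \<mu>'"
proof -
  have lim: "(\<lambda>n. \<integral>x. max 0 (1 - real n * infdist x F) \<partial>\<rho>) \<longlonglongrightarrow> measure \<rho> F"
    if F: "closed F" "F \<noteq> {}" and \<rho>: "\<rho> \<in> prob_measures" for F and \<rho> :: "'a measure"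
  proof -
    interpret prob_space \<rho> using \<rho> by (simp add: prob_measures_def)
    have s[measurable_cong]: "sets \<rho> = sets borel" using \<rho> by (simp add: prob_measures_def)
    have [measurable]: "F \<in> sets \<rho>" using F s by simp
    have "(\<lambda>n. \<integral>x. max 0 (1 - real n * infdist x F) \<partial>\<rho>) \<longlonglongrightarrow> (\<integral>x. indicat_real F x \<partial>\<rho>)"
    proof (rule integral_dominated_convergence[where w="\<lambda>_. 1"])
      show "(\<lambda>x. max 0 (1 - real n * infdist x F)) \<in> borel_measurable \<rho>" for n
        unfolding measurable_cong_sets[OF s refl]
        by (intro borel_measurable_continuous_onI continuous_intros)
      show "AE x in \<rho>. (\<lambda>n. max 0 (1 - real n * infdist x F)) \<longlonglongrightarrow> indicat_real F x"
      proof (rule AE_I2)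
        fix x
        show "(\<lambda>n. max 0 (1 - real n * infdist x F)) \<longlonglongrightarrow> indicat_real F x"
        proof (cases "x \<in> F")
          case True then show ?thesis by simp
        next
          case False
          then have pos: "infdist x F > 0"
            using F by (metis in_closed_iff_infdist_zero infdist_nonneg less_eq_real_def)
          obtain N where N: "1 / infdist x F < real N" using reals_Archimedean2 by blast
          have "max 0 (1 - real n * infdist x F) = 0" if "n \<ge> N" for n
          proof -
            have "1 / infdist x F \<le> real n" using N that by linarith
            then show ?thesis using pos by (simp add: field_simps)
          qed
          then have "\<forall>\<^sub>F n in sequentially. max 0 (1 - real n * infdist x F) = 0"
            by (auto simp: eventually_sequentially)
          then show ?thesis using False by (simp add: tendsto_eventually)
        qed
      qed
      show "AE x in \<rho>. norm (max 0 (1 - real n * infdist x F)) \<le> 1" for n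
        by (auto simp: infdist_nonneg)
    qed auto
    then show ?thesis by simp
  qed
  have cl: "measure \<mu> F = measure \<mu>' F" if F: "closed F" for F
  proof (cases "F = {}")
    case False
    have "(\<integral>x. max 0 (1 - real n * infdist x F) \<partial>\<mu>) = (\<integral>x. max 0 (1 - real n * infdist x F) \<partial>\<mu>')" for n
      by (rule eq) (auto intro!: continuous_intros simp: infdist_nonneg)
    then show ?thesis
      using lim[OF F False \<mu>(1)] lim[OF F False \<mu>(2)] by (intro LIMSEQ_unique) simp_all
  qed simp
  interpret P: prob_space \<mu> using \<mu> by (simp add: prob_measures_def)
  interpret P': prob_space \<mu>' using \<mu> by (simp add: prob_measures_def)
  show ?thesis
  proof (rule measure_eqI_generator_eq[where E="Collect closed" and \<Omega>=UNIV and A="\<lambda>_. UNIV"])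
    show "sets \<mu> = sigma_sets UNIV (Collect closed)" "sets \<mu>' = sigma_sets UNIV (Collect closed)"
      using \<mu> by (simp_all add: prob_measures_def borel_eq_closed)
    show "emeasure \<mu> X = emeasure \<mu>' X" if "X \<in> Collect closed" for X
      using cl that by (simp add: P.emeasure_eq_measure P'.emeasure_eq_measure)
  qed (auto simp: Int_stable_def)
qed

lemma Metric_space_strong_dist:
  "Metric_space (prob_measures :: 'a::metric_space measure set) strong_dist"
proof -
  have nonneg: "0 \<le> strong_dist \<mu> \<mu>'"
    if "\<mu> \<in> prob_measures" "\<mu>' \<in> prob_measures" for \<mu> \<mu>' :: "'a measure"
    using strong_dist_upper[OF that, of "\<lambda>_. 0"] by simp
  have le: "strong_dist \<mu> \<mu>' \<le> strong_dist \<mu>' \<mu>"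
    if "\<mu> \<in> prob_measures" "\<mu>' \<in> prob_measures" for \<mu> \<mu>' :: "'a measure"
  proof (rule strong_dist_least[OF that(1,2)])
    fix \<phi> :: "'a \<Rightarrow> real"
    assume "continuous_on UNIV \<phi>" "\<forall>x. \<bar>\<phi> x\<bar> \<le> 1"
    then show "(\<integral>x. \<phi> x \<partial>\<mu>) - (\<integral>x. \<phi> x \<partial>\<mu>') \<le> strong_dist \<mu>' \<mu>"
      using strong_dist_upper[OF that(2,1), of "\<lambda>x. - \<phi> x"] by (auto intro: continuous_intros)
  qed
  have dom: "strong_dist \<mu> \<mu>' = strong_dist \<mu>' \<mu>"
    if "\<mu> \<in> prob_measures" "\<mu>' \<in> prob_measures" for \<mu> \<mu>' :: "'a measure"
    using le that by (meson order_antisym)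
  have tri: "strong_dist \<mu> \<rho> \<le> strong_dist \<mu> \<mu>' + strong_dist \<mu>' \<rho>"
    if "\<mu> \<in> prob_measures" "\<mu>' \<in> prob_measures" "\<rho> \<in> prob_measures" for \<mu> \<mu>' \<rho> :: "'a measure"
  proof (rule strong_dist_least[OF that(1,3)])
    fix \<phi> :: "'a \<Rightarrow> real"
    assume "continuous_on UNIV \<phi>" "\<forall>x. \<bar>\<phi> x\<bar> \<le> 1"
    then show "(\<integral>x. \<phi> x \<partial>\<mu>) - (\<integral>x. \<phi> x \<partial>\<rho>) \<le> strong_dist \<mu> \<mu>' + strong_dist \<mu>' \<rho>"
      using strong_dist_upper[OF that(1,2), of \<phi>] strong_dist_upper[OF that(2,3), of \<phi>] by auto
  qed
  have zero: "\<mu> = \<mu>'"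
    if "\<mu> \<in> prob_measures" "\<mu>' \<in> prob_measures" "strong_dist \<mu> \<mu>' = 0" for \<mu> \<mu>' :: "'a measure"
  proof (rule prob_measures_eqI[OF that(1,2)])
    fix \<phi> :: "'a \<Rightarrow> real"
    assume "continuous_on UNIV \<phi>" "\<forall>x. \<bar>\<phi> x\<bar> \<le> 1"
    then show "(\<integral>x. \<phi> x \<partial>\<mu>) = (\<integral>x. \<phi> x \<partial>\<mu>')"
      using strong_dist_upper[OF that(1,2), of \<phi>] strong_dist_upper[OF that(2,1), of \<phi>]
        that(3) dom[OF that(1,2)] by auto
  qed
  have refl: "strong_dist \<mu> \<mu> = 0" if "\<mu> \<in> prob_measures" for \<mu> :: "'a measure"
    using nonneg[OF that that] strong_dist_least[OF that that, of 0] by auto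
  show ?thesis
  proof
    fix \<mu> \<mu>' \<rho> :: "'a measure"
    show "0 \<le> strong_dist \<mu> \<mu>'"
      by (cases "\<mu> \<in> prob_measures \<and> \<mu>' \<in> prob_measures") (use nonneg in \<open>auto simp: strong_dist_def\<close>)
    show "strong_dist \<mu> \<mu>' = strong_dist \<mu>' \<mu>"
      by (cases "\<mu> \<in> prob_measures \<and> \<mu>' \<in> prob_measures") (use dom in \<open>auto simp: strong_dist_def\<close>)
    show "strong_dist \<mu> \<mu>' = 0 \<longleftrightarrow> \<mu> = \<mu>'" if "\<mu> \<in> prob_measures" "\<mu>' \<in> prob_measures"
      using zero[OF that] refl[OF that(1)] by auto
    show "strong_dist \<mu> \<rho> \<le> strong_dist \<mu> \<mu>' + strong_dist \<mu>' \<rho>"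
      if "\<mu> \<in> prob_measures" "\<mu>' \<in> prob_measures" "\<rho> \<in> prob_measures"
      using that by (rule tri)
  qed
qed

definition strong_topology :: "'a::topological_space measure topology" where
  "strong_topology = Metric_space.mtopology prob_measures strong_dist"

text \<open>
  Such a sequence exists iff the space is sigma-compact; the value \<open>A 0\<close> is never used.
\<close>

definition compact_exhaustion :: "(nat \<Rightarrow> 'a::topological_space set) \<Rightarrow> bool" where
  "compact_exhaustion A \<longleftrightarrow>
     (\<forall>n\<ge>1. compact (A n)) \<and> mono_on {1..} A \<and> (\<Union>n\<in>{1..}. A n) = UNIV \<and>
     (compact (UNIV :: 'a set) \<longrightarrow> A 1 = UNIV)"

definition schroedinger_solution ::
  "('a::topological_space \<times> 'a \<Rightarrow> real) \<Rightarrow> 'a measure \<Rightarrow> 'a measure \<Rightarrow> 'a measure \<Rightarrow> 'a measure \<Rightarrow> bool" where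
  "schroedinger_solution q \<mu>1 \<mu>2 \<nu>1 \<nu>2 \<longleftrightarrow>
     sets \<nu>1 = sets borel \<and> sigma_finite_measure \<nu>1 \<and>
     sets \<nu>2 = sets borel \<and> sigma_finite_measure \<nu>2 \<and>
     \<mu>1 = density \<nu>1 (\<lambda>x1. \<integral>\<^sup>+x2. ennreal (q (x1, x2)) \<partial>\<nu>2) \<and>
     \<mu>2 = density \<nu>2 (\<lambda>x2. \<integral>\<^sup>+x1. ennreal (q (x1, x2)) \<partial>\<nu>1)"

definition first_charged_index :: "(nat \<Rightarrow> 'a set) \<Rightarrow> 'a measure \<Rightarrow> 'a measure \<Rightarrow> nat" where
  "first_charged_index A \<mu>1 \<mu>2 = (LEAST n. 1 \<le> n \<and> measure \<mu>1 (A n) * measure \<mu>2 (A n) > 0)"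

definition schroedinger_pair ::
  "(nat \<Rightarrow> 'a::topological_space set) \<Rightarrow> ('a \<times> 'a \<Rightarrow> real) \<Rightarrow> 'a measure \<Rightarrow> 'a measure \<Rightarrow>
     'a measure \<times> 'a measure" where
  "schroedinger_pair A q \<mu>1 \<mu>2 =
     (THE (\<nu>1, \<nu>2). schroedinger_solution q \<mu>1 \<mu>2 \<nu>1 \<nu>2 \<and>
        emeasure \<nu>1 (A (first_charged_index A \<mu>1 \<mu>2)) = emeasure \<nu>2 (A (first_charged_index A \<mu>1 \<mu>2)))"

text \<open>In \<open>schroedinger_nu\<close> and \<open>schroedinger_u\<close> the index \<open>i\<close> ranges over \<open>{1, 2}\<close>.\<close>

definition schroedinger_nu ::
  "(nat \<Rightarrow> 'a::topological_space set) \<Rightarrow> nat \<Rightarrow> ('a \<times> 'a \<Rightarrow> real) \<Rightarrow> 'a measure \<Rightarrow> 'a measure \<Rightarrow>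
     'a measure" where
  "schroedinger_nu A i q \<mu>1 \<mu>2 = (if i = 1 then fst (schroedinger_pair A q \<mu>1 \<mu>2) else snd (schroedinger_pair A q \<mu>1 \<mu>2))"

definition log_ennreal :: "ennreal \<Rightarrow> ereal" where
  "log_ennreal r =
     (if r = 0 then -\<infinity> else if r = \<infinity> then \<infinity> else ereal (ln (enn2real r)))"

definition schroedinger_u ::
  "(nat \<Rightarrow> 'a::topological_space set) \<Rightarrow> nat \<Rightarrow> 'a \<Rightarrow> ('a \<times> 'a \<Rightarrow> real) \<Rightarrow> 'a measure \<Rightarrow> 'a measure \<Rightarrow>
     ereal" where
  "schroedinger_u A i x q \<mu>1 \<mu>2 =
     (if i = 1 then log_ennreal (\<integral>\<^sup>+x2. ennreal (q (x, x2)) \<partial>schroedinger_nu A 2 q \<mu>1 \<mu>2)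
      else log_ennreal (\<integral>\<^sup>+x1. ennreal (q (x1, x)) \<partial>schroedinger_nu A 1 q \<mu>1 \<mu>2))"

definition C0_functions :: "('a::topological_space \<Rightarrow> real) set" where
  "C0_functions = {f. continuous_on UNIV f \<and> compact (closure {x. f x \<noteq> 0})}"

definition data_topology ::
  "(('a::topological_space \<times> 'a \<Rightarrow> real) \<times> 'a measure \<times> 'a measure) topology" where
  "data_topology =
     prod_topology positive_ucc_topology (prod_topology strong_topology strong_topology)"

end

theory Submission
  imports Defs
begin

text \<open>
  A solution amounts to densities \<open>a, b\<close> with respect to \<open>\<mu>1, \<mu>2\<close> such that the measure
  \<open>q(x,y) a(x) b(y) \<mu>1(dx) \<mu>2(dy)\<close> has marginals \<open>\<mu>1, \<mu>2\<close>. Testing the difference of two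
  such (possibly only approximate) scalings against \<open>(a - a') / (a + a') + (b - b') / (b + b')\<close>
  bounds the integral of \<open>2 q (a b - a' b')^2 / ((a + a') (b + b'))\<close> by the total variation distance
  of the marginals. For exact solutions this is uniqueness. A sequence of normalized
  approximate solutions whose marginals converge in total variation is therefore Cauchy in \<open>L^1\<close> over
  each compact \<open>A n\<close>, and it converges as a whole to a solution, because tightness of the marginals
  keeps mass from escaping.

  Approximate solutions come from Sinkhorn's iteration for the restrictions to \<open>A n\<close>, which contracts
  by Birkhoff's argument since \<open>q\<close> is bounded above and below there. Each iterate depends
  continuously on \<open>(q, \<mu>1, \<mu>2)\<close>, and the number of iterations needed is a measurable function of the
  data. Hence integrals against the solution are pointwise limits of measurable functions on each of the
  countably many Borel sets where the normalizing index is constant.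
\<close>

section \<open>Stability of scalings\<close>

lemma integrable_bounded_mult:
  fixes H u :: "'b \<Rightarrow> real"
  assumes "integrable M H" "u \<in> borel_measurable M" "\<And>z. \<bar>u z\<bar> \<le> 1"
  shows "integrable M (\<lambda>z. u z * H z)"
proof (rule Bochner_Integration.integrable_bound[OF assms(1)])
  show "(\<lambda>z. u z * H z) \<in> borel_measurable M"
    using assms by measurable
  show "AE z in M. norm (u z * H z) \<le> norm (H z)"
    by (intro AE_I2) (auto simp: abs_mult intro!: mult_left_le_one_le assms)
qed

locale compact_cover =
  fixes K :: "nat \<Rightarrow> 'a::metric_space set"
  assumes compact_K: "compact (K n)"
    and mono_K: "m \<le> n \<Longrightarrow> K m \<subseteq> K n"
    and UN_K: "(\<Union>n. K n) = UNIV"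
begin

lemma K_borel [measurable]: "K n \<in> sets borel"
  using compact_K compact_imp_closed borel_closed by blast

abbreviation "ind j \<equiv> indicat_real (K j)"

lemma obtain_dense_sequence:
  obtains D :: "nat \<Rightarrow> 'a" where "\<And>x e. 0 < e \<Longrightarrow> \<exists>n. dist x (D n) < e"
proof -
  have "\<exists>F. finite F \<and> K n \<subseteq> (\<Union>x\<in>F. ball x (1 / real (Suc m)))" for n m
    using compact_K[of n] unfolding compact_eq_totally_bounded by auto
  then obtain F where F: "\<And>n m. finite (F n m)" "\<And>n m. K n \<subseteq> (\<Union>x\<in>F n m. ball x (1 / real (Suc m)))"
    by metis
  define T where "T = (\<Union>n m. F n m)"
  have T: "\<exists>t\<in>T. dist x t < e" if "0 < e" for x e
  proof -
    obtain n where "x \<in> K n" using UN_K by auto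
    obtain m where m: "1 / real (Suc m) < e" by (rule nat_approx_posE[OF \<open>0 < e\<close>])
    have "x \<in> (\<Union>x\<in>F n m. ball x (1 / real (Suc m)))"
      using F(2)[of n m] \<open>x \<in> K n\<close> by blast
    then obtain t where "t \<in> F n m" "dist t x < 1 / real (Suc m)"
      unfolding UN_iff mem_ball by blast
    moreover have "t \<in> T" using \<open>t \<in> F n m\<close> unfolding T_def by blast
    ultimately show ?thesis using m by (metis dist_commute less_trans)
  qed
  have "T \<noteq> {}" using T[of 1] by auto
  moreover have "countable T" unfolding T_def using countable_finite[OF F(1)] by (intro countable_UN) auto
  ultimately have "range (from_nat_into T) = T" by simp
  then have "\<exists>n. dist x (from_nat_into T n) < e" if "0 < e" for x e
    using T[OF that, of x] by (metis imageE)
  then show thesis by (rule that)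
qed

lemma tendsto_measure_K:
  assumes "prob_space \<mu>" and sets: "sets \<mu> = sets borel"
  shows "(\<lambda>n. measure \<mu> (K n)) \<longlonglongrightarrow> 1" "(\<lambda>n. measure \<mu> (- K n)) \<longlonglongrightarrow> 0"
proof -
  interpret prob_space \<mu> by fact
  have sp: "space \<mu> = UNIV" using sets_eq_imp_space_eq[OF sets] by simp
  have "(\<lambda>n. measure \<mu> (K n)) \<longlonglongrightarrow> measure \<mu> (\<Union>n. K n)"
    by (rule finite_Lim_measure_incseq) (use mono_K in \<open>auto simp: incseq_def sets\<close>)
  then show lim: "(\<lambda>n. measure \<mu> (K n)) \<longlonglongrightarrow> 1"
    using prob_space by (simp add: UN_K sp)
  have "measure \<mu> (- K n) = 1 - measure \<mu> (K n)" for n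
    using prob_compl[of "K n"] by (simp add: Compl_eq_Diff_UNIV sets sp)
  then show "(\<lambda>n. measure \<mu> (- K n)) \<longlonglongrightarrow> 0"
    using tendsto_diff[OF tendsto_const[of "1::real"] lim] by simp
qed

text \<open>
  The type \<open>'a\<close> is not in the class of second countable spaces, so the library's identification
  of the Borel sets of a product with the product sigma-algebra is not available here.
\<close>

lemma borel_measurable_pair_continuous:
  fixes q :: "'a \<times> 'a \<Rightarrow> real"
  assumes q: "continuous_on UNIV q"
  shows "q \<in> borel_measurable (borel \<Otimes>\<^sub>M borel)"
proof -
  obtain D :: "nat \<Rightarrow> 'a" where D: "\<And>x e. 0 < e \<Longrightarrow> \<exists>n. dist x (D n) < e"
    by (rule obtain_dense_sequence) blast
  define idx where "idx m x = (LEAST n. dist x (D n) < 1 / real (Suc m))" for m x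
  have dist_idx: "dist x (D (idx m x)) < 1 / real (Suc m)" for m x
    unfolding idx_def by (rule LeastI_ex) (use D in auto)
  have [measurable]: "(\<lambda>x. dist x (D n)) \<in> borel_measurable borel" for n
    by (intro borel_measurable_continuous_onI continuous_intros)
  have [measurable]: "idx m \<in> borel \<rightarrow>\<^sub>M count_space UNIV" for m
    unfolding idx_def by measurable
  have [measurable]: "(\<lambda>y. q (D i, y)) \<in> borel_measurable borel" for i
    by (intro borel_measurable_continuous_onI continuous_intros continuous_on_compose2[OF q]) auto
  have meas: "(\<lambda>z. q (D (idx m (fst z)), snd z)) \<in> borel_measurable (borel \<Otimes>\<^sub>M borel)" for m
    by (rule measurable_compose_countable[where f="\<lambda>i z. q (D i, snd z)" and g="\<lambda>z. idx m (fst z)"])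
      measurable
  show ?thesis
  proof (rule borel_measurable_LIMSEQ_real[OF _ meas])
    fix z :: "'a \<times> 'a"
    have "(\<lambda>m. dist (D (idx m (fst z))) (fst z)) \<longlonglongrightarrow> 0"
    proof (rule Lim_null_comparison)
      show "\<forall>\<^sub>F m in sequentially. norm (dist (D (idx m (fst z))) (fst z)) \<le> 1 / real (Suc m)"
        using less_imp_le[OF dist_idx[of "fst z"]] by (simp add: dist_commute)
      show "(\<lambda>m. 1 / real (Suc m)) \<longlonglongrightarrow> 0"
        by (rule LIMSEQ_Suc[OF lim_const_over_n])
    qed
    then have "(\<lambda>m. D (idx m (fst z))) \<longlonglongrightarrow> fst z"
      using tendsto_dist_iff by blast
    then have "(\<lambda>m. (D (idx m (fst z)), snd z)) \<longlonglongrightarrow> (fst z, snd z)"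
      by (intro tendsto_intros)
    then show "(\<lambda>m. q (D (idx m (fst z)), snd z)) \<longlonglongrightarrow> q z"
      using continuous_on_tendsto_compose[OF q, of _ z sequentially] by simp
  qed
qed

end

locale schroedinger_problem = compact_cover K + M1: prob_space \<mu>1 + M2: prob_space \<mu>2
  for K :: "nat \<Rightarrow> 'a::metric_space set" and q :: "'a \<times> 'a \<Rightarrow> real" and \<mu>1 \<mu>2 :: "'a measure" +
  assumes sets_\<mu>1 [measurable_cong]: "sets \<mu>1 = sets borel"
    and sets_\<mu>2 [measurable_cong]: "sets \<mu>2 = sets borel"
    and continuous_q: "continuous_on UNIV q"
    and q_pos: "0 < q z"
begin

sublocale pair_prob_space \<mu>1 \<mu>2 ..

abbreviation "\<pi> \<equiv> \<mu>1 \<Otimes>\<^sub>M \<mu>2"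

lemma q_measurable [measurable]: "q \<in> borel_measurable (borel \<Otimes>\<^sub>M borel)"
  by (rule borel_measurable_pair_continuous[OF continuous_q])

lemma swap: "schroedinger_problem K (\<lambda>(x, y). q (y, x)) \<mu>2 \<mu>1"
  by unfold_locales
    (use q_pos in \<open>auto simp: sets_\<mu>1 sets_\<mu>2 split_beta
       intro!: continuous_intros continuous_on_compose2[OF continuous_q]\<close>)

lemma q_bounds:
  obtains m M where "0 < m" "m \<le> M" "\<And>x y. x \<in> K j \<Longrightarrow> y \<in> K j \<Longrightarrow> m \<le> q (x, y) \<and> q (x, y) \<le> M"
proof (cases "K j = {}")
  case False
  have c: "compact (K j \<times> K j)" by (intro compact_Times compact_K)
  have n: "K j \<times> K j \<noteq> {}" using False by auto
  have q: "continuous_on (K j \<times> K j) q" using continuous_q continuous_on_subset by blast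
  obtain z1 z2 where "z1 \<in> K j \<times> K j" "z2 \<in> K j \<times> K j"
    "\<forall>z\<in>K j \<times> K j. q z1 \<le> q z" "\<forall>z\<in>K j \<times> K j. q z \<le> q z2"
    using continuous_attains_inf[OF c n q] continuous_attains_sup[OF c n q] by blast
  then show thesis using that[of "q z1" "q z2"] q_pos by auto
qed (use that[of 1 1] in auto)

text \<open>
  The sum of the test functions \<open>(a - a') / (a + a')\<close> and \<open>(b - b') / (b + b')\<close> is
  \<open>2 (a b - a' b') / ((a + a') (b + b'))\<close>.
\<close>

lemma scaling_stability:
  assumes [measurable]: "a \<in> borel_measurable borel" "b \<in> borel_measurable borel"
      "a' \<in> borel_measurable borel" "b' \<in> borel_measurable borel"
    and nonneg: "\<And>x. 0 \<le> a x" "\<And>x. 0 \<le> b x" "\<And>x. 0 \<le> a' x" "\<And>x. 0 \<le> b' x"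
    and i: "integrable \<pi> (\<lambda>(x, y). q (x, y) * (a x * b y))"
    and i': "integrable \<pi> (\<lambda>(x, y). q (x, y) * (a' x * b' y))"
  shows "2 * (\<integral>\<^sup>+z. ennreal (case z of (x, y) \<Rightarrow> q (x, y) * (a x * b y - a' x * b' y)\<^sup>2 / ((a x + a' x) * (b y + b' y))) \<partial>\<pi>)
    \<le> ennreal ((\<integral>x. \<bar>(\<integral>y. q (x, y) * (a x * b y) \<partial>\<mu>2) - (\<integral>y. q (x, y) * (a' x * b' y) \<partial>\<mu>2)\<bar> \<partial>\<mu>1)
      + (\<integral>y. \<bar>(\<integral>x. q (x, y) * (a x * b y) \<partial>\<mu>1) - (\<integral>x. q (x, y) * (a' x * b' y) \<partial>\<mu>1)\<bar> \<partial>\<mu>2))"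
    (is "2 * (\<integral>\<^sup>+z. ennreal (?g z) \<partial>_) \<le> ennreal (?D1 + ?D2)")
proof -
  define H where "H = (\<lambda>(x, y). q (x, y) * (a x * b y) - q (x, y) * (a' x * b' y))"
  define T where "T x = (a x - a' x) / (a x + a' x)" for x
  define U where "U x = (b x - b' x) / (b x + b' x)" for x
  have [measurable]: "T \<in> borel_measurable borel" "U \<in> borel_measurable borel"
    unfolding T_def U_def by measurable
  have T1: "\<bar>T x\<bar> \<le> 1" and U1: "\<bar>U x\<bar> \<le> 1" for x
    using nonneg(1-4)[of x] by (auto simp: T_def U_def divide_simps abs_if)
  have iH: "integrable \<pi> H"
    using Bochner_Integration.integrable_diff[OF i i'] by (simp add: H_def split_beta')
  then have [measurable]: "H \<in> borel_measurable \<pi>" by simp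
  have iT: "integrable \<pi> (\<lambda>(x, y). T x * H (x, y))"
    using integrable_bounded_mult[OF iH, of "\<lambda>z. T (fst z)"] T1 by (simp add: split_beta')
  have iU: "integrable \<pi> (\<lambda>(x, y). U y * H (x, y))"
    using integrable_bounded_mult[OF iH, of "\<lambda>z. U (snd z)"] U1 by (simp add: split_beta')
  have eq: "2 * ?g (x, y) = T x * H (x, y) + U y * H (x, y)" for x y
  proof (cases "a x + a' x = 0 \<or> b y + b' y = 0")
    case True
    then have "(a x = 0 \<and> a' x = 0) \<or> (b y = 0 \<and> b' y = 0)"
      using nonneg(1,3)[of x] nonneg(2,4)[of y] by linarith
    then show ?thesis by (auto simp: H_def)
  next
    case False
    then show ?thesis
      by (simp add: H_def T_def U_def divide_simps power2_eq_square) algebra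
  qed
  have eq': "2 * ?g z = (case z of (x, y) \<Rightarrow> T x * H (x, y)) + (case z of (x, y) \<Rightarrow> U y * H (x, y))" for z
    using eq[of "fst z" "snd z"] by (cases z) (simp only: fst_conv snd_conv prod.case)
  have ig: "integrable \<pi> (\<lambda>z. 2 * ?g z)"
    unfolding eq' by (rule Bochner_Integration.integrable_add[OF iT iU])
  have test: "(\<integral>x. t x * h x \<partial>M) \<le> (\<integral>x. \<bar>h x\<bar> \<partial>M)"
    if "integrable M h" "t \<in> borel_measurable M" "\<And>x. \<bar>t x\<bar> \<le> 1" for M and t h :: "'a \<Rightarrow> real"
  proof (rule integral_mono[OF integrable_bounded_mult[OF that] integrable_abs[OF that(1)]])
    fix x
    have "\<bar>t x * h x\<bar> \<le> \<bar>h x\<bar>" using that(3) by (simp add: abs_mult mult_left_le_one_le)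
    then show "t x * h x \<le> \<bar>h x\<bar>" by linarith
  qed
  have le1: "(\<integral>z. (case z of (x, y) \<Rightarrow> T x * H (x, y)) \<partial>\<pi>) \<le> ?D1"
  proof -
    have "(\<integral>z. (case z of (x, y) \<Rightarrow> T x * H (x, y)) \<partial>\<pi>) = (\<integral>x. T x * (\<integral>y. H (x, y) \<partial>\<mu>2) \<partial>\<mu>1)"
      using integral_fst'[OF iT] by simp
    also have "\<dots> \<le> (\<integral>x. \<bar>\<integral>y. H (x, y) \<partial>\<mu>2\<bar> \<partial>\<mu>1)"
      by (rule test[OF integrable_fst'[OF iH] _ T1]) measurable
    also have "\<dots> = ?D1"
    proof (rule integral_cong_AE)
      have *: "AE x in \<mu>1. integrable \<mu>2 (\<lambda>y. q (x, y) * (a x * b y))"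
        "AE x in \<mu>1. integrable \<mu>2 (\<lambda>y. q (x, y) * (a' x * b' y))"
        using AE_integrable_fst'[OF i] AE_integrable_fst'[OF i'] by simp_all
      show "AE x in \<mu>1. \<bar>\<integral>y. H (x, y) \<partial>\<mu>2\<bar> =
          \<bar>(\<integral>y. q (x, y) * (a x * b y) \<partial>\<mu>2) - (\<integral>y. q (x, y) * (a' x * b' y) \<partial>\<mu>2)\<bar>"
        using * by eventually_elim (simp add: H_def)
    qed measurable
    finally show ?thesis .
  qed
  have le2: "(\<integral>z. (case z of (x, y) \<Rightarrow> U y * H (x, y)) \<partial>\<pi>) \<le> ?D2"
  proof -
    have "(\<integral>z. (case z of (x, y) \<Rightarrow> U y * H (x, y)) \<partial>\<pi>) = (\<integral>y. U y * (\<integral>x. H (x, y) \<partial>\<mu>1) \<partial>\<mu>2)"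
      using integral_snd[OF iU] by simp
    also have "\<dots> \<le> (\<integral>y. \<bar>\<integral>x. H (x, y) \<partial>\<mu>1\<bar> \<partial>\<mu>2)"
      by (rule test[OF integrable_snd[of "\<lambda>x y. H (x, y)"] _ U1]) (use iH in simp, measurable)
    also have "\<dots> = ?D2"
    proof (rule integral_cong_AE)
      have *: "AE y in \<mu>2. integrable \<mu>1 (\<lambda>x. q (x, y) * (a x * b y))"
        "AE y in \<mu>2. integrable \<mu>1 (\<lambda>x. q (x, y) * (a' x * b' y))"
        using AE_integrable_snd[OF i] AE_integrable_snd[OF i'] by simp_all
      show "AE y in \<mu>2. \<bar>\<integral>x. H (x, y) \<partial>\<mu>1\<bar> =
          \<bar>(\<integral>x. q (x, y) * (a x * b y) \<partial>\<mu>1) - (\<integral>x. q (x, y) * (a' x * b' y) \<partial>\<mu>1)\<bar>"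
        using * by eventually_elim (simp add: H_def)
    qed measurable
    finally show ?thesis .
  qed
  have g0: "0 \<le> ?g z" for z
    using q_pos[of z] nonneg by (cases z) (auto intro!: divide_nonneg_nonneg mult_nonneg_nonneg add_nonneg_nonneg)
  have "2 * (\<integral>\<^sup>+z. ennreal (?g z) \<partial>\<pi>) = (\<integral>\<^sup>+z. 2 * ennreal (?g z) \<partial>\<pi>)"
    by (rule nn_integral_cmult[symmetric]) measurable
  also have "\<dots> = (\<integral>\<^sup>+z. ennreal (2 * ?g z) \<partial>\<pi>)"
    using g0 by (subst ennreal_mult) auto
  also have "\<dots> = ennreal (\<integral>z. 2 * ?g z \<partial>\<pi>)"
    by (rule nn_integral_eq_integral[OF ig]) (use g0 in auto)
  also have "\<dots> \<le> ennreal (?D1 + ?D2)"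
    unfolding eq' Bochner_Integration.integral_add[OF iT iU] by (intro ennreal_leI add_mono le1 le2)
  finally show ?thesis .
qed

end

definition marginal_defect ::
  "('a \<times> 'a \<Rightarrow> real) \<Rightarrow> 'a measure \<Rightarrow> 'a measure \<Rightarrow> ('a \<Rightarrow> real) \<Rightarrow> ('a \<Rightarrow> real) \<Rightarrow> real" where
  "marginal_defect q \<mu> \<rho> a b = (\<integral>x. \<bar>(\<integral>y. q (x, y) * (a x * b y) \<partial>\<rho>) - 1\<bar> \<partial>\<mu>)"

lemma marginal_defect_nonneg: "0 \<le> marginal_defect q \<mu> \<rho> a b"
  unfolding marginal_defect_def by simp

context schroedinger_problem
begin

lemma product_integral:
  fixes f g :: "'a \<Rightarrow> real"
  assumes f: "integrable \<mu>1 f" and g: "integrable \<mu>2 g"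
  shows "integrable \<pi> (\<lambda>(x, y). f x * g y)" (is ?thesis1)
    and "(\<integral>(x, y). f x * g y \<partial>\<pi>) = (\<integral>x. f x \<partial>\<mu>1) * (\<integral>y. g y \<partial>\<mu>2)" (is ?thesis2)
proof -
  have [measurable]: "f \<in> borel_measurable \<mu>1" "g \<in> borel_measurable \<mu>2" using f g by auto
  show *: ?thesis1
    by (rule Fubini_integrable) (use f g in \<open>auto simp: abs_mult\<close>)
  show ?thesis2
    using integral_fst'[OF *] by simp
qed

definition admissible :: "('a \<Rightarrow> real) \<Rightarrow> ('a \<Rightarrow> real) \<Rightarrow> bool" where
  "admissible a b \<longleftrightarrow> a \<in> borel_measurable borel \<and> b \<in> borel_measurable borel \<and>
     (\<forall>x. 0 \<le> a x) \<and> (\<forall>x. 0 \<le> b x) \<and>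
     integrable \<pi> (\<lambda>(x, y). q (x, y) * (a x * b y))"

abbreviation "defect1 \<equiv> marginal_defect q \<mu>1 \<mu>2"
abbreviation "defect2 a b \<equiv> marginal_defect (\<lambda>(x, y). q (y, x)) \<mu>2 \<mu>1 b a"

lemma defect2_eq: "defect2 a b = (\<integral>y. \<bar>(\<integral>x. q (x, y) * (a x * b y) \<partial>\<mu>1) - 1\<bar> \<partial>\<mu>2)"
  unfolding marginal_defect_def by (simp add: mult.commute)

lemma rectangle_mass:
  assumes ab: "admissible a b" and [measurable]: "B \<in> sets borel" "C \<in> sets borel"
  shows "\<bar>(\<integral>(x, y). indicator B x * indicator C y * (q (x, y) * (a x * b y)) \<partial>\<pi>) - measure \<mu>1 B\<bar>
    \<le> defect1 a b + defect2 a b + measure \<mu>2 (- C)"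
proof -
  have [measurable]: "a \<in> borel_measurable borel" "b \<in> borel_measurable borel"
    and nonneg: "\<And>x. 0 \<le> a x" "\<And>x. 0 \<le> b x"
    and iH: "integrable \<pi> (\<lambda>(x, y). q (x, y) * (a x * b y))"
    using ab by (auto simp: admissible_def)
  define H where "H = (\<lambda>(x, y). q (x, y) * (a x * b y))"
  define \<alpha> where "\<alpha> x = (\<integral>y. H (x, y) \<partial>\<mu>2)" for x
  define \<beta> where "\<beta> y = (\<integral>x. H (x, y) \<partial>\<mu>1)" for y
  have i: "integrable \<pi> H" using iH by (simp add: H_def)
  have H0: "0 \<le> H z" for z using q_pos[of z] nonneg by (auto simp: H_def split: prod.split)
  have [measurable]: "H \<in> borel_measurable \<pi>" using i by simp
  have i\<alpha>: "integrable \<mu>1 \<alpha>" unfolding \<alpha>_def by (rule integrable_fst'[OF i])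
  have i\<beta>: "integrable \<mu>2 \<beta>" unfolding \<beta>_def using integrable_snd[of "\<lambda>x y. H (x, y)"] i by simp
  have d1: "defect1 a b = (\<integral>x. \<bar>\<alpha> x - 1\<bar> \<partial>\<mu>1)"
    by (simp add: marginal_defect_def \<alpha>_def H_def)
  have d2: "defect2 a b = (\<integral>x. \<bar>\<beta> x - 1\<bar> \<partial>\<mu>2)"
    by (simp add: defect2_eq \<beta>_def H_def)
  have iB: "integrable \<pi> (\<lambda>z. indicator B (fst z) * H z)"
    by (rule integrable_bounded_mult[OF i]) (auto simp: indicator_def)
  have iC: "integrable \<pi> (\<lambda>z. indicator (- C) (snd z) * H z)"
    by (rule integrable_bounded_mult[OF i]) (auto simp: indicator_def)
  have iBC: "integrable \<pi> (\<lambda>z. (indicator B (fst z) * indicator C (snd z)) * H z)"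
    by (rule integrable_bounded_mult[OF i]) (auto simp: indicator_def)
  have eB: "(\<integral>z. indicator B (fst z) * H z \<partial>\<pi>) = (\<integral>x. indicator B x * \<alpha> x \<partial>\<mu>1)"
    using integral_fst'[OF iB] by (simp add: \<alpha>_def)
  have eC: "(\<integral>z. indicator (- C) (snd z) * H z \<partial>\<pi>) = (\<integral>y. indicator (- C) y * \<beta> y \<partial>\<mu>2)"
    using integral_snd[of "\<lambda>x y. indicator (- C) y * H (x, y)"] iC by (simp add: \<beta>_def split_beta')
  have iB\<alpha>: "integrable \<mu>1 (\<lambda>x. indicator B x * \<alpha> x)"
    by (rule integrable_bounded_mult[OF i\<alpha>]) (auto simp: indicator_def)
  have iC\<beta>: "integrable \<mu>2 (\<lambda>x. indicator (- C) x * \<beta> x)"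
    by (rule integrable_bounded_mult[OF i\<beta>]) (auto simp: indicator_def)
  have iB1: "integrable \<mu>1 (indicat_real B)" "(\<integral>x. indicat_real B x \<partial>\<mu>1) = measure \<mu>1 B"
    by (auto simp: M1.emeasure_eq_measure)
  have iC1: "integrable \<mu>2 (indicat_real (- C))" "(\<integral>x. indicat_real (- C) x \<partial>\<mu>2) = measure \<mu>2 (- C)"
    by (auto simp: M2.emeasure_eq_measure)
  have 1: "\<bar>(\<integral>x. indicator B x * \<alpha> x \<partial>\<mu>1) - measure \<mu>1 B\<bar> \<le> defect1 a b"
  proof -
    have "(\<integral>x. indicator B x * \<alpha> x \<partial>\<mu>1) - measure \<mu>1 B = (\<integral>x. indicator B x * \<alpha> x - indicator B x \<partial>\<mu>1)"
      using iB1 iB\<alpha> by simp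
    also have "\<bar>\<dots>\<bar> \<le> (\<integral>x. \<bar>indicator B x * \<alpha> x - indicator B x\<bar> \<partial>\<mu>1)"
      by (rule integral_abs_bound)
    also have "\<dots> \<le> defect1 a b"
      unfolding d1
    proof (rule integral_mono)
      show "integrable \<mu>1 (\<lambda>x. \<bar>indicator B x * \<alpha> x - indicator B x\<bar>)"
        using iB1(1) iB\<alpha> by (intro integrable_abs Bochner_Integration.integrable_diff)
      show "integrable \<mu>1 (\<lambda>x. \<bar>\<alpha> x - 1\<bar>)"
        using i\<alpha> by (intro integrable_abs Bochner_Integration.integrable_diff) auto
    qed (auto simp: indicator_def)
    finally show ?thesis .
  qed
  have 2: "(\<integral>y. indicator (- C) y * \<beta> y \<partial>\<mu>2) \<le> measure \<mu>2 (- C) + defect2 a b"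
  proof -
    have "(\<integral>y. indicator (- C) y * \<beta> y \<partial>\<mu>2) \<le> (\<integral>y. indicator (- C) y + \<bar>\<beta> y - 1\<bar> \<partial>\<mu>2)"
    proof (rule integral_mono[OF iC\<beta>])
      show "integrable \<mu>2 (\<lambda>y. indicator (- C) y + \<bar>\<beta> y - 1\<bar>)"
        using i\<beta> iC1(1) by (intro Bochner_Integration.integrable_add integrable_abs Bochner_Integration.integrable_diff) auto
    qed (auto simp: indicator_def)
    also have "\<dots> = measure \<mu>2 (- C) + defect2 a b"
      unfolding d2 iC1(2)[symmetric]
      by (rule Bochner_Integration.integral_add[OF iC1(1)])
        (use i\<beta> in \<open>intro integrable_abs Bochner_Integration.integrable_diff; auto\<close>)
    finally show ?thesis .
  qed
  have 3: "(\<integral>z. (indicator B (fst z) * indicator C (snd z)) * H z \<partial>\<pi>) \<le> (\<integral>z. indicator B (fst z) * H z \<partial>\<pi>)"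
    by (rule integral_mono[OF iBC iB]) (use H0 in \<open>auto simp: indicator_def\<close>)
  have 4: "(\<integral>z. indicator B (fst z) * H z \<partial>\<pi>) \<le>
      (\<integral>z. (indicator B (fst z) * indicator C (snd z)) * H z + indicator (- C) (snd z) * H z \<partial>\<pi>)"
    by (rule integral_mono[OF iB Bochner_Integration.integrable_add[OF iBC iC]]) (use H0 in \<open>auto simp: indicator_def\<close>)
  have "(\<integral>(x, y). indicator B x * indicator C y * (q (x, y) * (a x * b y)) \<partial>\<pi>) =
      (\<integral>z. (indicator B (fst z) * indicator C (snd z)) * H z \<partial>\<pi>)"
    by (simp add: H_def split_beta')
  moreover have "0 \<le> defect2 a b" "0 \<le> measure \<mu>2 (- C)" by (auto simp: marginal_defect_nonneg)
  ultimately show ?thesis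
    using 1 2 3 4 eB eC by (simp add: Bochner_Integration.integral_add[OF iBC iC])
qed

lemma defect_diff:
  assumes "admissible a b" "admissible a' b'"
  shows "(\<integral>x. \<bar>(\<integral>y. q (x, y) * (a x * b y) \<partial>\<mu>2) - (\<integral>y. q (x, y) * (a' x * b' y) \<partial>\<mu>2)\<bar> \<partial>\<mu>1)
    \<le> defect1 a b + defect1 a' b'" (is ?thesis1)
  and "(\<integral>y. \<bar>(\<integral>x. q (x, y) * (a x * b y) \<partial>\<mu>1) - (\<integral>x. q (x, y) * (a' x * b' y) \<partial>\<mu>1)\<bar> \<partial>\<mu>2)
    \<le> defect2 a b + defect2 a' b'" (is ?thesis2)
proof -
  have i: "integrable \<pi> (\<lambda>(x, y). q (x, y) * (a x * b y))"
    "integrable \<pi> (\<lambda>(x, y). q (x, y) * (a' x * b' y))"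
    using assms by (auto simp: admissible_def)
  have *: "(\<integral>x. \<bar>f x - g x\<bar> \<partial>M) \<le> (\<integral>x. \<bar>f x - 1\<bar> \<partial>M) + (\<integral>x. \<bar>g x - 1\<bar> \<partial>M)"
    if "integrable M f" "integrable M g" "prob_space M" for M and f g :: "'a \<Rightarrow> real"
  proof -
    interpret prob_space M by fact
    have i1: "integrable M (\<lambda>x. \<bar>f x - 1\<bar>)" and i2: "integrable M (\<lambda>x. \<bar>g x - 1\<bar>)"
      using that by auto
    have "(\<integral>x. \<bar>f x - g x\<bar> \<partial>M) \<le> (\<integral>x. \<bar>f x - 1\<bar> + \<bar>g x - 1\<bar> \<partial>M)"
      by (rule integral_mono) (use that i1 i2 in auto)
    then show ?thesis
      by (simp add: Bochner_Integration.integral_add[OF i1 i2])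
  qed
  show ?thesis1
    using *[OF integrable_fst'[OF i(1)] integrable_fst'[OF i(2)] M1.prob_space_axioms]
    by (simp add: marginal_defect_def)
  show ?thesis2
    using *[OF integrable_snd[OF i(1)] integrable_snd[OF i(2)] M2.prob_space_axioms]
    by (simp add: defect2_eq)
qed

lemma product_L1_stability:
  assumes ab: "admissible a b" "admissible a' b'"
    and i: "integrable \<mu>1 a" "integrable \<mu>2 b" "integrable \<mu>1 a'" "integrable \<mu>2 b'"
    and m: "0 < m" "\<And>x y. x \<in> K j \<Longrightarrow> y \<in> K j \<Longrightarrow> m \<le> q (x, y)" and \<eta>: "0 < \<eta>"
  shows "(\<integral>(x, y). ind j x * ind j y * \<bar>a x * b y - a' x * b' y\<bar> \<partial>\<pi>)
    \<le> (defect1 a b + defect1 a' b' + (defect2 a b + defect2 a' b')) / (4 * \<eta> * m) +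
      \<eta> / 2 * ((\<integral>x. ind j x * a x \<partial>\<mu>1) + (\<integral>x. ind j x * a' x \<partial>\<mu>1)) *
        ((\<integral>x. ind j x * b x \<partial>\<mu>2) + (\<integral>x. ind j x * b' x \<partial>\<mu>2))"
    (is "(\<integral>z. ?W z \<partial>_) \<le> ?D / _ + \<eta> / 2 * ?P * ?Q")
proof -
  have meas [measurable]: "a \<in> borel_measurable borel" "b \<in> borel_measurable borel"
     "a' \<in> borel_measurable borel" "b' \<in> borel_measurable borel"
    and nonneg: "\<And>x. 0 \<le> a x" "\<And>x. 0 \<le> b x" "\<And>x. 0 \<le> a' x" "\<And>x. 0 \<le> b' x"
    using ab by (auto simp: admissible_def)
  define X where "X = (\<lambda>(x, y). q (x, y) * (a x * b y - a' x * b' y)\<^sup>2 / ((a x + a' x) * (b y + b' y)))"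
  define Y where "Y = (\<lambda>(x, y). (ind j x * (a x + a' x)) * (ind j y * (b y + b' y)))"
  have [measurable]: "X \<in> borel_measurable \<pi>" unfolding X_def by measurable
  have ind: "integrable \<mu>1 (\<lambda>x. ind j x * f x)" if "integrable \<mu>1 f" for f :: "'a \<Rightarrow> real"
    by (rule integrable_bounded_mult[OF that]) (auto simp: indicator_def)
  have ind2: "integrable \<mu>2 (\<lambda>x. ind j x * f x)" if "integrable \<mu>2 f" for f :: "'a \<Rightarrow> real"
    by (rule integrable_bounded_mult[OF that]) (auto simp: indicator_def)
  have iY: "integrable \<pi> Y" "(\<integral>z. Y z \<partial>\<pi>) = ?P * ?Q"
  proof -
    have *: "integrable \<mu>1 (\<lambda>x. ind j x * (a x + a' x))" "integrable \<mu>2 (\<lambda>y. ind j y * (b y + b' y))"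
      by (intro ind ind2 Bochner_Integration.integrable_add i)+
    show "integrable \<pi> Y" unfolding Y_def by (rule product_integral[OF *])
    show "(\<integral>z. Y z \<partial>\<pi>) = ?P * ?Q"
      unfolding Y_def product_integral(2)[OF *]
      using i by (simp add: distrib_left ind ind2)
  qed
  have Y0: "0 \<le> Y z" and X0: "0 \<le> X z" for z
    using nonneg q_pos[of z] by (auto simp: X_def Y_def split: prod.split intro!: divide_nonneg_nonneg mult_nonneg_nonneg add_nonneg_nonneg)
  have le: "?W z \<le> X z / (2 * \<eta> * m) + \<eta> / 2 * Y z" for z
  proof (cases z)
    case [simp]: (Pair x y)
    define s where "s = (a x + a' x) * (b y + b' y)"
    define w where "w = a x * b y - a' x * b' y"
    have s0: "0 \<le> s" unfolding s_def using nonneg by (auto intro!: mult_nonneg_nonneg add_nonneg_nonneg)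
    show ?thesis
    proof (cases "x \<in> K j \<and> y \<in> K j")
      case True
      then have q: "m \<le> q (x, y)" using m by auto
      have "\<bar>w\<bar> \<le> w\<^sup>2 / s / (2 * \<eta>) + \<eta> / 2 * s"
      proof (cases "s = 0")
        case True
        then have "(a x = 0 \<and> a' x = 0) \<or> (b y = 0 \<and> b' y = 0)"
          unfolding s_def using nonneg(1,3)[of x] nonneg(2,4)[of y] by (auto simp: add_nonneg_eq_0_iff)
        then show ?thesis using True by (auto simp: w_def)
      next
        case False
        then have s: "0 < s" using s0 by simp
        have "0 \<le> (\<bar>w\<bar> - \<eta> * s)\<^sup>2" by simp
        then have "2 * \<eta> * s * \<bar>w\<bar> \<le> w\<^sup>2 + (\<eta> * s)\<^sup>2"
          by (simp add: power2_diff algebra_simps)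
        then show ?thesis using s \<eta> by (simp add: field_simps power2_eq_square)
      qed
      also have "w\<^sup>2 / s / (2 * \<eta>) \<le> (q (x, y) / m) * (w\<^sup>2 / s / (2 * \<eta>))"
        using q m(1) s0 \<eta> mult_right_mono[of 1 "q (x, y) / m" "w\<^sup>2 / s / (2 * \<eta>)"] by simp
      also have "\<dots> = X z / (2 * \<eta> * m)"
        by (simp add: X_def w_def s_def)
      finally show ?thesis using True by (simp add: Y_def w_def s_def)
    next
      case False
      then have "?W z = 0" by (auto simp: indicator_def)
      moreover have "0 \<le> X z / (2 * \<eta> * m) + \<eta> / 2 * Y z"
        using X0[of z] Y0[of z] m(1) \<eta> by simp
      ultimately show ?thesis by linarith
    qed
  qed
  have iW: "integrable \<pi> ?W"
  proof -
    have "integrable \<pi> (\<lambda>z. (case z of (x, y) \<Rightarrow> a x * b y) - (case z of (x, y) \<Rightarrow> a' x * b' y))"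
      by (intro Bochner_Integration.integrable_diff product_integral i)
    from integrable_bounded_mult[OF integrable_abs[OF this], of "\<lambda>z. ind j (fst z) * ind j (snd z)"]
    show ?thesis by (simp add: split_beta' indicator_def)
  qed
  have "ennreal (\<integral>z. ?W z \<partial>\<pi>) = (\<integral>\<^sup>+z. ennreal (?W z) \<partial>\<pi>)"
    by (rule nn_integral_eq_integral[symmetric, OF iW]) (auto simp: split_beta')
  also have "\<dots> \<le> (\<integral>\<^sup>+z. ennreal (1 / (4 * \<eta> * m)) * (2 * ennreal (X z)) + ennreal (\<eta> / 2 * Y z) \<partial>\<pi>)"
  proof (rule nn_integral_mono)
    fix z
    have e: "ennreal (1 / (4 * \<eta> * m)) * (2 * ennreal (X z)) = ennreal (X z / (2 * \<eta> * m))"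
      using X0[of z] \<eta> m(1) by (simp flip: ennreal_numeral ennreal_mult)
    show "ennreal (?W z) \<le> ennreal (1 / (4 * \<eta> * m)) * (2 * ennreal (X z)) + ennreal (\<eta> / 2 * Y z)"
      unfolding e using le[of z] X0[of z] Y0[of z] \<eta> m(1) by (simp flip: ennreal_plus)
  qed
  also have "\<dots> = ennreal (1 / (4 * \<eta> * m)) * (2 * (\<integral>\<^sup>+z. ennreal (X z) \<partial>\<pi>)) + (\<integral>\<^sup>+z. ennreal (\<eta> / 2 * Y z) \<partial>\<pi>)"
    using borel_measurable_integrable[OF iY(1)] by (simp add: nn_integral_add nn_integral_cmult)
  also have "(\<integral>\<^sup>+z. ennreal (\<eta> / 2 * Y z) \<partial>\<pi>) = ennreal (\<eta> / 2 * (?P * ?Q))"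
    unfolding iY(2)[symmetric]
    by (subst nn_integral_eq_integral) (use iY(1) Y0 \<eta> in auto)
  also have "ennreal (1 / (4 * \<eta> * m)) * (2 * (\<integral>\<^sup>+z. ennreal (X z) \<partial>\<pi>)) \<le> ennreal (1 / (4 * \<eta> * m)) * ennreal ?D"
  proof (rule mult_left_mono)
    have *: "integrable \<pi> (\<lambda>(x, y). q (x, y) * (a x * b y))"
      "integrable \<pi> (\<lambda>(x, y). q (x, y) * (a' x * b' y))"
      using ab by (auto simp: admissible_def)
    show "2 * (\<integral>\<^sup>+z. ennreal (X z) \<partial>\<pi>) \<le> ennreal ?D"
      unfolding X_def
      by (rule order_trans[OF scaling_stability[OF meas nonneg *]])
        (intro ennreal_leI add_mono defect_diff ab)
  qed simp
  also have "ennreal (1 / (4 * \<eta> * m)) * ennreal ?D + ennreal (\<eta> / 2 * (?P * ?Q)) = ennreal (?D / (4 * \<eta> * m) + \<eta> / 2 * ?P * ?Q)"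
    using \<eta> m(1) nonneg by (subst ennreal_mult[symmetric], simp, simp add: marginal_defect_nonneg, subst ennreal_plus[symmetric])
      (auto intro!: mult_nonneg_nonneg add_nonneg_nonneg divide_nonneg_nonneg integral_nonneg_AE marginal_defect_nonneg simp: mult.assoc)
  finally show ?thesis
    by (rule ennreal_le_iff[THEN iffD1, rotated])
      (use \<eta> m(1) nonneg in \<open>auto intro!: mult_nonneg_nonneg add_nonneg_nonneg divide_nonneg_nonneg integral_nonneg_AE marginal_defect_nonneg\<close>)
qed

end

locale approximate_scaling = schroedinger_problem K q \<mu>1 \<mu>2
  for K :: "nat \<Rightarrow> 'a::metric_space set" and q :: "'a \<times> 'a \<Rightarrow> real" and \<mu>1 \<mu>2 :: "'a measure" +
  fixes a b :: "nat \<Rightarrow> 'a \<Rightarrow> real" and k :: nat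
  assumes admissible: "admissible (a n) (b n)"
    and integrable_a: "integrable \<mu>1 (a n)"
    and integrable_b: "integrable \<mu>2 (b n)"
    and charged: "0 < measure \<mu>1 (K k)" "0 < measure \<mu>2 (K k)"
    and normalized: "(\<integral>x. ind k x * a n x \<partial>\<mu>1) = (\<integral>x. ind k x * b n x \<partial>\<mu>2)"
    and defect1: "(\<lambda>n. defect1 (a n) (b n)) \<longlonglongrightarrow> 0"
    and defect2: "(\<lambda>n. defect2 (a n) (b n)) \<longlonglongrightarrow> 0"
begin

lemma a_measurable [measurable]: "a n \<in> borel_measurable borel"
  and b_measurable [measurable]: "b n \<in> borel_measurable borel"
  and a_nonneg: "0 \<le> a n x" and b_nonneg: "0 \<le> b n x"
  and integrable_qab: "integrable \<pi> (\<lambda>(x, y). q (x, y) * (a n x * b n y))"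
  using admissible[of n] by (auto simp: admissible_def)

lemma swap_approx: "approximate_scaling K (\<lambda>(x, y). q (y, x)) \<mu>2 \<mu>1 b a k"
proof -
  interpret S: schroedinger_problem K "\<lambda>(x, y). q (y, x)" \<mu>2 \<mu>1 by (rule swap)
  have "integrable (\<mu>2 \<Otimes>\<^sub>M \<mu>1) (\<lambda>(x, y). q (y, x) * (b n x * a n y))" for n
    using integrable_product_swap[OF integrable_qab[of n]] by (simp add: split_beta' mult.commute)
  then show ?thesis
    using normalized charged integrable_a integrable_b defect1 defect2
    by unfold_locales (auto simp: S.admissible_def a_nonneg b_nonneg)
qed

lemma integrable_K_a: "integrable \<mu>1 (\<lambda>x. ind j x * a n x)"
  by (rule integrable_bounded_mult[OF integrable_a]) (auto simp: indicator_def)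

lemma integrable_K_b: "integrable \<mu>2 (\<lambda>x. ind j x * b n x)"
  by (rule integrable_bounded_mult[OF integrable_b]) (auto simp: indicator_def)

definition mass1 :: "nat \<Rightarrow> nat \<Rightarrow> real" where "mass1 j n = (\<integral>x. ind j x * a n x \<partial>\<mu>1)"
definition mass2 :: "nat \<Rightarrow> nat \<Rightarrow> real" where "mass2 j n = (\<integral>x. ind j x * b n x \<partial>\<mu>2)"

lemma mass_nonneg: "0 \<le> mass1 j n" "0 \<le> mass2 j n"
  unfolding mass1_def mass2_def by (auto intro!: integral_nonneg_AE simp: a_nonneg b_nonneg)

lemma mass_mono: "i \<le> j \<Longrightarrow> mass1 i n \<le> mass1 j n" "i \<le> j \<Longrightarrow> mass2 i n \<le> mass2 j n"
  unfolding mass1_def mass2_def using mono_K[of i j]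
  by (intro integral_mono integrable_K_a integrable_K_b mult_right_mono; auto simp: a_nonneg b_nonneg indicator_def)+

lemma mass_k: "mass1 k n = mass2 k n"
  unfolding mass1_def mass2_def by (rule normalized)

lemma rectangle_product:
  "integrable \<pi> (\<lambda>(x, y). ind i x * ind j y * (a n x * b n y))"
  "(\<integral>(x, y). ind i x * ind j y * (a n x * b n y) \<partial>\<pi>) = mass1 i n * mass2 j n"
proof -
  have e: "(\<lambda>(x, y). ind i x * ind j y * (a n x * b n y)) =
     (\<lambda>(x, y). (ind i x * a n x) * (ind j y * b n y))"
    by (auto simp: mult_ac)
  show "integrable \<pi> (\<lambda>(x, y). ind i x * ind j y * (a n x * b n y))"
    unfolding e by (rule product_integral[OF integrable_K_a integrable_K_b])
  show "(\<integral>(x, y). ind i x * ind j y * (a n x * b n y) \<partial>\<pi>) = mass1 i n * mass2 j n"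
    unfolding e mass1_def mass2_def by (rule product_integral(2)[OF integrable_K_a integrable_K_b])
qed

lemma integrable_rectangle:
  "integrable \<pi> (\<lambda>(x, y). ind i x * ind j y * (q (x, y) * (a n x * b n y)))"
  using integrable_bounded_mult[OF integrable_qab[of n], of "\<lambda>z. ind i (fst z) * ind j (snd z)"]
  by (simp add: split_beta' indicator_def)

lemma mass_product_upper:
  assumes m: "0 < m" "\<And>x y. x \<in> K j \<Longrightarrow> y \<in> K j \<Longrightarrow> m \<le> q (x, y)"
  shows "\<forall>\<^sub>F n in sequentially. mass1 j n * mass2 j n \<le> 4 / m"
proof -
  have "\<forall>\<^sub>F n in sequentially. defect1 (a n) (b n) < 1" "\<forall>\<^sub>F n in sequentially. defect2 (a n) (b n) < 1"
    using order_tendstoD(2)[OF defect1, of 1] order_tendstoD(2)[OF defect2, of 1] by auto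
  then show ?thesis
  proof eventually_elim
    case (elim n)
    have "m * (mass1 j n * mass2 j n) = (\<integral>z. m * (case z of (x, y) \<Rightarrow> ind j x * ind j y * (a n x * b n y)) \<partial>\<pi>)"
      by (simp add: rectangle_product(2))
    also have "\<dots> \<le> (\<integral>(x, y). ind j x * ind j y * (q (x, y) * (a n x * b n y)) \<partial>\<pi>)"
      by (rule integral_mono[OF _ integrable_rectangle])
        (use rectangle_product(1) m(2) in \<open>auto simp: indicator_def a_nonneg b_nonneg intro!: mult_right_mono\<close>)
    also have "\<dots> \<le> measure \<mu>1 (K j) + defect1 (a n) (b n) + defect2 (a n) (b n) + measure \<mu>2 (- K j)"
      using rectangle_mass[OF admissible[of n] K_borel[of j] K_borel[of j]] by linarith
    also have "\<dots> \<le> 4" using elim M1.prob_le_1[of "K j"] M2.prob_le_1[of "- K j"] by linarith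
    finally show ?case using m(1) by (simp add: field_simps)
  qed
qed

lemma tail_mass:
  assumes "0 < e"
  obtains J where "k \<le> J" "measure \<mu>2 (- K J) < e"
proof -
  have "\<forall>\<^sub>F n in sequentially. measure \<mu>2 (- K n) < e"
    by (rule order_tendstoD(2)[OF tendsto_measure_K(2)[OF M2.prob_space_axioms sets_\<mu>2] assms])
  then obtain N where N: "\<And>n. N \<le> n \<Longrightarrow> measure \<mu>2 (- K n) < e"
    unfolding eventually_sequentially by blast
  show thesis by (rule that[of "max k N"]) (simp_all add: N)
qed

lemma mass_product_lower:
  obtains J c where "k \<le> J" "0 < c" "\<forall>\<^sub>F n in sequentially. c \<le> mass1 k n * mass2 J n"
proof -
  define e where "e = measure \<mu>1 (K k) / 4"
  have e: "0 < e" using charged by (simp add: e_def)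
  obtain J where J: "k \<le> J" "measure \<mu>2 (- K J) < e" by (rule tail_mass[OF e])
  obtain m M where M: "0 < m" "m \<le> M" "\<And>x y. x \<in> K J \<Longrightarrow> y \<in> K J \<Longrightarrow> m \<le> q (x, y) \<and> q (x, y) \<le> M"
    using q_bounds[of J] by metis
  have "\<forall>\<^sub>F n in sequentially. defect1 (a n) (b n) < e" "\<forall>\<^sub>F n in sequentially. defect2 (a n) (b n) < e"
    using order_tendstoD(2)[OF defect1 e] order_tendstoD(2)[OF defect2 e] by auto
  then have "\<forall>\<^sub>F n in sequentially. e / M \<le> mass1 k n * mass2 J n"
  proof eventually_elim
    case (elim n)
    have "e \<le> (\<integral>(x, y). ind k x * ind J y * (q (x, y) * (a n x * b n y)) \<partial>\<pi>)"
      using rectangle_mass[OF admissible[of n] K_borel[of k] K_borel[of J]] elim J(2) e_def by linarith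
    also have "\<dots> \<le> (\<integral>z. M * (case z of (x, y) \<Rightarrow> ind k x * ind J y * (a n x * b n y)) \<partial>\<pi>)"
      by (rule integral_mono[OF integrable_rectangle])
        (use rectangle_product(1) M(3) mono_K[OF J(1), THEN subsetD] in \<open>auto simp: indicator_def a_nonneg b_nonneg intro!: mult_right_mono\<close>)
    also have "\<dots> = M * (mass1 k n * mass2 J n)"
      by (simp add: rectangle_product(2))
    finally show ?case using M by (simp add: field_simps)
  qed
  then show thesis using that[OF J(1), of "e / M"] e M by simp
qed

end

context approximate_scaling
begin

interpretation S: approximate_scaling K "\<lambda>(x, y). q (y, x)" \<mu>2 \<mu>1 b a k
  by (rule swap_approx)

lemma S_mass: "S.mass1 = mass2" "S.mass2 = mass1"
  by (auto simp: fun_eq_iff S.mass1_def S.mass2_def mass1_def mass2_def)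

lemma mass_k_lower:
  obtains c where "0 < c" "\<forall>\<^sub>F n in sequentially. c \<le> mass1 k n"
proof -
  obtain J c where J: "k \<le> J" "0 < c" "\<forall>\<^sub>F n in sequentially. c \<le> mass1 k n * mass2 J n"
    by (rule mass_product_lower)
  obtain J' c' where J': "k \<le> J'" "0 < c'" "\<forall>\<^sub>F n in sequentially. c' \<le> mass2 k n * mass1 J' n"
    using S.mass_product_lower unfolding S_mass by blast
  define L where "L = max J J'"
  obtain m M where m: "0 < m" "m \<le> M" "\<And>x y. x \<in> K L \<Longrightarrow> y \<in> K L \<Longrightarrow> m \<le> q (x, y) \<and> q (x, y) \<le> M"
    using q_bounds[of L] by metis
  define d where "d = min (sqrt (c * c' * m / 4)) 1"
  have "\<forall>\<^sub>F n in sequentially. mass1 L n * mass2 L n \<le> 4 / m"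
    by (rule mass_product_upper) (use m in auto)
  with J(3) J'(3) have "\<forall>\<^sub>F n in sequentially. sqrt (c * c' * m / 4) \<le> mass1 k n"
  proof eventually_elim
    case (elim n)
    have "c \<le> mass1 k n * mass2 L n"
      using elim(1) mult_left_mono[OF mass_mono(2)[of J L n] mass_nonneg(1)[of k n]] L_def by simp
    moreover have "c' \<le> mass1 k n * mass1 L n"
      using elim(2) mult_left_mono[OF mass_mono(1)[of J' L n] mass_nonneg(1)[of k n]] L_def mass_k[of n] by simp
    ultimately have "c * c' \<le> (mass1 k n * mass2 L n) * (mass1 k n * mass1 L n)"
      using J(2) J'(2) by (intro mult_mono) auto
    also have "\<dots> = (mass1 k n)\<^sup>2 * (mass1 L n * mass2 L n)" by (simp add: power2_eq_square mult_ac)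
    also have "\<dots> \<le> (mass1 k n)\<^sup>2 * (4 / m)" using elim(3) by (intro mult_left_mono) auto
    finally have "c * c' * m / 4 \<le> (mass1 k n)\<^sup>2" using m(1) by (simp add: field_simps)
    then show ?case using mass_nonneg(1) by (simp add: real_le_lsqrt)
  qed
  then show thesis using that[of "sqrt (c * c' * m / 4)"] J(2) J'(2) m(1) by simp
qed

lemma mass_upper:
  obtains C where "0 < C" "\<forall>\<^sub>F n in sequentially. mass1 j n \<le> C" "\<forall>\<^sub>F n in sequentially. mass2 j n \<le> C"
proof -
  define L where "L = max j k"
  obtain c where c: "0 < c" "\<forall>\<^sub>F n in sequentially. c \<le> mass1 k n" by (rule mass_k_lower)
  obtain m M where m: "0 < m" "m \<le> M" "\<And>x y. x \<in> K L \<Longrightarrow> y \<in> K L \<Longrightarrow> m \<le> q (x, y) \<and> q (x, y) \<le> M"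
    using q_bounds[of L] by metis
  have "\<forall>\<^sub>F n in sequentially. mass1 L n * mass2 L n \<le> 4 / m"
    by (rule mass_product_upper) (use m in auto)
  with c(2) have "\<forall>\<^sub>F n in sequentially. mass1 j n \<le> 4 / m / c \<and> mass2 j n \<le> 4 / m / c"
  proof eventually_elim
    case (elim n)
    have "mass1 j n * c \<le> mass1 L n * mass2 L n"
      using elim(1) mass_k[of n] mass_mono[of k L n] mass_mono[of j L n] mass_nonneg[of _ n] L_def c(1)
      by (intro mult_mono) auto
    moreover have "c * mass2 j n \<le> mass1 L n * mass2 L n"
      using elim(1) mass_k[of n] mass_mono[of k L n] mass_mono[of j L n] mass_nonneg[of _ n] L_def c(1)
      by (intro mult_mono) auto
    ultimately have "mass1 j n * c \<le> 4 / m" "mass2 j n * c \<le> 4 / m" using elim(2) by (simp_all add: mult.commute)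
    then show ?case using c(1) by (simp only: pos_le_divide_eq simp_thms)
  qed
  then show thesis using that[of "4 / m / c"] c(1) m(1) by (simp add: eventually_conj_iff)
qed

definition W :: "nat \<Rightarrow> nat \<Rightarrow> nat \<Rightarrow> real" where
  "W j n n' = (\<integral>(x, y). ind j x * ind j y * \<bar>a n x * b n y - a n' x * b n' y\<bar> \<partial>\<pi>)"

lemma W_Cauchy:
  assumes "0 < e"
  shows "\<exists>N. \<forall>n\<ge>N. \<forall>n'\<ge>N. W j n n' < e"
proof -
  obtain m M where m: "0 < m" "m \<le> M" "\<And>x y. x \<in> K j \<Longrightarrow> y \<in> K j \<Longrightarrow> m \<le> q (x, y) \<and> q (x, y) \<le> M"
    using q_bounds[of j] by metis
  obtain C where C: "0 < C" "\<forall>\<^sub>F n in sequentially. mass1 j n \<le> C" "\<forall>\<^sub>F n in sequentially. mass2 j n \<le> C"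
    by (rule mass_upper)
  define \<eta> where "\<eta> = e / (4 * C\<^sup>2)"
  have \<eta>: "0 < \<eta>" using assms C by (simp add: \<eta>_def)
  define d where "d = e * \<eta> * m / 4"
  have d: "0 < d" using assms \<eta> m by (simp add: d_def)
  have "\<forall>\<^sub>F n in sequentially. mass1 j n \<le> C \<and> mass2 j n \<le> C \<and> defect1 (a n) (b n) < d \<and> defect2 (a n) (b n) < d"
    using C(2,3) order_tendstoD(2)[OF defect1 d] order_tendstoD(2)[OF defect2 d] by eventually_elim auto
  then obtain N where N: "\<And>n. n \<ge> N \<Longrightarrow> mass1 j n \<le> C \<and> mass2 j n \<le> C \<and> defect1 (a n) (b n) < d \<and> defect2 (a n) (b n) < d"
    by (auto simp: eventually_sequentially)
  have "W j n n' < e" if n: "N \<le> n" "N \<le> n'" for n n'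
  proof -
    have "W j n n' \<le> (defect1 (a n) (b n) + defect1 (a n') (b n') + (defect2 (a n) (b n) + defect2 (a n') (b n'))) / (4 * \<eta> * m) +
      \<eta> / 2 * (mass1 j n + mass1 j n') * (mass2 j n + mass2 j n')"
      unfolding W_def mass1_def mass2_def
      by (rule product_L1_stability[OF admissible admissible integrable_a integrable_b integrable_a integrable_b m(1) _ \<eta>])
        (use m(3) in auto)
    also have "\<dots> < (d + d + (d + d)) / (4 * \<eta> * m) + \<eta> / 2 * (C + C) * (C + C)"
    proof (rule add_less_le_mono)
      have "0 < 4 * \<eta> * m" using \<eta> m(1) by simp
      then show "(defect1 (a n) (b n) + defect1 (a n') (b n') + (defect2 (a n) (b n) + defect2 (a n') (b n'))) / (4 * \<eta> * m)
          < (d + d + (d + d)) / (4 * \<eta> * m)"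
        by (rule divide_strict_right_mono[rotated]) (use N[OF n(1)] N[OF n(2)] in linarith)
      have "(mass1 j n + mass1 j n') * (mass2 j n + mass2 j n') \<le> (C + C) * (C + C)"
        using N[OF n(1)] N[OF n(2)] C(1) mass_nonneg[of j n] mass_nonneg[of j n'] by (intro mult_mono) linarith+
      then have "\<eta> / 2 * ((mass1 j n + mass1 j n') * (mass2 j n + mass2 j n')) \<le> \<eta> / 2 * ((C + C) * (C + C))"
        by (rule mult_left_mono) (use \<eta> in simp)
      then show "\<eta> / 2 * (mass1 j n + mass1 j n') * (mass2 j n + mass2 j n') \<le> \<eta> / 2 * (C + C) * (C + C)"
        by (simp only: mult.assoc)
    qed
    also have "\<dots> = e / 4 + e / 2"
      using \<eta> m(1) C(1) by (simp add: d_def \<eta>_def field_simps power2_eq_square)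
    also have "\<dots> < e" using assms by simp
    finally show ?thesis .
  qed
  then show ?thesis by blast
qed

lemma W_integrable:
  "integrable \<pi> (\<lambda>(x, y). ind i x * ind j y * \<bar>a n x * b n y - a n' x * b n' y\<bar>)"
proof -
  have "integrable \<pi> (\<lambda>z. (case z of (x, y) \<Rightarrow> a n x * b n y) - (case z of (x, y) \<Rightarrow> a n' x * b n' y))"
    by (intro Bochner_Integration.integrable_diff product_integral integrable_a integrable_b)
  from integrable_bounded_mult[OF integrable_abs[OF this], of "\<lambda>z. ind i (fst z) * ind j (snd z)"]
  show ?thesis by (simp add: split_beta' indicator_def)
qed

lemma mass_weighted_diff:
  assumes "k \<le> j"
  shows "(\<integral>x. ind j x * \<bar>a n x * mass2 k n - a n' x * mass2 k n'\<bar> \<partial>\<mu>1) \<le> W j n n'"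
    and "\<bar>(mass1 k n)\<^sup>2 - (mass1 k n')\<^sup>2\<bar> \<le> W j n n'"
proof -
  have i: "integrable \<mu>1 (\<lambda>x. ind j x * \<bar>a n x * mass2 k n - a n' x * mass2 k n'\<bar>)"
    by (rule integrable_bounded_mult) (use integrable_a in \<open>auto simp: indicator_def\<close>)
  have b: "integrable \<mu>2 (\<lambda>y. ind j y * b n y)" for j n
    by (rule integrable_K_b)
  have le: "ind j x * \<bar>a n x * mass2 k n - a n' x * mass2 k n'\<bar> \<le>
      (\<integral>y. ind j x * ind j y * \<bar>a n x * b n y - a n' x * b n' y\<bar> \<partial>\<mu>2)" for x
  proof -
    have "a n x * mass2 k n - a n' x * mass2 k n' = (\<integral>y. a n x * (ind k y * b n y) - a n' x * (ind k y * b n' y) \<partial>\<mu>2)"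
      using b by (simp add: mass2_def)
    also have "\<bar>\<dots>\<bar> \<le> (\<integral>y. \<bar>a n x * (ind k y * b n y) - a n' x * (ind k y * b n' y)\<bar> \<partial>\<mu>2)"
      by (rule integral_abs_bound)
    also have "\<dots> \<le> (\<integral>y. \<bar>a n x * (ind j y * b n y) - a n' x * (ind j y * b n' y)\<bar> \<partial>\<mu>2)"
      by (rule integral_mono) (use b mono_K[OF assms] in \<open>auto simp: indicator_def\<close>)
    also have "\<dots> = (\<integral>y. ind j y * \<bar>a n x * b n y - a n' x * b n' y\<bar> \<partial>\<mu>2)"
      by (rule Bochner_Integration.integral_cong) (auto simp: indicator_def)
    finally have "ind j x * \<bar>a n x * mass2 k n - a n' x * mass2 k n'\<bar> \<le>
        ind j x * (\<integral>y. ind j y * \<bar>a n x * b n y - a n' x * b n' y\<bar> \<partial>\<mu>2)"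
      by (rule mult_left_mono) simp
    then show ?thesis by (simp add: mult.assoc)
  qed
  have "(\<integral>x. ind j x * \<bar>a n x * mass2 k n - a n' x * mass2 k n'\<bar> \<partial>\<mu>1) \<le>
      (\<integral>x. \<integral>y. ind j x * ind j y * \<bar>a n x * b n y - a n' x * b n' y\<bar> \<partial>\<mu>2 \<partial>\<mu>1)"
    using integrable_fst'[OF W_integrable] by (intro integral_mono i le) simp
  also have "\<dots> = W j n n'"
    unfolding W_def using integral_fst'[OF W_integrable] by simp
  finally show 1: "(\<integral>x. ind j x * \<bar>a n x * mass2 k n - a n' x * mass2 k n'\<bar> \<partial>\<mu>1) \<le> W j n n'" .
  have i2: "integrable \<mu>1 (\<lambda>x. mass2 k n * (ind k x * a n x))" for n
    by (intro integrable_mult_right integrable_K_a)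
  have e: "(mass1 k n)\<^sup>2 = (\<integral>x. mass2 k n * (ind k x * a n x) \<partial>\<mu>1)" for n
    unfolding integral_mult_right_zero using mass_k[of n] by (simp only: mass1_def[symmetric] power2_eq_square)
  have "\<bar>(mass1 k n)\<^sup>2 - (mass1 k n')\<^sup>2\<bar> = \<bar>\<integral>x. mass2 k n * (ind k x * a n x) - mass2 k n' * (ind k x * a n' x) \<partial>\<mu>1\<bar>"
    unfolding e by (subst Bochner_Integration.integral_diff[OF i2 i2]) (rule refl)
  also have "\<dots> \<le> (\<integral>x. \<bar>mass2 k n * (ind k x * a n x) - mass2 k n' * (ind k x * a n' x)\<bar> \<partial>\<mu>1)"
    by (rule integral_abs_bound)
  also have "\<dots> \<le> (\<integral>x. ind j x * \<bar>a n x * mass2 k n - a n' x * mass2 k n'\<bar> \<partial>\<mu>1)"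
  proof (rule integral_mono[OF integrable_abs[OF Bochner_Integration.integrable_diff[OF i2 i2]] i])
    fix x
    show "\<bar>mass2 k n * (ind k x * a n x) - mass2 k n' * (ind k x * a n' x)\<bar> \<le>
        ind j x * \<bar>a n x * mass2 k n - a n' x * mass2 k n'\<bar>"
      using mono_K[OF assms] by (auto simp: indicator_def mult.commute)
  qed
  finally show "\<bar>(mass1 k n)\<^sup>2 - (mass1 k n')\<^sup>2\<bar> \<le> W j n n'" using 1 by linarith
qed

lemma a_Cauchy:
  assumes e: "0 < e"
  shows "\<exists>N. \<forall>n\<ge>N. \<forall>n'\<ge>N. (\<integral>x. ind j x * \<bar>a n x - a n' x\<bar> \<partial>\<mu>1) < e"
proof -
  define L where "L = max j k"
  have L: "k \<le> L" "K j \<subseteq> K L" using mono_K by (auto simp: L_def)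
  obtain c where c: "0 < c" "\<forall>\<^sub>F n in sequentially. c \<le> mass1 k n" by (rule mass_k_lower)
  obtain C where C: "0 < C" "\<forall>\<^sub>F n in sequentially. mass1 L n \<le> C" by (rule mass_upper)
  obtain N1 where N1: "\<And>n. N1 \<le> n \<Longrightarrow> c \<le> mass1 k n \<and> mass1 L n \<le> C"
    using eventually_conj[OF c(2) C(2)] by (auto simp: eventually_sequentially)
  define d where "d = e * c / (1 + C / (2 * c))"
  have D: "0 < 1 + C / (2 * c)" using C c by (simp add: add_pos_pos)
  then have d: "0 < d" using e c C by (simp add: d_def)
  obtain N2 where N2: "\<And>n n'. N2 \<le> n \<Longrightarrow> N2 \<le> n' \<Longrightarrow> W L n n' < d"
    using W_Cauchy[OF d, of L] by blast
  have "(\<integral>x. ind j x * \<bar>a n x - a n' x\<bar> \<partial>\<mu>1) < e" if n: "max N1 N2 \<le> n" "max N1 N2 \<le> n'" for n n'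
  proof -
    let ?p = "mass1 k n" and ?p' = "mass1 k n'"
    have p: "c \<le> ?p" "c \<le> ?p'" "mass1 L n' \<le> C" using N1[of n] N1[of n'] n by auto
    have w: "W L n n' < d" using N2 n by auto
    have i: "integrable \<mu>1 (\<lambda>x. ind L x * \<bar>a n x * ?p - a n' x * ?p'\<bar>)"
      by (rule integrable_bounded_mult) (use integrable_a in \<open>auto simp: indicator_def\<close>)
    have i': "integrable \<mu>1 (\<lambda>x. ind j x * \<bar>a n x - a n' x\<bar>)"
      by (rule integrable_bounded_mult) (use integrable_a in \<open>auto simp: indicator_def\<close>)
    have "2 * c * \<bar>?p - ?p'\<bar> \<le> (?p + ?p') * \<bar>?p - ?p'\<bar>"
      using p by (intro mult_right_mono) auto
    also have "\<dots> = \<bar>?p\<^sup>2 - ?p'\<^sup>2\<bar>"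
      using p c(1) by (simp add: power2_eq_square square_diff_square_factored abs_mult)
    also have "\<dots> \<le> W L n n'" by (rule mass_weighted_diff(2)[OF L(1)])
    finally have pp: "\<bar>?p - ?p'\<bar> \<le> W L n n' / (2 * c)" using c(1) by (simp add: field_simps)
    have W0: "0 \<le> W L n n'" using pp c(1) by (smt (verit) divide_less_0_iff)
    have "c * (\<integral>x. ind j x * \<bar>a n x - a n' x\<bar> \<partial>\<mu>1) = (\<integral>x. c * (ind j x * \<bar>a n x - a n' x\<bar>) \<partial>\<mu>1)"
      by simp
    also have "\<dots> \<le> (\<integral>x. ind L x * \<bar>a n x * ?p - a n' x * ?p'\<bar> + (ind L x * a n' x) * \<bar>?p - ?p'\<bar> \<partial>\<mu>1)"
    proof (intro integral_mono Bochner_Integration.integrable_add i integrable_mult_left integrable_mult_right i' integrable_K_a)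
      fix x
      show "c * (ind j x * \<bar>a n x - a n' x\<bar>) \<le> ind L x * \<bar>a n x * ?p - a n' x * ?p'\<bar> + (ind L x * a n' x) * \<bar>?p - ?p'\<bar>"
      proof (cases "x \<in> K j")
        case True
        then have "x \<in> K L" using L by auto
        have "c * \<bar>a n x - a n' x\<bar> \<le> ?p * \<bar>a n x - a n' x\<bar>" using p by (intro mult_right_mono) auto
        also have "\<dots> = \<bar>(a n x * ?p - a n' x * ?p') + a n' x * (?p' - ?p)\<bar>"
          using p c(1) by (simp add: abs_mult_pos' algebra_simps)
        also have "\<dots> \<le> \<bar>a n x * ?p - a n' x * ?p'\<bar> + a n' x * \<bar>?p' - ?p\<bar>"
          using a_nonneg[of n' x] abs_triangle_ineq[of "a n x * ?p - a n' x * ?p'" "a n' x * (?p' - ?p)"] by (simp add: abs_mult)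
        finally show ?thesis using True \<open>x \<in> K L\<close> by (simp add: abs_minus_commute)
      qed (simp add: a_nonneg)
    qed
    also have "\<dots> = (\<integral>x. ind L x * \<bar>a n x * ?p - a n' x * ?p'\<bar> \<partial>\<mu>1) + mass1 L n' * \<bar>?p - ?p'\<bar>"
      using i integrable_K_a by (simp add: mass1_def[of L])
    also have "\<dots> \<le> W L n n' + C * (W L n n' / (2 * c))"
      using mass_weighted_diff(1)[OF L(1), of n n'] pp p(3) C(1) by (intro add_mono mult_mono) (auto simp: mass_k)
    also have "\<dots> = W L n n' * (1 + C / (2 * c))" by (simp add: algebra_simps)
    also have "\<dots> < d * (1 + C / (2 * c))" using w D by (rule mult_strict_right_mono)
    also have "\<dots> = c * e" using D by (simp add: d_def)
    finally show ?thesis using c(1) by simp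
  qed
  then show ?thesis by blast
qed

end

section \<open>Existence of the limit\<close>

lemma L1_local_complete:
  fixes f :: "nat \<Rightarrow> 'b \<Rightarrow> real" and A :: "nat \<Rightarrow> 'b set"
  assumes f [measurable]: "\<And>n. f n \<in> borel_measurable M"
    and A [measurable]: "\<And>j. A j \<in> sets M" and mono: "\<And>i j. i \<le> j \<Longrightarrow> A i \<subseteq> A j"
    and space: "space M \<subseteq> (\<Union>j. A j)"
    and int: "\<And>j n. integrable M (\<lambda>x. indicator (A j) x * f n x)"
    and Cauchy: "\<And>j e. 0 < e \<Longrightarrow> \<exists>N. \<forall>n\<ge>N. \<forall>n'\<ge>N. (\<integral>x. indicator (A j) x * \<bar>f n x - f n' x\<bar> \<partial>M) < e"
  obtains g where "g \<in> borel_measurable M"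
    and "\<And>j. integrable M (\<lambda>x. indicator (A j) x * g x)"
    and "\<And>j. (\<lambda>n. \<integral>x. indicator (A j) x * \<bar>f n x - g x\<bar> \<partial>M) \<longlonglongrightarrow> 0"
proof -
  have int_diff: "integrable M (\<lambda>x. indicator (A j) x * \<bar>f n x - f n' x\<bar>)" for j n n'
  proof -
    have "integrable M (\<lambda>x. \<bar>indicator (A j) x * f n x - indicator (A j) x * f n' x\<bar>)"
      by (intro integrable_abs Bochner_Integration.integrable_diff int)
    moreover have "\<bar>indicator (A j) x * f n x - indicator (A j) x * f n' x\<bar> = indicator (A j) x * \<bar>f n x - f n' x\<bar>" for x
      by (simp add: indicator_def)
    ultimately show ?thesis by simp
  qed
  have nn_int: "(\<integral>\<^sup>+x. ennreal (indicator (A j) x * \<bar>f n x - f n' x\<bar>) \<partial>M) = ennreal (\<integral>x. indicator (A j) x * \<bar>f n x - f n' x\<bar> \<partial>M)" for j n n'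
    by (rule nn_integral_eq_integral[OF int_diff]) simp
  have "\<exists>N. \<forall>j. \<forall>n\<ge>N j. \<forall>n'\<ge>N j. (\<integral>x. indicator (A j) x * \<bar>f n x - f n' x\<bar> \<partial>M) < (1/2) ^ j"
    by (intro choice allI Cauchy) simp
  then obtain N where N: "\<And>j n n'. N j \<le> n \<Longrightarrow> N j \<le> n' \<Longrightarrow> (\<integral>x. indicator (A j) x * \<bar>f n x - f n' x\<bar> \<partial>M) < (1/2) ^ j"
    by blast
  define r where "r n = (\<Sum>i\<le>n. Suc (N i))" for n
  have rN: "N n \<le> r n" for n
    unfolding r_def using member_le_sum[of n "{..n}" "\<lambda>i. Suc (N i)"] by simp
  have r_Suc: "r n < r (Suc n)" for n by (simp add: r_def)
  have r_ge: "n \<le> r n" for n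
    using strict_mono_Suc_iff[of r] r_Suc strict_mono_imp_increasing by blast
  define d where "d n x = \<bar>f (r (Suc n)) x - f (r n) x\<bar>" for n x
  have [measurable]: "d n \<in> borel_measurable M" for n unfolding d_def by measurable
  define g where "g x = lim (\<lambda>n. f (r n) x)" for x
  have g [measurable]: "g \<in> borel_measurable M"
    unfolding g_def by (rule borel_measurable_lim_metric) simp
  have conv: "AE x in M. x \<in> A j \<longrightarrow> (\<lambda>n. f (r n) x) \<longlonglongrightarrow> g x" for j
  proof -
    have "(\<integral>\<^sup>+x. (\<Sum>n. ennreal (indicator (A j) x * d (n + j) x)) \<partial>M) = (\<Sum>n. \<integral>\<^sup>+x. ennreal (indicator (A j) x * d (n + j) x) \<partial>M)"
      by (rule nn_integral_suminf) measurable
    also have "\<dots> \<le> (\<Sum>n. ennreal ((1/2) ^ n))"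
    proof (rule suminf_le)
      fix n
      have "(\<integral>\<^sup>+x. ennreal (indicator (A j) x * d (n + j) x) \<partial>M) \<le> (\<integral>\<^sup>+x. ennreal (indicator (A (n + j)) x * d (n + j) x) \<partial>M)"
        using mono[of j "n + j"] by (intro nn_integral_mono ennreal_leI) (auto simp: indicator_def d_def)
      also have "\<dots> \<le> ennreal ((1/2) ^ (n + j))"
        unfolding d_def nn_int
        using N[of "n + j" "r (Suc (n + j))" "r (n + j)"] rN[of "n + j"] r_Suc[of "n + j"] by (intro ennreal_leI) simp
      also have "\<dots> \<le> ennreal ((1/2) ^ n)"
        by (intro ennreal_leI power_decreasing) auto
      finally show "(\<integral>\<^sup>+x. ennreal (indicator (A j) x * d (n + j) x) \<partial>M) \<le> ennreal ((1/2) ^ n)" .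
    qed auto
    also have "\<dots> = ennreal (\<Sum>n. (1/2) ^ n)"
      by (rule suminf_ennreal_eq) (auto intro!: summable_sums summable_geometric)
    also have "\<dots> < \<infinity>" by simp
    finally have "AE x in M. (\<Sum>n. ennreal (indicator (A j) x * d (n + j) x)) \<noteq> \<infinity>"
      by (intro nn_integral_PInf_AE) auto
    then show ?thesis
    proof eventually_elim
      case (elim x)
      show ?case
      proof
        assume x: "x \<in> A j"
        have "summable (\<lambda>n. d (n + j) x)"
          using elim x by (intro summable_suminf_not_top) (auto simp: d_def)
        then have "summable (\<lambda>n. \<bar>f (r (Suc n)) x - f (r n) x\<bar>)"
          unfolding d_def summable_iff_shift[of "\<lambda>n. \<bar>f (r (Suc n)) x - f (r n) x\<bar>" j] .
        then have "summable (\<lambda>n. f (r (Suc n)) x - f (r n) x)"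
          by (rule summable_rabs_cancel)
        from summable_LIMSEQ[OF this] obtain s where "(\<lambda>n. \<Sum>i<n. f (r (Suc i)) x - f (r i) x) \<longlonglongrightarrow> s" by blast
        then have "(\<lambda>n. f (r n) x - f (r 0) x) \<longlonglongrightarrow> s"
          by (simp only: sum_lessThan_telescope[of "\<lambda>i. f (r i) x"])
        from tendsto_add[OF this tendsto_const[of "f (r 0) x"]]
        have "convergent (\<lambda>n. f (r n) x)" by (auto simp: convergent_def)
        then show "(\<lambda>n. f (r n) x) \<longlonglongrightarrow> g x" unfolding g_def by (rule convergent_LIMSEQ_iff[THEN iffD1])
      qed
    qed
  qed
  have fatou: "(\<integral>\<^sup>+x. ennreal (indicator (A j) x * \<bar>f n x - g x\<bar>) \<partial>M) \<le> ennreal e"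
    if "\<And>n n'. L \<le> n \<Longrightarrow> L \<le> n' \<Longrightarrow> (\<integral>x. indicator (A j) x * \<bar>f n x - f n' x\<bar> \<partial>M) < e" "L \<le> n" for L n e j
  proof -
    have "(\<integral>\<^sup>+x. ennreal (indicator (A j) x * \<bar>f n x - g x\<bar>) \<partial>M) = (\<integral>\<^sup>+x. liminf (\<lambda>m. ennreal (indicator (A j) x * \<bar>f n x - f (r m) x\<bar>)) \<partial>M)"
    proof (rule nn_integral_cong_AE)
      show "AE x in M. ennreal (indicator (A j) x * \<bar>f n x - g x\<bar>) = liminf (\<lambda>m. ennreal (indicator (A j) x * \<bar>f n x - f (r m) x\<bar>))"
        using conv[of j]
      proof eventually_elim
        case (elim x)
        show ?case
        proof (cases "x \<in> A j")
          case True
          then have "(\<lambda>m. ennreal (indicator (A j) x * \<bar>f n x - f (r m) x\<bar>)) \<longlonglongrightarrow> ennreal (indicator (A j) x * \<bar>f n x - g x\<bar>)"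
            using elim by (intro tendsto_ennrealI tendsto_intros) auto
          then show ?thesis by (intro lim_imp_Liminf[symmetric]) auto
        qed (simp add: Liminf_const)
      qed
    qed
    also have "\<dots> \<le> liminf (\<lambda>m. \<integral>\<^sup>+x. ennreal (indicator (A j) x * \<bar>f n x - f (r m) x\<bar>) \<partial>M)"
      by (rule nn_integral_liminf) measurable
    also have "\<dots> \<le> liminf (\<lambda>m. ennreal e)"
    proof (rule Liminf_mono)
      show "\<forall>\<^sub>F m in sequentially. (\<integral>\<^sup>+x. ennreal (indicator (A j) x * \<bar>f n x - f (r m) x\<bar>) \<partial>M) \<le> ennreal e"
        unfolding eventually_sequentially nn_int
        using that r_ge order_trans by (intro exI[of _ L] allI impI ennreal_leI less_imp_le) blast
    qed
    finally show ?thesis by (simp add: Liminf_const)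
  qed
  have int_g: "integrable M (\<lambda>x. indicator (A j) x * \<bar>f n x - g x\<bar>)" if "N j \<le> n" for j n
    by (rule integrableI_nonneg) (use fatou[of "N j" j "(1/2) ^ j" n] N that in \<open>auto simp: less_top[symmetric] top_unique\<close>)
  show thesis
  proof (rule that[OF g])
    fix j
    have "integrable M (\<lambda>x. indicator (A j) x * (f (N j) x - g x))"
      by (rule Bochner_Integration.integrable_bound[OF int_g[of j "N j"]]) (auto simp: abs_mult)
    from Bochner_Integration.integrable_diff[OF int[of j "N j"] this]
    show "integrable M (\<lambda>x. indicator (A j) x * g x)" by (simp add: algebra_simps)
    show "(\<lambda>n. \<integral>x. indicator (A j) x * \<bar>f n x - g x\<bar> \<partial>M) \<longlonglongrightarrow> 0"
    proof (rule LIMSEQ_I)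
      fix e :: real assume e: "0 < e"
      then obtain L where L: "\<And>n n'. L \<le> n \<Longrightarrow> L \<le> n' \<Longrightarrow> (\<integral>x. indicator (A j) x * \<bar>f n x - f n' x\<bar> \<partial>M) < e / 2"
        using Cauchy[of "e / 2" j] by auto
      have "norm ((\<integral>x. indicator (A j) x * \<bar>f n x - g x\<bar> \<partial>M) - 0) < e" if n: "max L (N j) \<le> n" for n
      proof -
        have "ennreal (\<integral>x. indicator (A j) x * \<bar>f n x - g x\<bar> \<partial>M) = (\<integral>\<^sup>+x. ennreal (indicator (A j) x * \<bar>f n x - g x\<bar>) \<partial>M)"
          by (rule nn_integral_eq_integral[symmetric, OF int_g]) (use n in auto)
        also have "\<dots> \<le> ennreal (e / 2)" by (rule fatou[OF L]) (use n in auto)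
        finally have "(\<integral>x. indicator (A j) x * \<bar>f n x - g x\<bar> \<partial>M) \<le> e / 2" using e by (subst (asm) ennreal_le_iff) auto
        moreover have "0 \<le> (\<integral>x. indicator (A j) x * \<bar>f n x - g x\<bar> \<partial>M)" by (intro integral_nonneg_AE) auto
        ultimately show ?thesis using e by simp
      qed
      then show "\<exists>no. \<forall>n\<ge>no. norm ((\<integral>x. indicator (A j) x * \<bar>f n x - g x\<bar> \<partial>M) - 0) < e" by blast
    qed
  qed
qed

context schroedinger_problem
begin

lemma product_tendsto:
  fixes f :: "nat \<Rightarrow> 'a \<Rightarrow> real" and g :: "nat \<Rightarrow> 'a \<Rightarrow> real"
  assumes f: "\<And>n. integrable \<mu>1 (f n)" "integrable \<mu>1 f'" "(\<lambda>n. \<integral>x. \<bar>f n x - f' x\<bar> \<partial>\<mu>1) \<longlonglongrightarrow> 0"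
    and g: "\<And>n. integrable \<mu>2 (g n)" "integrable \<mu>2 g'" "(\<lambda>n. \<integral>x. \<bar>g n x - g' x\<bar> \<partial>\<mu>2) \<longlonglongrightarrow> 0"
    and u: "u \<in> borel_measurable \<pi>" "\<And>z. \<bar>u z\<bar> \<le> C"
  shows "(\<lambda>n. \<integral>(x, y). u (x, y) * (f n x * g n y) \<partial>\<pi>) \<longlonglongrightarrow> (\<integral>(x, y). u (x, y) * (f' x * g' y) \<partial>\<pi>)"
    and "integrable \<pi> (\<lambda>(x, y). u (x, y) * (f' x * g' y))"
proof -
  have C0: "0 \<le> C" using u(2)[of undefined] by linarith
  have int: "integrable \<pi> (\<lambda>(x, y). u (x, y) * (h x * k y))" if "integrable \<mu>1 h" "integrable \<mu>2 k" for h k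
  proof (rule Bochner_Integration.integrable_bound[where f="\<lambda>z. C * (case z of (x, y) \<Rightarrow> h x * k y)"])
    show i: "integrable \<pi> (\<lambda>z. C * (case z of (x, y) \<Rightarrow> h x * k y))"
      by (intro integrable_mult_right product_integral that)
    have "(\<lambda>(x, y). h x * k y) \<in> borel_measurable \<pi>"
      using product_integral(1)[OF that] by simp
    from borel_measurable_times[OF u(1) this]
    show "(\<lambda>(x, y). u (x, y) * (h x * k y)) \<in> borel_measurable \<pi>" by (simp add: split_beta')
    show "AE z in \<pi>. norm (case z of (x, y) \<Rightarrow> u (x, y) * (h x * k y)) \<le> norm (C * (case z of (x, y) \<Rightarrow> h x * k y))"
      using u(2) C0 by (intro AE_I2) (auto simp: abs_mult intro!: mult_right_mono)
  qed
  show int': "integrable \<pi> (\<lambda>(x, y). u (x, y) * (f' x * g' y))" by (rule int[OF f(2) g(2)])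
  let ?F = "\<lambda>n. \<integral>x. \<bar>f n x - f' x\<bar> \<partial>\<mu>1" and ?G = "\<lambda>n. \<integral>x. \<bar>g n x - g' x\<bar> \<partial>\<mu>2"
  let ?f = "\<integral>x. \<bar>f' x\<bar> \<partial>\<mu>1" and ?g = "\<integral>x. \<bar>g' x\<bar> \<partial>\<mu>2"
  have iF: "integrable \<mu>1 (\<lambda>x. \<bar>f n x - f' x\<bar>)" and iG: "integrable \<mu>2 (\<lambda>x. \<bar>g n x - g' x\<bar>)" for n
    using f g by auto
  have bound: "\<bar>(\<integral>(x, y). u (x, y) * (f n x * g n y) \<partial>\<pi>) - (\<integral>(x, y). u (x, y) * (f' x * g' y) \<partial>\<pi>)\<bar>
      \<le> C * (?F n * (?G n + ?g) + ?f * ?G n)" for n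
  proof -
    have p: "integrable \<pi> (\<lambda>(x, y). \<bar>f n x - f' x\<bar> * (\<bar>g n y - g' y\<bar> + \<bar>g' y\<bar>))"
      "(\<integral>(x, y). \<bar>f n x - f' x\<bar> * (\<bar>g n y - g' y\<bar> + \<bar>g' y\<bar>) \<partial>\<pi>) = ?F n * (?G n + ?g)"
      "integrable \<pi> (\<lambda>(x, y). \<bar>f' x\<bar> * \<bar>g n y - g' y\<bar>)"
      "(\<integral>(x, y). \<bar>f' x\<bar> * \<bar>g n y - g' y\<bar> \<partial>\<pi>) = ?f * ?G n"
      using f(1,2) g(1,2) by (auto simp: product_integral[OF iF] product_integral[OF _ iG])
    have "(\<integral>(x, y). u (x, y) * (f n x * g n y) \<partial>\<pi>) - (\<integral>(x, y). u (x, y) * (f' x * g' y) \<partial>\<pi>) =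
       (\<integral>z. (case z of (x, y) \<Rightarrow> u (x, y) * (f n x * g n y)) - (case z of (x, y) \<Rightarrow> u (x, y) * (f' x * g' y)) \<partial>\<pi>)"
      by (rule Bochner_Integration.integral_diff[symmetric, OF int[OF f(1) g(1)] int'])
    then have "\<bar>(\<integral>(x, y). u (x, y) * (f n x * g n y) \<partial>\<pi>) - (\<integral>(x, y). u (x, y) * (f' x * g' y) \<partial>\<pi>)\<bar> \<le>
       (\<integral>z. \<bar>(case z of (x, y) \<Rightarrow> u (x, y) * (f n x * g n y)) - (case z of (x, y) \<Rightarrow> u (x, y) * (f' x * g' y))\<bar> \<partial>\<pi>)"
      by (simp only: integral_abs_bound)
    also have "\<dots> \<le> (\<integral>z. C * ((case z of (x, y) \<Rightarrow> \<bar>f n x - f' x\<bar> * (\<bar>g n y - g' y\<bar> + \<bar>g' y\<bar>)) + (case z of (x, y) \<Rightarrow> \<bar>f' x\<bar> * \<bar>g n y - g' y\<bar>)) \<partial>\<pi>)"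
    proof (intro integral_mono integrable_abs Bochner_Integration.integrable_diff int[OF f(1) g(1)] int'
        integrable_mult_right Bochner_Integration.integrable_add p)
      fix z :: "'a \<times> 'a"
      obtain x y where z: "z = (x, y)" by force
      have "\<bar>u z * (f n x * g n y) - u z * (f' x * g' y)\<bar> = \<bar>u z\<bar> * \<bar>(f n x - f' x) * g n y + f' x * (g n y - g' y)\<bar>"
        unfolding abs_mult[symmetric] by (simp add: algebra_simps)
      also have "\<dots> \<le> C * (\<bar>f n x - f' x\<bar> * (\<bar>g n y - g' y\<bar> + \<bar>g' y\<bar>) + \<bar>f' x\<bar> * \<bar>g n y - g' y\<bar>)"
      proof (rule mult_mono[OF u(2) _ C0])
        have "\<bar>(f n x - f' x) * g n y + f' x * (g n y - g' y)\<bar> \<le> \<bar>f n x - f' x\<bar> * \<bar>g n y\<bar> + \<bar>f' x\<bar> * \<bar>g n y - g' y\<bar>"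
          using abs_triangle_ineq[of "(f n x - f' x) * g n y" "f' x * (g n y - g' y)"] by (simp add: abs_mult)
        also have "\<dots> \<le> \<bar>f n x - f' x\<bar> * (\<bar>g n y - g' y\<bar> + \<bar>g' y\<bar>) + \<bar>f' x\<bar> * \<bar>g n y - g' y\<bar>"
          by (intro add_right_mono mult_left_mono) auto
        finally show "\<bar>(f n x - f' x) * g n y + f' x * (g n y - g' y)\<bar> \<le> \<dots>" .
      qed simp
      finally show "\<bar>(case z of (x, y) \<Rightarrow> u (x, y) * (f n x * g n y)) - (case z of (x, y) \<Rightarrow> u (x, y) * (f' x * g' y))\<bar> \<le>
          C * ((case z of (x, y) \<Rightarrow> \<bar>f n x - f' x\<bar> * (\<bar>g n y - g' y\<bar> + \<bar>g' y\<bar>)) + (case z of (x, y) \<Rightarrow> \<bar>f' x\<bar> * \<bar>g n y - g' y\<bar>))"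
        unfolding z by simp
    qed
    also have "\<dots> = C * (?F n * (?G n + ?g) + ?f * ?G n)"
      unfolding integral_mult_right_zero Bochner_Integration.integral_add[OF p(1,3)] p(2,4) ..
    finally show ?thesis .
  qed
  have "(\<lambda>n. C * (?F n * (?G n + ?g) + ?f * ?G n)) \<longlonglongrightarrow> C * (0 * (0 + ?g) + ?f * 0)"
    by (intro tendsto_intros f g)
  then have lim: "(\<lambda>n. C * (?F n * (?G n + ?g) + ?f * ?G n)) \<longlonglongrightarrow> 0" by simp
  show "(\<lambda>n. \<integral>(x, y). u (x, y) * (f n x * g n y) \<partial>\<pi>) \<longlonglongrightarrow> (\<integral>(x, y). u (x, y) * (f' x * g' y) \<partial>\<pi>)"
    by (rule LIM_zero_cancel, rule Lim_null_comparison[OF _ lim]) (use bound in auto)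
qed

lemma space_\<mu> [simp]: "space \<mu>1 = UNIV" "space \<mu>2 = UNIV"
  using sets_eq_imp_space_eq[OF sets_\<mu>1] sets_eq_imp_space_eq[OF sets_\<mu>2] by auto

lemma emeasure_double_density:
  assumes [measurable]: "\<alpha> \<in> borel_measurable borel" "\<beta> \<in> borel_measurable borel" "B \<in> sets borel"
    and nonneg: "\<And>x. 0 \<le> \<alpha> x" "\<And>x. 0 \<le> \<beta> x"
  shows "emeasure (density (density \<mu>1 (\<lambda>x. ennreal (\<alpha> x))) (\<lambda>x. \<integral>\<^sup>+y. ennreal (q (x, y)) \<partial>density \<mu>2 (\<lambda>x. ennreal (\<beta> x)))) B
    = (\<integral>\<^sup>+z. ennreal (indicator B (fst z) * (q z * (\<alpha> (fst z) * \<beta> (snd z)))) \<partial>\<pi>)"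
proof -
  have e: "(\<integral>\<^sup>+y. ennreal (q (x, y)) \<partial>density \<mu>2 (\<lambda>x. ennreal (\<beta> x))) = (\<integral>\<^sup>+y. ennreal (\<beta> y) * ennreal (q (x, y)) \<partial>\<mu>2)" for x
    by (subst nn_integral_density) auto
  have "emeasure (density (density \<mu>1 (\<lambda>x. ennreal (\<alpha> x))) (\<lambda>x. \<integral>\<^sup>+y. ennreal (q (x, y)) \<partial>density \<mu>2 (\<lambda>x. ennreal (\<beta> x)))) B
    = (\<integral>\<^sup>+x. ennreal (\<alpha> x) * ((\<integral>\<^sup>+y. ennreal (\<beta> y) * ennreal (q (x, y)) \<partial>\<mu>2) * indicator B x) \<partial>\<mu>1)"
    unfolding e by (subst emeasure_density, measurable) (subst nn_integral_density; simp)
  also have "\<dots> = (\<integral>\<^sup>+x. \<integral>\<^sup>+y. ennreal (indicator B x * (q (x, y) * (\<alpha> x * \<beta> y))) \<partial>\<mu>2 \<partial>\<mu>1)"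
  proof (rule nn_integral_cong)
    fix x
    have "ennreal (\<alpha> x) * ((\<integral>\<^sup>+y. ennreal (\<beta> y) * ennreal (q (x, y)) \<partial>\<mu>2) * indicator B x) =
      (\<integral>\<^sup>+y. (ennreal (\<alpha> x) * indicator B x) * (ennreal (\<beta> y) * ennreal (q (x, y))) \<partial>\<mu>2)"
      by (subst nn_integral_cmult) (auto simp: mult_ac)
    also have "\<dots> = (\<integral>\<^sup>+y. ennreal (indicator B x * (q (x, y) * (\<alpha> x * \<beta> y))) \<partial>\<mu>2)"
      using nonneg q_pos[THEN less_imp_le] by (intro nn_integral_cong) (auto simp: indicator_def ennreal_mult'' mult_ac)
    finally show "ennreal (\<alpha> x) * ((\<integral>\<^sup>+y. ennreal (\<beta> y) * ennreal (q (x, y)) \<partial>\<mu>2) * indicator B x) =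
      (\<integral>\<^sup>+y. ennreal (indicator B x * (q (x, y) * (\<alpha> x * \<beta> y))) \<partial>\<mu>2)" .
  qed
  also have "\<dots> = (\<integral>\<^sup>+z. ennreal (indicator B (fst z) * (q z * (\<alpha> (fst z) * \<beta> (snd z)))) \<partial>\<pi>)"
    by (subst M2.nn_integral_fst[symmetric]) (auto simp: split_beta')
  finally show ?thesis .
qed

lemma sigma_finite_density:
  fixes \<alpha> :: "'a \<Rightarrow> real"
  assumes "\<alpha> \<in> borel_measurable borel"
  shows "sigma_finite_measure (density \<mu>1 (\<lambda>x. ennreal (\<alpha> x)))" "sigma_finite_measure (density \<mu>2 (\<lambda>x. ennreal (\<alpha> x)))"
  using assms by (auto simp: M1.sigma_finite_iff_density_finite M2.sigma_finite_iff_density_finite)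

end

context approximate_scaling
begin

definition locally_converges where
  "locally_converges \<alpha> \<beta> \<longleftrightarrow> \<alpha> \<in> borel_measurable borel \<and> \<beta> \<in> borel_measurable borel \<and>
     (\<forall>x. 0 \<le> \<alpha> x) \<and> (\<forall>x. 0 \<le> \<beta> x) \<and>
     (\<forall>j. integrable \<mu>1 (\<lambda>x. ind j x * \<alpha> x)) \<and> (\<forall>j. integrable \<mu>2 (\<lambda>x. ind j x * \<beta> x)) \<and>
     (\<forall>j. (\<lambda>n. \<integral>x. ind j x * \<bar>a n x - \<alpha> x\<bar> \<partial>\<mu>1) \<longlonglongrightarrow> 0) \<and>
     (\<forall>j. (\<lambda>n. \<integral>x. ind j x * \<bar>b n x - \<beta> x\<bar> \<partial>\<mu>2) \<longlonglongrightarrow> 0)"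

lemma limit_marginal:
  assumes "locally_converges \<alpha> \<beta>"
  shows "\<mu>1 = density (density \<mu>1 (\<lambda>x. ennreal (\<alpha> x))) (\<lambda>x. \<integral>\<^sup>+y. ennreal (q (x, y)) \<partial>density \<mu>2 (\<lambda>x. ennreal (\<beta> x)))"
    (is "\<mu>1 = ?R")
proof (rule measure_eqI)
  have [measurable]: "\<alpha> \<in> borel_measurable borel" "\<beta> \<in> borel_measurable borel"
    and nonneg: "\<And>x. 0 \<le> \<alpha> x" "\<And>x. 0 \<le> \<beta> x"
    and int: "\<And>j. integrable \<mu>1 (\<lambda>x. ind j x * \<alpha> x)" "\<And>j. integrable \<mu>2 (\<lambda>x. ind j x * \<beta> x)"
    and lim: "\<And>j. (\<lambda>n. \<integral>x. ind j x * \<bar>a n x - \<alpha> x\<bar> \<partial>\<mu>1) \<longlonglongrightarrow> 0"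
      "\<And>j. (\<lambda>n. \<integral>x. ind j x * \<bar>b n x - \<beta> x\<bar> \<partial>\<mu>2) \<longlonglongrightarrow> 0"
    using assms unfolding locally_converges_def by blast+
  show "sets \<mu>1 = sets ?R" by simp
  fix B assume "B \<in> sets \<mu>1"
  then have [measurable]: "B \<in> sets borel" by (simp add: sets_\<mu>1)
  define H where "H z = indicator B (fst z) * (q z * (\<alpha> (fst z) * \<beta> (snd z)))" for z
  define R where "R j z = (ind j (fst z) * ind j (snd z) * H z :: real)" for j z
  define I where "I j = (\<integral>z. R j z \<partial>\<pi>)" for j
  have [measurable]: "H \<in> borel_measurable \<pi>" "R j \<in> borel_measurable \<pi>" for j
    unfolding H_def R_def by measurable
  have H0: "0 \<le> H z" for z using nonneg q_pos[of z] by (simp add: H_def less_imp_le)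
  have R0: "0 \<le> R j z" for j z using H0 by (simp add: R_def)
  have IR: "integrable \<pi> (R j) \<and> \<bar>I j - measure \<mu>1 (B \<inter> K j)\<bar> \<le> measure \<mu>2 (- K j)" for j
  proof -
    obtain m M where M: "0 < m" "m \<le> M" "\<And>x y. x \<in> K j \<Longrightarrow> y \<in> K j \<Longrightarrow> m \<le> q (x, y) \<and> q (x, y) \<le> M"
      using q_bounds[of j] by metis
    define u where "u z = indicator (B \<inter> K j) (fst z) * ind j (snd z) * q z" for z
    have u: "u \<in> borel_measurable \<pi>" "\<bar>u z\<bar> \<le> M" for z
    proof -
      show "u \<in> borel_measurable \<pi>" unfolding u_def by measurable
      show "\<bar>u z\<bar> \<le> M"
        using M(1,2) M(3)[of "fst z" "snd z"] q_pos[of z] by (auto simp: u_def indicator_def)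
    qed
    have abs_ind: "\<bar>ind j x * f x - ind j x * g x\<bar> = ind j x * \<bar>f x - g x\<bar>" for x and f g :: "'a \<Rightarrow> real"
      by (simp add: indicator_def)
    have lim1: "(\<lambda>n. \<integral>x. \<bar>ind j x * a n x - ind j x * \<alpha> x\<bar> \<partial>\<mu>1) \<longlonglongrightarrow> 0"
      unfolding abs_ind by (rule lim)
    have lim2: "(\<lambda>n. \<integral>x. \<bar>ind j x * b n x - ind j x * \<beta> x\<bar> \<partial>\<mu>2) \<longlonglongrightarrow> 0"
      unfolding abs_ind by (rule lim)
    note p = product_tendsto[OF integrable_K_a int(1) lim1 integrable_K_b int(2) lim2 u]
    have e: "(\<lambda>(x, y). u (x, y) * ((ind j x * \<alpha> x) * (ind j y * \<beta> y))) = R j"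
      by (auto simp: fun_eq_iff R_def u_def H_def indicator_def)
    have e2: "(\<lambda>(x, y). u (x, y) * ((ind j x * a n x) * (ind j y * b n y))) =
        (\<lambda>(x, y). indicator (B \<inter> K j) x * ind j y * (q (x, y) * (a n x * b n y)))" for n
      by (auto simp: fun_eq_iff u_def indicator_def)
    have l: "(\<lambda>n. \<integral>(x, y). indicator (B \<inter> K j) x * ind j y * (q (x, y) * (a n x * b n y)) \<partial>\<pi>) \<longlonglongrightarrow> I j"
      using p(1) unfolding e e2 I_def .
    have "\<bar>I j - measure \<mu>1 (B \<inter> K j)\<bar> \<le> 0 + 0 + measure \<mu>2 (- K j)"
    proof (rule tendsto_le[OF sequentially_bot])
      show "(\<lambda>n. defect1 (a n) (b n) + defect2 (a n) (b n) + measure \<mu>2 (- K j)) \<longlonglongrightarrow> 0 + 0 + measure \<mu>2 (- K j)"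
        by (intro tendsto_intros defect1 defect2)
      show "(\<lambda>n. \<bar>(\<integral>(x, y). indicator (B \<inter> K j) x * ind j y * (q (x, y) * (a n x * b n y)) \<partial>\<pi>) - measure \<mu>1 (B \<inter> K j)\<bar>)
          \<longlonglongrightarrow> \<bar>I j - measure \<mu>1 (B \<inter> K j)\<bar>"
        by (intro tendsto_intros l)
      show "\<forall>\<^sub>F n in sequentially. \<bar>(\<integral>(x, y). indicator (B \<inter> K j) x * ind j y * (q (x, y) * (a n x * b n y)) \<partial>\<pi>) - measure \<mu>1 (B \<inter> K j)\<bar>
          \<le> defect1 (a n) (b n) + defect2 (a n) (b n) + measure \<mu>2 (- K j)"
        by (intro always_eventually allI rectangle_mass admissible) auto
    qed
    then show ?thesis using p(2) unfolding e by simp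
  qed
  note tail = tendsto_measure_K(2)[OF M2.prob_space_axioms sets_\<mu>2]
  have "(\<lambda>j. measure \<mu>1 (B \<inter> K j)) \<longlonglongrightarrow> measure \<mu>1 (\<Union>j. B \<inter> K j)"
    by (rule M1.finite_Lim_measure_incseq) (use mono_K in \<open>auto simp: incseq_def\<close>)
  moreover have "(\<Union>j. B \<inter> K j) = B" using UN_K by auto
  ultimately have "(\<lambda>j. measure \<mu>1 (B \<inter> K j)) \<longlonglongrightarrow> measure \<mu>1 B" by simp
  moreover have "(\<lambda>j. I j - measure \<mu>1 (B \<inter> K j)) \<longlonglongrightarrow> 0"
    by (rule Lim_null_comparison[OF _ tail]) (use IR in auto)
  ultimately have "(\<lambda>j. (I j - measure \<mu>1 (B \<inter> K j)) + measure \<mu>1 (B \<inter> K j)) \<longlonglongrightarrow> 0 + measure \<mu>1 B"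
    by (intro tendsto_add)
  then have I: "(\<lambda>j. ennreal (I j)) \<longlonglongrightarrow> ennreal (measure \<mu>1 B)" by (intro tendsto_ennrealI) simp
  have "(\<lambda>j. \<integral>\<^sup>+z. ennreal (R j z) \<partial>\<pi>) \<longlonglongrightarrow> (\<integral>\<^sup>+z. ennreal (H z) \<partial>\<pi>)"
  proof (rule nn_integral_LIMSEQ)
    show "incseq (\<lambda>j z. ennreal (R j z))"
    proof (intro incseq_SucI le_funI ennreal_leI)
      fix j z show "R j z \<le> R (Suc j) z"
        using mono_K[of j "Suc j"] H0[of z] by (auto simp: R_def indicator_def)
    qed
    fix z :: "'a \<times> 'a"
    obtain j1 j2 where "fst z \<in> K j1" "snd z \<in> K j2" using UN_K by blast
    then have "R n z = H z" if "max j1 j2 \<le> n" for n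
      using mono_K[of j1 n] mono_K[of j2 n] that by (auto simp: R_def indicator_def)
    then show "(\<lambda>j. ennreal (R j z)) \<longlonglongrightarrow> ennreal (H z)"
      by (intro tendsto_eventually) (auto simp: eventually_sequentially intro!: exI[of _ "max j1 j2"])
  qed measurable
  moreover have "(\<integral>\<^sup>+z. ennreal (R j z) \<partial>\<pi>) = ennreal (I j)" for j
    unfolding I_def by (rule nn_integral_eq_integral) (use IR R0 in auto)
  ultimately have "(\<integral>\<^sup>+z. ennreal (H z) \<partial>\<pi>) = ennreal (measure \<mu>1 B)"
    using LIMSEQ_unique[OF _ I] by simp
  then show "emeasure \<mu>1 B = emeasure ?R B"
    unfolding H_def by (subst emeasure_double_density) (auto simp: nonneg M1.emeasure_eq_measure)
qed

end

context approximate_scaling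
begin

interpretation S: approximate_scaling K "\<lambda>(x, y). q (y, x)" \<mu>2 \<mu>1 b a k
  by (rule swap_approx)

lemma locally_converges_swap: "locally_converges \<alpha> \<beta> \<Longrightarrow> S.locally_converges \<beta> \<alpha>"
  unfolding locally_converges_def S.locally_converges_def by blast

lemma obtain_limit:
  obtains \<alpha> \<beta> where "locally_converges \<alpha> \<beta>"
proof -
  have *: "\<exists>g. g \<in> borel_measurable borel \<and> (\<forall>x. 0 \<le> g x) \<and> (\<forall>j. integrable M (\<lambda>x. ind j x * g x)) \<and>
      (\<forall>j. (\<lambda>n. \<integral>x. ind j x * \<bar>f n x - g x\<bar> \<partial>M) \<longlonglongrightarrow> 0)"
    if [measurable_cong]: "sets M = sets borel" and f [measurable]: "\<And>n. f n \<in> borel_measurable borel" and f0: "\<And>n x. 0 \<le> f n x"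
      and int: "\<And>j n. integrable M (\<lambda>x. ind j x * f n x)"
      and Cauchy: "\<And>j e. 0 < e \<Longrightarrow> \<exists>N. \<forall>n\<ge>N. \<forall>n'\<ge>N. (\<integral>x. ind j x * \<bar>f n x - f n' x\<bar> \<partial>M) < e"
    for M and f :: "nat \<Rightarrow> 'a \<Rightarrow> real"
  proof -
    have [measurable]: "f n \<in> borel_measurable M" "K j \<in> sets M" for n j by measurable
    obtain g where g: "g \<in> borel_measurable M" "\<And>j. integrable M (\<lambda>x. ind j x * g x)"
      "\<And>j. (\<lambda>n. \<integral>x. ind j x * \<bar>f n x - g x\<bar> \<partial>M) \<longlonglongrightarrow> 0"
      by (rule L1_local_complete[of f M K]) (use int Cauchy UN_K mono_K in auto)
    have i: "integrable M (\<lambda>x. ind j x * \<bar>g x\<bar>)" for j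
      using integrable_abs[OF g(2)[of j]] by (simp add: abs_mult)
    have id: "integrable M (\<lambda>x. ind j x * \<bar>f n x - h x\<bar>)" if "integrable M (\<lambda>x. ind j x * h x)" for j n h
      using integrable_abs[OF Bochner_Integration.integrable_diff[OF int[of j n] that]] by (simp add: abs_mult flip: right_diff_distrib)
    have "(\<lambda>n. \<integral>x. ind j x * \<bar>f n x - \<bar>g x\<bar>\<bar> \<partial>M) \<longlonglongrightarrow> 0" for j
    proof (rule Lim_null_comparison[OF _ g(3)])
      have "\<bar>f n x - \<bar>g x\<bar>\<bar> \<le> \<bar>f n x - g x\<bar>" for n x
        using f0[of n x] by linarith
      then have "(\<integral>x. ind j x * \<bar>f n x - \<bar>g x\<bar>\<bar> \<partial>M) \<le> (\<integral>x. ind j x * \<bar>f n x - g x\<bar> \<partial>M)" for n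
        by (intro integral_mono id i g mult_left_mono) auto
      then show "\<forall>\<^sub>F n in sequentially. norm (\<integral>x. ind j x * \<bar>f n x - \<bar>g x\<bar>\<bar> \<partial>M) \<le> (\<integral>x. ind j x * \<bar>f n x - g x\<bar> \<partial>M)"
        by simp
    qed
    moreover have "g \<in> borel_measurable borel" using g(1) measurable_cong_sets[OF that(1) refl] by blast
    then have "(\<lambda>x. \<bar>g x\<bar>) \<in> borel_measurable borel" by measurable
    ultimately show ?thesis
      using i by (intro exI[of _ "\<lambda>x. \<bar>g x\<bar>"]) auto
  qed
  obtain \<alpha> where "\<alpha> \<in> borel_measurable borel" "\<forall>x. 0 \<le> \<alpha> x" "\<forall>j. integrable \<mu>1 (\<lambda>x. ind j x * \<alpha> x)"
      "\<forall>j. (\<lambda>n. \<integral>x. ind j x * \<bar>a n x - \<alpha> x\<bar> \<partial>\<mu>1) \<longlonglongrightarrow> 0"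
    using *[OF sets_\<mu>1 a_measurable a_nonneg integrable_K_a a_Cauchy] by blast
  moreover obtain \<beta> where "\<beta> \<in> borel_measurable borel" "\<forall>x. 0 \<le> \<beta> x" "\<forall>j. integrable \<mu>2 (\<lambda>x. ind j x * \<beta> x)"
      "\<forall>j. (\<lambda>n. \<integral>x. ind j x * \<bar>b n x - \<beta> x\<bar> \<partial>\<mu>2) \<longlonglongrightarrow> 0"
    using *[OF sets_\<mu>2 b_measurable b_nonneg integrable_K_b S.a_Cauchy] by blast
  ultimately show thesis by (intro that[of \<alpha> \<beta>]) (simp add: locally_converges_def)
qed

lemma limit_solution:
  assumes lc: "locally_converges \<alpha> \<beta>"
  shows "schroedinger_solution q \<mu>1 \<mu>2 (density \<mu>1 (\<lambda>x. ennreal (\<alpha> x))) (density \<mu>2 (\<lambda>x. ennreal (\<beta> x)))"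
proof -
  have "\<alpha> \<in> borel_measurable borel" "\<beta> \<in> borel_measurable borel"
    using lc by (auto simp: locally_converges_def)
  then show ?thesis
    unfolding schroedinger_solution_def
    using limit_marginal[OF lc] S.limit_marginal[OF locally_converges_swap[OF lc]]
    by (simp add: sigma_finite_density sets_\<mu>1 sets_\<mu>2)
qed

lemma tendsto_local_integral:
  assumes lc: "locally_converges \<alpha> \<beta>"
    and f [measurable]: "f \<in> borel_measurable borel" and C: "\<And>x. x \<in> K j \<Longrightarrow> \<bar>f x\<bar> \<le> C"
  shows "(\<lambda>n. \<integral>x. ind j x * (f x * a n x) \<partial>\<mu>1) \<longlonglongrightarrow> (\<integral>x. ind j x * (f x * \<alpha> x) \<partial>\<mu>1)"
    and "integrable \<mu>1 (\<lambda>x. ind j x * (f x * \<alpha> x))"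
proof -
  have [measurable]: "\<alpha> \<in> borel_measurable borel"
    and int: "\<And>j. integrable \<mu>1 (\<lambda>x. ind j x * \<alpha> x)"
    and lim: "\<And>j. (\<lambda>n. \<integral>x. ind j x * \<bar>a n x - \<alpha> x\<bar> \<partial>\<mu>1) \<longlonglongrightarrow> 0"
    using lc unfolding locally_converges_def by blast+
  have i: "integrable \<mu>1 (\<lambda>x. ind j x * (f x * g x))"
    if [measurable]: "g \<in> borel_measurable borel" and g: "integrable \<mu>1 (\<lambda>x. ind j x * g x)" for g
    by (rule Bochner_Integration.integrable_bound[where f="\<lambda>x. C * (ind j x * g x)"])
      (use g C in \<open>auto simp: indicator_def abs_mult intro!: mult_right_mono order_trans[OF C abs_ge_self]\<close>)
  show "integrable \<mu>1 (\<lambda>x. ind j x * (f x * \<alpha> x))" by (rule i[OF _ int]) measurable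
  have d: "integrable \<mu>1 (\<lambda>x. ind j x * \<bar>a n x - \<alpha> x\<bar>)" for n
    using integrable_abs[OF Bochner_Integration.integrable_diff[OF integrable_K_a[of j n] int[of j]]]
    by (simp add: abs_mult flip: right_diff_distrib)
  show "(\<lambda>n. \<integral>x. ind j x * (f x * a n x) \<partial>\<mu>1) \<longlonglongrightarrow> (\<integral>x. ind j x * (f x * \<alpha> x) \<partial>\<mu>1)"
  proof (rule LIM_zero_cancel, rule Lim_null_comparison)
    show "(\<lambda>n. C * (\<integral>x. ind j x * \<bar>a n x - \<alpha> x\<bar> \<partial>\<mu>1)) \<longlonglongrightarrow> 0"
      using tendsto_mult_left[OF lim, of C j] by simp
    have "\<bar>(\<integral>x. ind j x * (f x * a n x) \<partial>\<mu>1) - (\<integral>x. ind j x * (f x * \<alpha> x) \<partial>\<mu>1)\<bar> \<le>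
        C * (\<integral>x. ind j x * \<bar>a n x - \<alpha> x\<bar> \<partial>\<mu>1)" for n
    proof -
      have ia: "integrable \<mu>1 (\<lambda>x. ind j x * (f x * a n x))" by (rule i[OF _ integrable_K_a]) measurable
      have i\<alpha>: "integrable \<mu>1 (\<lambda>x. ind j x * (f x * \<alpha> x))" by (rule i[OF _ int]) measurable
      have "\<bar>(\<integral>x. ind j x * (f x * a n x) \<partial>\<mu>1) - (\<integral>x. ind j x * (f x * \<alpha> x) \<partial>\<mu>1)\<bar> =
         \<bar>\<integral>x. ind j x * (f x * a n x) - ind j x * (f x * \<alpha> x) \<partial>\<mu>1\<bar>"
        by (simp add: Bochner_Integration.integral_diff[OF ia i\<alpha>])
      also have "\<dots> \<le> (\<integral>x. \<bar>ind j x * (f x * a n x) - ind j x * (f x * \<alpha> x)\<bar> \<partial>\<mu>1)"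
        by (rule integral_abs_bound)
      also have "\<dots> \<le> (\<integral>x. C * (ind j x * \<bar>a n x - \<alpha> x\<bar>) \<partial>\<mu>1)"
      proof (rule integral_mono[OF integrable_abs[OF Bochner_Integration.integrable_diff[OF ia i\<alpha>]] integrable_mult_right[OF d]])
        show "\<bar>ind j x * (f x * a n x) - ind j x * (f x * \<alpha> x)\<bar> \<le> C * (ind j x * \<bar>a n x - \<alpha> x\<bar>)" for x
          using mult_right_mono[OF C, of x "\<bar>a n x - \<alpha> x\<bar>"] by (auto simp: indicator_def abs_mult[symmetric] right_diff_distrib)
      qed
      also have "\<dots> = C * (\<integral>x. ind j x * \<bar>a n x - \<alpha> x\<bar> \<partial>\<mu>1)" by simp
      finally show ?thesis .
    qed
    then show "\<forall>\<^sub>F n in sequentially. norm ((\<integral>x. ind j x * (f x * a n x) \<partial>\<mu>1) - (\<integral>x. ind j x * (f x * \<alpha> x) \<partial>\<mu>1)) \<le>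
        C * (\<integral>x. ind j x * \<bar>a n x - \<alpha> x\<bar> \<partial>\<mu>1)" by simp
  qed
qed

end

context approximate_scaling
begin

interpretation S: approximate_scaling K "\<lambda>(x, y). q (y, x)" \<mu>2 \<mu>1 b a k
  by (rule swap_approx)

lemmas tendsto_local_integral2 = S.tendsto_local_integral[OF locally_converges_swap]

lemma limit_normalized:
  assumes lc: "locally_converges \<alpha> \<beta>"
  shows "emeasure (density \<mu>1 (\<lambda>x. ennreal (\<alpha> x))) (K k) = emeasure (density \<mu>2 (\<lambda>x. ennreal (\<beta> x))) (K k)"
proof -
  have [measurable]: "\<alpha> \<in> borel_measurable borel" "\<beta> \<in> borel_measurable borel"
    and nonneg: "\<And>x. 0 \<le> \<alpha> x" "\<And>x. 0 \<le> \<beta> x"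
    and int: "integrable \<mu>1 (\<lambda>x. ind k x * \<alpha> x)" "integrable \<mu>2 (\<lambda>x. ind k x * \<beta> x)"
    using lc by (auto simp: locally_converges_def)
  have "(\<integral>x. ind k x * \<alpha> x \<partial>\<mu>1) = (\<integral>x. ind k x * \<beta> x \<partial>\<mu>2)"
    using tendsto_local_integral(1)[OF lc, of "\<lambda>_. 1" k 1] tendsto_local_integral2(1)[OF lc, of "\<lambda>_. 1" k 1] normalized
    by (intro LIMSEQ_unique) auto
  moreover have "emeasure (density M (\<lambda>x. ennreal (f x))) (K k) = ennreal (\<integral>x. ind k x * f x \<partial>M)"
    if [measurable_cong]: "sets M = sets borel" and [measurable]: "f \<in> borel_measurable borel" and "integrable M (\<lambda>x. ind k x * f x)" "\<And>x. 0 \<le> f x" for M f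
  proof -
    have "emeasure (density M (\<lambda>x. ennreal (f x))) (K k) = (\<integral>\<^sup>+x. ennreal (ind k x * f x) \<partial>M)"
      by (subst emeasure_density) (auto intro!: nn_integral_cong simp: indicator_def)
    also have "\<dots> = ennreal (\<integral>x. ind k x * f x \<partial>M)"
      by (rule nn_integral_eq_integral) (use that in auto)
    finally show ?thesis .
  qed
  ultimately show ?thesis using int nonneg by (simp add: sets_\<mu>1 sets_\<mu>2)
qed

end

section \<open>Uniqueness\<close>

context schroedinger_problem
begin

lemma solution_swap:
  "schroedinger_solution q \<mu>1 \<mu>2 \<nu>1 \<nu>2 \<Longrightarrow> schroedinger_solution (\<lambda>(x, y). q (y, x)) \<mu>2 \<mu>1 \<nu>2 \<nu>1"
  unfolding schroedinger_solution_def by simp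

lemma scaled_section:
  assumes [measurable]: "\<beta> \<in> borel_measurable borel" and nonneg: "0 \<le> c" "\<And>x. 0 \<le> \<beta> x"
  shows "ennreal (c) * (\<integral>\<^sup>+y. ennreal (q (x, y)) \<partial>density \<mu>2 (\<lambda>y. ennreal (\<beta> y))) =
    (\<integral>\<^sup>+y. ennreal (q (x, y) * (c * \<beta> y)) \<partial>\<mu>2)"
proof -
  have "ennreal (c) * (\<integral>\<^sup>+y. ennreal (q (x, y)) \<partial>density \<mu>2 (\<lambda>y. ennreal (\<beta> y))) =
      ennreal (c) * (\<integral>\<^sup>+y. ennreal (\<beta> y) * ennreal (q (x, y)) \<partial>\<mu>2)"
    by (subst nn_integral_density) auto
  also have "\<dots> = (\<integral>\<^sup>+y. ennreal (c) * (ennreal (\<beta> y) * ennreal (q (x, y))) \<partial>\<mu>2)"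
    by (rule nn_integral_cmult[symmetric]) measurable
  also have "\<dots> = (\<integral>\<^sup>+y. ennreal (q (x, y) * (c * \<beta> y)) \<partial>\<mu>2)"
    using nonneg q_pos[THEN less_imp_le] by (intro nn_integral_cong) (simp add: mult_ac flip: ennreal_mult)
  finally show ?thesis .
qed

lemma solution_density1:
  assumes sol: "schroedinger_solution q \<mu>1 \<mu>2 \<nu>1 \<nu>2"
  obtains \<alpha> where "\<alpha> \<in> borel_measurable borel" "\<And>x. 0 \<le> \<alpha> x" "\<nu>1 = density \<mu>1 (\<lambda>x. ennreal (\<alpha> x))"
    and "AE x in \<mu>1. 0 < \<alpha> x" "AE x in \<mu>1. ennreal (\<alpha> x) * (\<integral>\<^sup>+y. ennreal (q (x, y)) \<partial>\<nu>2) = 1"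
proof -
  have [measurable_cong]: "sets \<nu>1 = sets borel" "sets \<nu>2 = sets borel"
    and "sigma_finite_measure \<nu>1" "sigma_finite_measure \<nu>2"
    and \<mu>1: "\<mu>1 = density \<nu>1 (\<lambda>x1. \<integral>\<^sup>+x2. ennreal (q (x1, x2)) \<partial>\<nu>2)"
    and \<mu>2: "\<mu>2 = density \<nu>2 (\<lambda>x2. \<integral>\<^sup>+x1. ennreal (q (x1, x2)) \<partial>\<nu>1)"
    using sol by (auto simp: schroedinger_solution_def)
  interpret N1: sigma_finite_measure \<nu>1 by fact
  interpret N2: sigma_finite_measure \<nu>2 by fact
  have sp: "space \<nu>1 = UNIV" "space \<nu>2 = UNIV"
    using sets_eq_imp_space_eq[of \<nu>1 borel] sets_eq_imp_space_eq[of \<nu>2 borel] by (auto simp: \<open>sets \<nu>1 = sets borel\<close> \<open>sets \<nu>2 = sets borel\<close>)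
  have one1: "emeasure \<mu>1 UNIV = 1" and one2: "emeasure \<mu>2 UNIV = 1"
    using M1.emeasure_space_1 M2.emeasure_space_1 by simp_all
  define g where "g x = (\<integral>\<^sup>+y. ennreal (q (x, y)) \<partial>\<nu>2)" for x
  have [measurable]: "g \<in> borel_measurable borel" unfolding g_def by measurable
  have \<mu>1': "\<mu>1 = density \<nu>1 g" using \<mu>1 unfolding g_def .
  have "emeasure \<nu>2 UNIV \<noteq> 0"
  proof
    assume "emeasure \<nu>2 UNIV = 0"
    then have "AE y in \<nu>2. False"
      by (intro AE_I[of _ _ UNIV]) auto
    then have "(\<integral>\<^sup>+x2. (\<integral>\<^sup>+x1. ennreal (q (x1, x2)) \<partial>\<nu>1) * indicator UNIV x2 \<partial>\<nu>2) = (\<integral>\<^sup>+x2. 0 \<partial>\<nu>2)"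
      by (intro nn_integral_cong_AE) auto
    moreover have "emeasure \<mu>2 UNIV = (\<integral>\<^sup>+x2. (\<integral>\<^sup>+x1. ennreal (q (x1, x2)) \<partial>\<nu>1) * indicator UNIV x2 \<partial>\<nu>2)"
      by (subst \<mu>2, rule emeasure_density) measurable
    ultimately show False using one2 by simp
  qed
  have g_pos: "g x \<noteq> 0" for x
  proof
    assume "g x = 0"
    then have "AE y in \<nu>2. ennreal (q (x, y)) = 0"
      unfolding g_def by (subst (asm) nn_integral_0_iff_AE) auto
    then have "AE y in \<nu>2. False"
      by eventually_elim (metis ennreal_eq_0_iff not_le q_pos)
    then have "emeasure \<nu>2 (space \<nu>2) = 0" by (subst (asm) AE_iff_measurable[OF _ refl]) auto
    then show False
      using \<open>emeasure \<nu>2 UNIV \<noteq> 0\<close> sp by simp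
  qed
  have "(\<integral>\<^sup>+x. g x \<partial>\<nu>1) = emeasure (density \<nu>1 g) UNIV"
    by (subst emeasure_density) auto
  also have "\<dots> = 1" using one1 unfolding \<mu>1'[symmetric] .
  finally have fin: "AE x in \<nu>1. g x \<noteq> \<infinity>"
    by (intro nn_integral_PInf_AE) auto
  define \<alpha> where "\<alpha> x = 1 / enn2real (g x)" for x
  have [measurable]: "\<alpha> \<in> borel_measurable borel" unfolding \<alpha>_def by measurable
  have \<alpha>0: "0 \<le> \<alpha> x" for x by (simp add: \<alpha>_def)
  have one: "ennreal (\<alpha> x) * g x = 1 \<and> 0 < \<alpha> x" if g_fin: "g x \<noteq> \<infinity>" for x
  proof -
    obtain r where r: "g x = ennreal r" "0 < r"
      using g_fin g_pos[of x] by (cases "g x") (auto simp: order_less_le)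
    then show ?thesis by (simp add: \<alpha>_def flip: ennreal_mult)
  qed
  have fin': "AE x in \<mu>1. g x \<noteq> \<infinity>"
    unfolding \<mu>1' by (subst AE_density) (use fin in auto)
  have "density \<mu>1 (\<lambda>x. ennreal (\<alpha> x)) = density \<nu>1 (\<lambda>x. g x * ennreal (\<alpha> x))"
    unfolding \<mu>1' by (rule density_density_eq) auto
  also have "\<dots> = density \<nu>1 (\<lambda>_. 1)"
    by (rule density_cong) (use fin one in \<open>auto simp: mult.commute\<close>)
  also have "\<dots> = \<nu>1" by (rule density_1)
  finally have "\<nu>1 = density \<mu>1 (\<lambda>x. ennreal (\<alpha> x))" by simp
  moreover have "AE x in \<mu>1. 0 < \<alpha> x" "AE x in \<mu>1. ennreal (\<alpha> x) * (\<integral>\<^sup>+y. ennreal (q (x, y)) \<partial>\<nu>2) = 1"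
    using fin' one unfolding g_def[symmetric] by auto
  ultimately show thesis using \<alpha>0 by (intro that[of \<alpha>]) auto
qed

end

context schroedinger_problem
begin

interpretation S: schroedinger_problem K "\<lambda>(x, y). q (y, x)" \<mu>2 \<mu>1
  by (rule swap)

lemma solution_densities:
  assumes sol: "schroedinger_solution q \<mu>1 \<mu>2 \<nu>1 \<nu>2"
  obtains \<alpha> \<beta> where "admissible \<alpha> \<beta>"
    and "\<nu>1 = density \<mu>1 (\<lambda>x. ennreal (\<alpha> x))" "\<nu>2 = density \<mu>2 (\<lambda>x. ennreal (\<beta> x))"
    and "AE x in \<mu>1. 0 < \<alpha> x" "AE x in \<mu>2. 0 < \<beta> x"
    and "defect1 \<alpha> \<beta> = 0" "defect2 \<alpha> \<beta> = 0"
    and "(\<integral>\<^sup>+(x, y). ennreal (q (x, y) * (\<alpha> x * \<beta> y)) \<partial>\<pi>) = 1"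
proof -
  obtain \<alpha> where \<alpha> [measurable]: "\<alpha> \<in> borel_measurable borel" and \<alpha>0: "\<And>x. 0 \<le> \<alpha> x"
    and \<nu>1: "\<nu>1 = density \<mu>1 (\<lambda>x. ennreal (\<alpha> x))"
    and \<alpha>1: "AE x in \<mu>1. 0 < \<alpha> x" "AE x in \<mu>1. ennreal (\<alpha> x) * (\<integral>\<^sup>+y. ennreal (q (x, y)) \<partial>\<nu>2) = 1"
    by (rule solution_density1[OF sol]) blast
  obtain \<beta> where \<beta> [measurable]: "\<beta> \<in> borel_measurable borel" and \<beta>0: "\<And>x. 0 \<le> \<beta> x"
    and \<nu>2: "\<nu>2 = density \<mu>2 (\<lambda>x. ennreal (\<beta> x))"
    and \<beta>1: "AE x in \<mu>2. 0 < \<beta> x" "AE y in \<mu>2. ennreal (\<beta> y) * (\<integral>\<^sup>+x. ennreal (q (x, y)) \<partial>\<nu>1) = 1"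
    by (rule S.solution_density1[OF solution_swap[OF sol]]) auto
  have H0: "0 \<le> q (x, y) * (\<alpha> x * \<beta> y)" for x y
    using q_pos[of "(x, y)"] \<alpha>0 \<beta>0 by (simp add: less_imp_le)
  have n1: "AE x in \<mu>1. (\<integral>\<^sup>+y. ennreal (q (x, y) * (\<alpha> x * \<beta> y)) \<partial>\<mu>2) = 1"
    using \<alpha>1(2) unfolding \<nu>2 by (simp add: scaled_section[OF \<beta> \<alpha>0 \<beta>0])
  have n2: "AE y in \<mu>2. (\<integral>\<^sup>+x. ennreal (q (x, y) * (\<alpha> x * \<beta> y)) \<partial>\<mu>1) = 1"
    using \<beta>1(2) S.scaled_section[OF \<alpha> \<beta>0 \<alpha>0] unfolding \<nu>1 by (simp add: mult.commute)
  have "(\<integral>\<^sup>+z. (case z of (x, y) \<Rightarrow> ennreal (q (x, y) * (\<alpha> x * \<beta> y))) \<partial>\<pi>) = (\<integral>\<^sup>+x. \<integral>\<^sup>+y. ennreal (q (x, y) * (\<alpha> x * \<beta> y)) \<partial>\<mu>2 \<partial>\<mu>1)"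
    by (subst M2.nn_integral_fst[symmetric]) auto
  also have "\<dots> = (\<integral>\<^sup>+x. 1 \<partial>\<mu>1)" by (rule nn_integral_cong_AE) (rule n1)
  also have "\<dots> = 1" using M1.emeasure_space_1 by simp
  finally have tot: "(\<integral>\<^sup>+z. (case z of (x, y) \<Rightarrow> ennreal (q (x, y) * (\<alpha> x * \<beta> y))) \<partial>\<pi>) = 1" .
  have "integrable \<pi> (\<lambda>(x, y). q (x, y) * (\<alpha> x * \<beta> y))"
    by (rule integrableI_nonneg) (use H0 tot in \<open>auto simp: split_beta'\<close>)
  then have "admissible \<alpha> \<beta>" using \<alpha>0 \<beta>0 by (simp add: admissible_def)
  have *: "(\<integral>x. \<bar>h x - 1\<bar> \<partial>M) = 0" if "AE x in M. h x = 1" for M and h :: "'a \<Rightarrow> real"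
  proof -
    have "AE x in M. \<bar>h x - 1\<bar> = 0" using that by eventually_elim simp
    then show ?thesis by (rule integral_eq_zero_AE)
  qed
  have "defect1 \<alpha> \<beta> = 0"
    unfolding marginal_defect_def
  proof (rule *)
    show "AE x in \<mu>1. (\<integral>y. q (x, y) * (\<alpha> x * \<beta> y) \<partial>\<mu>2) = 1"
      using n1 by eventually_elim (subst integral_eq_nn_integral; use H0 in simp)
  qed
  moreover have "defect2 \<alpha> \<beta> = 0"
    unfolding defect2_eq
  proof (rule *)
    show "AE y in \<mu>2. (\<integral>x. q (x, y) * (\<alpha> x * \<beta> y) \<partial>\<mu>1) = 1"
      using n2 by eventually_elim (subst integral_eq_nn_integral; use H0 in simp)
  qed
  ultimately show thesis
    by (intro that[of \<alpha> \<beta>]) (use \<open>admissible \<alpha> \<beta>\<close> \<nu>1 \<nu>2 \<alpha>1(1) \<beta>1(1) tot in auto)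
qed

lemma emeasure_K_density:
  assumes "f \<in> borel_measurable borel"
  shows "emeasure (density \<mu>1 (\<lambda>x. ennreal (f x))) (K j) = (\<integral>\<^sup>+x. indicator (K j) x * ennreal (f x) \<partial>\<mu>1)"
    and "emeasure (density \<mu>2 (\<lambda>x. ennreal (f x))) (K j) = (\<integral>\<^sup>+x. indicator (K j) x * ennreal (f x) \<partial>\<mu>2)"
  using assms by (auto simp: emeasure_density mult.commute)

lemma solution_charged2:
  assumes sol: "schroedinger_solution q \<mu>1 \<mu>2 \<nu>1 \<nu>2" and ch: "0 < measure \<mu>2 (K j)"
  shows "emeasure \<nu>2 (K j) \<noteq> 0"
proof
  assume z: "emeasure \<nu>2 (K j) = 0"
  obtain \<alpha> \<beta> where ab: "admissible \<alpha> \<beta>" and \<nu>2: "\<nu>2 = density \<mu>2 (\<lambda>x. ennreal (\<beta> x))"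
    and pos: "AE x in \<mu>2. 0 < \<beta> x"
    by (rule solution_densities[OF sol]) blast
  have [measurable]: "\<beta> \<in> borel_measurable borel" using ab by (simp add: admissible_def)
  have "(\<integral>\<^sup>+x. indicator (K j) x * ennreal (\<beta> x) \<partial>\<mu>2) = 0"
    using z unfolding \<nu>2 by (simp add: emeasure_K_density)
  then have "AE x in \<mu>2. indicator (K j) x * ennreal (\<beta> x) = 0"
    by (subst (asm) nn_integral_0_iff_AE) auto
  then have "AE x in \<mu>2. x \<notin> K j"
    using pos by eventually_elim (auto simp: indicator_def)
  then have "measure \<mu>2 (K j) = 0"
    by (simp add: AE_iff_measurable[OF _ refl] measure_def)
  then show False using ch by simp
qed

lemma solution_finite1:
  assumes sol: "schroedinger_solution q \<mu>1 \<mu>2 \<nu>1 \<nu>2" and ch: "0 < measure \<mu>2 (K j)"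
  shows "emeasure \<nu>1 (K j) < \<infinity>"
proof -
  obtain \<alpha> \<beta> where ab: "admissible \<alpha> \<beta>" and \<nu>: "\<nu>1 = density \<mu>1 (\<lambda>x. ennreal (\<alpha> x))" "\<nu>2 = density \<mu>2 (\<lambda>x. ennreal (\<beta> x))"
    and tot: "(\<integral>\<^sup>+(x, y). ennreal (q (x, y) * (\<alpha> x * \<beta> y)) \<partial>\<pi>) = 1"
    by (rule solution_densities[OF sol]) blast
  have [measurable]: "\<alpha> \<in> borel_measurable borel" "\<beta> \<in> borel_measurable borel"
    and nonneg: "\<And>x. 0 \<le> \<alpha> x" "\<And>x. 0 \<le> \<beta> x"
    using ab by (auto simp: admissible_def)
  obtain m M where m: "0 < m" "m \<le> M" "\<And>x y. x \<in> K j \<Longrightarrow> y \<in> K j \<Longrightarrow> m \<le> q (x, y) \<and> q (x, y) \<le> M"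
    using q_bounds[of j] by metis
  have "ennreal m * (emeasure \<nu>1 (K j) * emeasure \<nu>2 (K j)) =
      ennreal m * (\<integral>\<^sup>+x. \<integral>\<^sup>+y. (indicator (K j) x * ennreal (\<alpha> x)) * (indicator (K j) y * ennreal (\<beta> y)) \<partial>\<mu>2 \<partial>\<mu>1)"
    unfolding \<nu> by (simp add: emeasure_K_density nn_integral_cmult nn_integral_multc)
  also have "\<dots> = (\<integral>\<^sup>+x. \<integral>\<^sup>+y. ennreal m * ((indicator (K j) x * ennreal (\<alpha> x)) * (indicator (K j) y * ennreal (\<beta> y))) \<partial>\<mu>2 \<partial>\<mu>1)"
    by (simp add: nn_integral_cmult)
  also have "\<dots> \<le> (\<integral>\<^sup>+x. \<integral>\<^sup>+y. ennreal (q (x, y) * (\<alpha> x * \<beta> y)) \<partial>\<mu>2 \<partial>\<mu>1)"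
  proof (intro nn_integral_mono)
    fix x y
    show "ennreal m * ((indicator (K j) x * ennreal (\<alpha> x)) * (indicator (K j) y * ennreal (\<beta> y))) \<le> ennreal (q (x, y) * (\<alpha> x * \<beta> y))"
      using m(1) m(3)[of x y] nonneg
      by (auto simp: indicator_def simp flip: ennreal_mult intro!: ennreal_leI mult_right_mono)
  qed
  also have "\<dots> = 1"
    using tot by (subst (asm) M2.nn_integral_fst[symmetric]) auto
  finally have "emeasure \<nu>1 (K j) * emeasure \<nu>2 (K j) \<noteq> \<infinity>"
    using m(1) by (auto simp: ennreal_mult_top top_unique)
  then show ?thesis
    using solution_charged2[OF sol ch] by (auto simp: ennreal_mult_eq_top_iff less_top)
qed

lemma solution_unique1:
  assumes sol: "schroedinger_solution q \<mu>1 \<mu>2 \<nu>1 \<nu>2" "schroedinger_solution q \<mu>1 \<mu>2 \<nu>1' \<nu>2'"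
    and norm: "emeasure \<nu>1 (K k) = emeasure \<nu>2 (K k)" "emeasure \<nu>1' (K k) = emeasure \<nu>2' (K k)"
    and ch: "0 < measure \<mu>2 (K k)"
  shows "\<nu>1 = \<nu>1'"
proof -
  obtain \<alpha> \<beta> where ab: "admissible \<alpha> \<beta>" and \<nu>: "\<nu>1 = density \<mu>1 (\<lambda>x. ennreal (\<alpha> x))" "\<nu>2 = density \<mu>2 (\<lambda>x. ennreal (\<beta> x))"
    and pos: "AE x in \<mu>1. 0 < \<alpha> x" "AE x in \<mu>2. 0 < \<beta> x"
    and d: "defect1 \<alpha> \<beta> = 0" "defect2 \<alpha> \<beta> = 0"
    by (rule solution_densities[OF sol(1)]) blast
  obtain \<alpha>' \<beta>' where ab': "admissible \<alpha>' \<beta>'" and \<nu>': "\<nu>1' = density \<mu>1 (\<lambda>x. ennreal (\<alpha>' x))" "\<nu>2' = density \<mu>2 (\<lambda>x. ennreal (\<beta>' x))"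
    and d': "defect1 \<alpha>' \<beta>' = 0" "defect2 \<alpha>' \<beta>' = 0"
    by (rule solution_densities[OF sol(2)]) blast
  have meas [measurable]: "\<alpha> \<in> borel_measurable borel" "\<beta> \<in> borel_measurable borel" "\<alpha>' \<in> borel_measurable borel" "\<beta>' \<in> borel_measurable borel"
    and nonneg: "\<And>x. 0 \<le> \<alpha> x" "\<And>x. 0 \<le> \<beta> x" "\<And>x. 0 \<le> \<alpha>' x" "\<And>x. 0 \<le> \<beta>' x"
    and i: "integrable \<pi> (\<lambda>(x, y). q (x, y) * (\<alpha> x * \<beta> y))"
      "integrable \<pi> (\<lambda>(x, y). q (x, y) * (\<alpha>' x * \<beta>' y))"
    using ab ab' by (auto simp: admissible_def)
  define X where "X = (\<lambda>(x, y). q (x, y) * (\<alpha> x * \<beta> y - \<alpha>' x * \<beta>' y)\<^sup>2 / ((\<alpha> x + \<alpha>' x) * (\<beta> y + \<beta>' y)))"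
  have [measurable]: "X \<in> borel_measurable \<pi>" unfolding X_def by measurable
  have "2 * (\<integral>\<^sup>+z. ennreal (X z) \<partial>\<pi>) \<le> 0"
    unfolding X_def
    by (rule order_trans[OF scaling_stability[OF meas nonneg i]])
      (use add_mono[OF defect_diff[OF ab ab']] d d' in \<open>simp add: ennreal_neg\<close>)
  then have "AE z in \<pi>. ennreal (X z) = 0"
    by (subst nn_integral_0_iff_AE[symmetric]) auto
  from AE_pair[OF this]
  have eq: "AE x in \<mu>1. AE y in \<mu>2. \<alpha> x * \<beta> y = \<alpha>' x * \<beta>' y"
    using pos(1)
  proof eventually_elim
    case (elim x)
    from elim(1) pos(2) show ?case
    proof eventually_elim
      case e: (elim y)
      have p: "0 < (\<alpha> x + \<alpha>' x) * (\<beta> y + \<beta>' y)"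
        using elim(2) e(2) nonneg by (intro mult_pos_pos add_pos_nonneg) auto
      have "X (x, y) \<le> 0" using e(1) by (simp add: ennreal_eq_0_iff)
      then have "q (x, y) * (\<alpha> x * \<beta> y - \<alpha>' x * \<beta>' y)\<^sup>2 \<le> 0"
        using p by (simp add: X_def divide_le_0_iff)
      then have "(\<alpha> x * \<beta> y - \<alpha>' x * \<beta>' y)\<^sup>2 \<le> 0"
        using q_pos[of "(x, y)"] by (simp add: mult_le_0_iff not_le)
      then show ?case by simp
    qed
  qed
  let ?p = "emeasure \<nu>1 (K k)" and ?p' = "emeasure \<nu>1' (K k)"
  have ap: "AE x in \<mu>1. ennreal (\<alpha> x) * ?p = ennreal (\<alpha>' x) * ?p'"
    using eq
  proof eventually_elim
    case (elim x)
    have "ennreal (\<alpha> x) * ?p = (\<integral>\<^sup>+y. ennreal (\<alpha> x) * (indicator (K k) y * ennreal (\<beta> y)) \<partial>\<mu>2)"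
      unfolding norm(1) unfolding \<nu>(2) by (simp add: emeasure_K_density nn_integral_cmult)
    also have "\<dots> = (\<integral>\<^sup>+y. ennreal (\<alpha>' x) * (indicator (K k) y * ennreal (\<beta>' y)) \<partial>\<mu>2)"
    proof (rule nn_integral_cong_AE)
      show "AE y in \<mu>2. ennreal (\<alpha> x) * (indicator (K k) y * ennreal (\<beta> y)) = ennreal (\<alpha>' x) * (indicator (K k) y * ennreal (\<beta>' y))"
        using elim by eventually_elim (use nonneg in \<open>auto simp: indicator_def simp flip: ennreal_mult\<close>)
    qed
    also have "\<dots> = ennreal (\<alpha>' x) * ?p'"
      unfolding norm(2) unfolding \<nu>'(2) by (simp add: emeasure_K_density nn_integral_cmult)
    finally show ?case .
  qed
  have "?p * ?p = (\<integral>\<^sup>+x. indicator (K k) x * (ennreal (\<alpha> x) * ?p) \<partial>\<mu>1)"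
    unfolding \<nu>(1) by (simp add: emeasure_K_density nn_integral_multc flip: mult.assoc)
  also have "\<dots> = (\<integral>\<^sup>+x. indicator (K k) x * (ennreal (\<alpha>' x) * ?p') \<partial>\<mu>1)"
    by (rule nn_integral_cong_AE) (use ap in eventually_elim, simp)
  also have "\<dots> = ?p' * ?p'"
    unfolding \<nu>'(1) by (simp add: emeasure_K_density nn_integral_multc flip: mult.assoc)
  finally have sq: "?p * ?p = ?p' * ?p'" .
  have fin: "?p < \<infinity>" "?p' < \<infinity>" using solution_finite1 sol ch by auto
  have nz: "?p \<noteq> 0" unfolding norm by (rule solution_charged2[OF sol(1) ch])
  obtain r r' where r: "?p = ennreal r" "0 \<le> r" "?p' = ennreal r'" "0 \<le> r'"
    using fin by (cases ?p; cases ?p') auto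
  then have "r * r = r' * r'" using sq by (simp flip: ennreal_mult)
  then have "r = r'" using r by (metis power2_eq_square power2_eq_iff_nonneg)
  have "AE x in \<mu>1. ennreal (\<alpha> x) = ennreal (\<alpha>' x)"
    using ap
  proof eventually_elim
    case (elim x)
    then have "\<alpha> x * r = \<alpha>' x * r" using r nonneg \<open>r = r'\<close> by (simp flip: ennreal_mult)
    then show ?case using nz r by simp
  qed
  then show ?thesis unfolding \<nu> \<nu>' by (intro density_cong) auto
qed

end

context schroedinger_problem
begin

interpretation S: schroedinger_problem K "\<lambda>(x, y). q (y, x)" \<mu>2 \<mu>1
  by (rule swap)

lemma solution_unique:
  assumes "schroedinger_solution q \<mu>1 \<mu>2 \<nu>1 \<nu>2" "schroedinger_solution q \<mu>1 \<mu>2 \<nu>1' \<nu>2'"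
    and "emeasure \<nu>1 (K k) = emeasure \<nu>2 (K k)" "emeasure \<nu>1' (K k) = emeasure \<nu>2' (K k)"
    and "0 < measure \<mu>1 (K k)" "0 < measure \<mu>2 (K k)"
  shows "\<nu>1 = \<nu>1' \<and> \<nu>2 = \<nu>2'"
  using solution_unique1[OF assms(1-4,6)]
    S.solution_unique1[OF solution_swap[OF assms(1)] solution_swap[OF assms(2)] assms(3,4)[symmetric] assms(5)] by simp

end

section \<open>Sinkhorn's iteration\<close>

lemma compact_insert_limit:
  fixes x :: "nat \<Rightarrow> 'b::topological_space"
  assumes "x \<longlonglongrightarrow> a"
  shows "compact (insert a (range x))"
  unfolding compact_eq_Heine_Borel
proof (intro allI impI, elim conjE)
  fix \<U> assume \<U>: "\<forall>U\<in>\<U>. open U" "insert a (range x) \<subseteq> \<Union>\<U>"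
  then obtain U where U: "U \<in> \<U>" "a \<in> U" by blast
  then have "\<forall>\<^sub>F n in sequentially. x n \<in> U"
    using \<U>(1) assms by (intro topological_tendstoD) auto
  then obtain N where N: "\<And>n. N \<le> n \<Longrightarrow> x n \<in> U" by (auto simp: eventually_sequentially)
  have "\<forall>n. \<exists>V. V \<in> \<U> \<and> x n \<in> V" using \<U>(2) by blast
  then obtain V where V: "\<And>n. V n \<in> \<U> \<and> x n \<in> V n" by metis
  have "x n \<in> U \<or> x n \<in> \<Union>(V ` {..<N})" for n
    using N[of n] V[of n] by (cases "N \<le> n") auto
  then show "\<exists>\<U>'\<subseteq>\<U>. finite \<U>' \<and> insert a (range x) \<subseteq> \<Union>\<U>'"
    using U V by (intro exI[of _ "insert U (V ` {..<N})"]) auto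
qed

definition sinkhorn_half ::
  "'a set \<Rightarrow> ('a \<times> 'a \<Rightarrow> real) \<Rightarrow> 'a measure \<Rightarrow> ('a \<Rightarrow> real) \<Rightarrow> 'a \<Rightarrow> real" where
  "sinkhorn_half C q \<rho> f x = 1 / (\<integral>y. indicator C y * (q (x, y) * f y) \<partial>\<rho>)"

locale compact_kernel =
  fixes C :: "'a::metric_space set" and q :: "'a \<times> 'a \<Rightarrow> real" and \<rho> :: "'a measure"
  assumes compact_C: "compact C"
    and continuous_q: "continuous_on UNIV q" and q_pos: "0 < q z"
    and prob_\<rho>: "prob_space \<rho>" and sets_\<rho>: "sets \<rho> = sets borel"
    and charged: "0 < measure \<rho> C"
begin

interpretation prob_space \<rho> by (rule prob_\<rho>)

declare sets_\<rho> [measurable_cong]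

lemma C_borel [measurable]: "C \<in> sets borel"
  using compact_C compact_imp_closed borel_closed by blast

lemma C_nonempty: "C \<noteq> {}"
  using charged by auto

lemma integrable_C:
  assumes g: "continuous_on UNIV g"
  shows "integrable \<rho> (\<lambda>y. indicator C y * (g y :: real))"
proof -
  have "compact (g ` C)"
    using compact_continuous_image[OF continuous_on_subset[OF g] compact_C] by simp
  then obtain B where B: "\<And>y. y \<in> C \<Longrightarrow> \<bar>g y\<bar> \<le> B"
    using compact_imp_bounded bounded_iff by (metis imageI real_norm_def)
  have [measurable]: "g \<in> borel_measurable borel" by (rule borel_measurable_continuous_onI[OF g])
  show ?thesis
    by (rule integrable_const_bound[where B="\<bar>B\<bar>"]) (use B in \<open>fastforce simp: indicator_def intro!: AE_I2\<close>, measurable)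
qed

lemma positive_bounds:
  fixes g :: "'a \<Rightarrow> real"
  assumes g: "continuous_on UNIV g" "\<And>y. 0 < g y"
  obtains l u :: real where "0 < l" "0 < u" "\<And>y. y \<in> C \<Longrightarrow> l \<le> g y" "\<And>y. y \<in> C \<Longrightarrow> g y \<le> u"
proof -
  have c: "continuous_on C g" using g(1) continuous_on_subset by blast
  obtain y1 y2 where "\<forall>y\<in>C. g y1 \<le> g y" "\<forall>y\<in>C. g y \<le> g y2"
    using continuous_attains_inf[OF compact_C C_nonempty c] continuous_attains_sup[OF compact_C C_nonempty c] by blast
  then show thesis using that[of "g y1" "g y2"] g(2) by auto
qed

lemma kernel_bounds:
  obtains m M where "0 < m" "m \<le> M" "\<And>x y. x \<in> C \<Longrightarrow> y \<in> C \<Longrightarrow> m \<le> q (x, y)" "\<And>x y. x \<in> C \<Longrightarrow> y \<in> C \<Longrightarrow> q (x, y) \<le> M"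
proof -
  have n: "C \<times> C \<noteq> {}" using C_nonempty by auto
  have c: "continuous_on (C \<times> C) q" using continuous_q continuous_on_subset by blast
  obtain z1 z2 where "z1 \<in> C \<times> C" "\<forall>z\<in>C \<times> C. q z1 \<le> q z" "\<forall>z\<in>C \<times> C. q z \<le> q z2"
    using continuous_attains_inf[OF compact_Times[OF compact_C compact_C] n c]
      continuous_attains_sup[OF compact_Times[OF compact_C compact_C] n c] by blast
  moreover from this have "q z1 \<le> q z2" by blast
  ultimately show thesis using that[of "q z1" "q z2"] q_pos by auto
qed

lemma integral_C_pos:
  fixes g :: "'a \<Rightarrow> real"
  assumes g: "continuous_on UNIV g" "\<And>y. 0 < g y"
  shows "0 < (\<integral>y. indicator C y * g y \<partial>\<rho>)"
proof -
  obtain l u where l: "0 < l" "\<And>y. y \<in> C \<Longrightarrow> l \<le> g y" by (rule positive_bounds[OF g]) blast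
  have "0 < l * measure \<rho> C" using l charged by simp
  also have "\<dots> = (\<integral>y. indicator C y * l \<partial>\<rho>)" by simp
  also have "\<dots> \<le> (\<integral>y. indicator C y * g y \<partial>\<rho>)"
    by (intro integral_mono integrable_C g continuous_on_const) (use l in \<open>auto simp: indicator_def\<close>)
  finally show ?thesis .
qed

lemma continuous_section: "continuous_on UNIV f \<Longrightarrow> continuous_on UNIV (\<lambda>y. q (x, y) * f y)"
  by (intro continuous_intros continuous_on_compose2[OF continuous_q]) auto

lemma denominator_pos:
  assumes f: "continuous_on UNIV f" "\<And>y. 0 < f y"
  shows "0 < (\<integral>y. indicator C y * (q (x, y) * f y) \<partial>\<rho>)"
  by (intro integral_C_pos continuous_section f mult_pos_pos q_pos)

lemma sinkhorn_half_pos: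
  assumes "continuous_on UNIV f" "\<And>y. 0 < f y"
  shows "0 < sinkhorn_half C q \<rho> f x"
  unfolding sinkhorn_half_def using denominator_pos[OF assms] by simp

lemma continuous_denominator:
  assumes f: "continuous_on UNIV f"
  shows "continuous_on UNIV (\<lambda>x. \<integral>y. indicator C y * (q (x, y) * f y) \<partial>\<rho>)"
  unfolding continuous_on_sequentially comp_def
proof (intro allI ballI impI, elim conjE)
  fix x :: "nat \<Rightarrow> 'a" and a
  assume x: "x \<longlonglongrightarrow> a"
  have [measurable]: "(\<lambda>y. q (x, y) * f y) \<in> borel_measurable borel" for x
    by (intro borel_measurable_continuous_onI continuous_section f)
  have "continuous_on UNIV (\<lambda>z. q z * f (snd z))"
    by (intro continuous_intros continuous_q continuous_on_compose2[OF f]) auto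
  then have "continuous_on (insert a (range x) \<times> C) (\<lambda>z. q z * f (snd z))"
    by (rule continuous_on_subset) (rule subset_UNIV)
  then have "bounded ((\<lambda>z. q z * f (snd z)) ` (insert a (range x) \<times> C))"
    by (rule compact_imp_bounded[OF compact_continuous_image]) (rule compact_Times[OF compact_insert_limit[OF x] compact_C])
  then obtain B where "\<forall>w\<in>(\<lambda>z. q z * f (snd z)) ` (insert a (range x) \<times> C). norm w \<le> B"
    unfolding bounded_iff by blast
  then have B: "\<bar>q z * f (snd z)\<bar> \<le> B" if "z \<in> insert a (range x) \<times> C" for z
    using that unfolding real_norm_def by blast
  show "(\<lambda>n. \<integral>y. indicator C y * (q (x n, y) * f y) \<partial>\<rho>) \<longlonglongrightarrow> (\<integral>y. indicator C y * (q (a, y) * f y) \<partial>\<rho>)"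
  proof (rule integral_dominated_convergence[where w="\<lambda>_. \<bar>B\<bar>"])
    show "AE y in \<rho>. (\<lambda>n. indicator C y * (q (x n, y) * f y)) \<longlonglongrightarrow> indicator C y * (q (a, y) * f y)"
    proof (rule AE_I2)
      fix y
      have "(\<lambda>n. q (x n, y)) \<longlonglongrightarrow> q (a, y)"
        by (rule continuous_on_tendsto_compose[OF continuous_q]) (auto intro!: tendsto_intros x)
      then show "(\<lambda>n. indicator C y * (q (x n, y) * f y)) \<longlonglongrightarrow> indicator C y * (q (a, y) * f y)"
        by (intro tendsto_intros)
    qed
    show "AE y in \<rho>. norm (indicator C y * (q (x n, y) * f y)) \<le> \<bar>B\<bar>" for n
    proof (rule AE_I2)
      fix y show "norm (indicator C y * (q (x n, y) * f y)) \<le> \<bar>B\<bar>"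
        using B[of "(x n, y)"] by (auto simp: indicator_def)
    qed
  qed auto
qed

lemma continuous_sinkhorn_half:
  assumes f: "continuous_on UNIV f" "\<And>y. 0 < f y"
  shows "continuous_on UNIV (sinkhorn_half C q \<rho> f)"
  unfolding sinkhorn_half_def[abs_def]
proof (intro continuous_on_divide continuous_on_const continuous_denominator f(1) ballI)
  show "(\<integral>y. indicator C y * (q (x, y) * f y) \<partial>\<rho>) \<noteq> 0" for x
    using denominator_pos[OF f, of x] by (rule less_imp_neq[symmetric])
qed

end

definition ratio_close :: "'a set \<Rightarrow> real \<Rightarrow> ('a \<Rightarrow> real) \<Rightarrow> ('a \<Rightarrow> real) \<Rightarrow> bool" where
  "ratio_close C c f g \<longleftrightarrow> (\<exists>\<alpha>>0. \<forall>x\<in>C. \<alpha> * g x \<le> f x \<and> f x \<le> \<alpha> * (1 + c) * g x)"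

context compact_kernel
begin

interpretation prob_space \<rho> by (rule prob_\<rho>)

text \<open>
  Birkhoff's contraction: the ratio of the two integrals is an average of \<open>f / g\<close> against a
  probability measure that dominates \<open>m / M\<close> times a fixed one.
\<close>

lemma ratio_close_contraction:
  assumes f: "continuous_on UNIV f" "\<And>y. 0 < f y" and g: "continuous_on UNIV g" "\<And>y. 0 < g y"
    and c: "0 \<le> c" and close: "ratio_close C c f g"
    and m: "0 < m" "m \<le> M" "\<And>x y. x \<in> C \<Longrightarrow> y \<in> C \<Longrightarrow> m \<le> q (x, y)" "\<And>x y. x \<in> C \<Longrightarrow> y \<in> C \<Longrightarrow> q (x, y) \<le> M"
  shows "ratio_close C ((1 - m / M) * c) (sinkhorn_half C q \<rho> f) (sinkhorn_half C q \<rho> g)"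
proof -
  obtain \<alpha> where \<alpha>: "0 < \<alpha>" "\<And>x. x \<in> C \<Longrightarrow> \<alpha> * g x \<le> f x" "\<And>x. x \<in> C \<Longrightarrow> f x \<le> \<alpha> * (1 + c) * g x"
    using close unfolding ratio_close_def by blast
  define \<beta> where "\<beta> = \<alpha> * (1 + c)"
  define F where "F x = (\<integral>y. indicator C y * (q (x, y) * f y) \<partial>\<rho>)" for x
  define G where "G x = (\<integral>y. indicator C y * (q (x, y) * g y) \<partial>\<rho>)" for x
  define If where "If = (\<integral>y. indicator C y * f y \<partial>\<rho>)"
  define Ig where "Ig = (\<integral>y. indicator C y * g y \<partial>\<rho>)"
  define \<kappa> where "\<kappa> = If / Ig"
  define \<theta> where "\<theta> = m / M"
  have Ig: "0 < Ig" unfolding Ig_def by (rule integral_C_pos[OF g])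
  have FG: "0 < F x" "0 < G x" for x unfolding F_def G_def by (auto intro: denominator_pos f g)
  have \<theta>: "0 < \<theta>" "\<theta> \<le> 1" using m(1,2) by (auto simp: \<theta>_def)
  have iq: "integrable \<rho> (\<lambda>y. indicator C y * (q (x, y) * h y))" if "continuous_on UNIV h" for h x
    by (intro integrable_C continuous_section that)
  have low: "\<alpha> * Ig \<le> If"
    unfolding If_def Ig_def integral_mult_right_zero[symmetric]
    by (intro integral_mono integrable_mult_right integrable_C f g) (use \<alpha>(2) in \<open>auto simp: indicator_def\<close>)
  have up: "If \<le> \<beta> * Ig"
    unfolding If_def Ig_def integral_mult_right_zero[symmetric]
    by (intro integral_mono integrable_mult_right integrable_C f g) (use \<alpha>(3) in \<open>auto simp: indicator_def \<beta>_def\<close>)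
  have GM: "G x \<le> M * Ig" if "x \<in> C" for x
    unfolding G_def Ig_def integral_mult_right_zero[symmetric]
    by (intro integral_mono integrable_mult_right integrable_C continuous_section g)
      (use m(4)[OF that] g(2) in \<open>auto simp: indicator_def less_imp_le intro!: mult_right_mono\<close>)
  have key: "\<theta> * G x * (s / Ig) \<le> m * s" if "x \<in> C" "0 \<le> s" for x s
  proof -
    have "\<theta> * G x * (s / Ig) \<le> \<theta> * (M * Ig) * (s / Ig)"
      using GM[OF that(1)] \<theta>(1) Ig that(2) by (intro mult_right_mono mult_left_mono) auto
    also have "\<dots> = m * s" using Ig m(1,2) by (simp add: \<theta>_def)
    finally show ?thesis .
  qed
  define \<alpha>1 where "\<alpha>1 = \<alpha> + \<theta> * (\<kappa> - \<alpha>)"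
  define \<beta>1 where "\<beta>1 = \<beta> - \<theta> * (\<beta> - \<kappa>)"
  have \<kappa>: "\<alpha> \<le> \<kappa>" "\<kappa> \<le> \<beta>" using low up Ig by (auto simp: \<kappa>_def field_simps)
  have lowF: "\<alpha>1 * G x \<le> F x" if x: "x \<in> C" for x
  proof -
    have "\<theta> * G x * ((If - \<alpha> * Ig) / Ig) \<le> m * (If - \<alpha> * Ig)" using low by (intro key x) simp
    also have "\<dots> = (\<integral>y. m * (indicator C y * f y - \<alpha> * (indicator C y * g y)) \<partial>\<rho>)"
      using integrable_C[OF f(1)] integrable_C[OF g(1)] by (simp add: If_def Ig_def)
    also have "\<dots> \<le> (\<integral>y. indicator C y * (q (x, y) * f y) - \<alpha> * (indicator C y * (q (x, y) * g y)) \<partial>\<rho>)"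
    proof (intro integral_mono integrable_mult_right Bochner_Integration.integrable_diff integrable_C continuous_section f g)
      fix y show "m * (indicator C y * f y - \<alpha> * (indicator C y * g y)) \<le> indicator C y * (q (x, y) * f y) - \<alpha> * (indicator C y * (q (x, y) * g y))"
        using mult_right_mono[OF m(3)[OF x], of y "f y - \<alpha> * g y"] \<alpha>(2)[of y] by (auto simp: indicator_def algebra_simps)
    qed
    also have "\<dots> = F x - \<alpha> * G x" using iq[OF f(1), of x] iq[OF g(1), of x] by (simp add: F_def G_def)
    finally show ?thesis using Ig by (simp add: \<alpha>1_def \<kappa>_def field_simps)
  qed
  have upF: "F x \<le> \<beta>1 * G x" if x: "x \<in> C" for x
  proof -
    have "\<theta> * G x * ((\<beta> * Ig - If) / Ig) \<le> m * (\<beta> * Ig - If)" using up by (intro key x) simp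
    also have "\<dots> = (\<integral>y. m * (\<beta> * (indicator C y * g y) - indicator C y * f y) \<partial>\<rho>)"
      using integrable_C[OF f(1)] integrable_C[OF g(1)] by (simp add: If_def Ig_def)
    also have "\<dots> \<le> (\<integral>y. \<beta> * (indicator C y * (q (x, y) * g y)) - indicator C y * (q (x, y) * f y) \<partial>\<rho>)"
    proof (intro integral_mono integrable_mult_right Bochner_Integration.integrable_diff integrable_C continuous_section f g)
      fix y show "m * (\<beta> * (indicator C y * g y) - indicator C y * f y) \<le> \<beta> * (indicator C y * (q (x, y) * g y)) - indicator C y * (q (x, y) * f y)"
        using mult_right_mono[OF m(3)[OF x], of y "\<beta> * g y - f y"] \<alpha>(3)[of y] by (auto simp: indicator_def algebra_simps \<beta>_def)
    qed
    also have "\<dots> = \<beta> * G x - F x" using iq[OF f(1), of x] iq[OF g(1), of x] by (simp add: F_def G_def)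
    finally show ?thesis using Ig by (simp add: \<beta>1_def \<kappa>_def field_simps)
  qed
  have \<alpha>1: "\<alpha> \<le> \<alpha>1" using \<kappa> \<theta> by (simp add: \<alpha>1_def)
  have "\<beta>1 = \<alpha>1 + (1 - \<theta>) * c * \<alpha>" by (simp add: \<beta>1_def \<alpha>1_def \<beta>_def algebra_simps)
  also have "\<dots> \<le> \<alpha>1 * (1 + (1 - \<theta>) * c)"
    using mult_left_mono[OF \<alpha>1 mult_nonneg_nonneg[of "1 - \<theta>" c]] \<theta> c by (simp add: algebra_simps)
  finally have \<beta>1: "\<beta>1 \<le> \<alpha>1 * (1 + (1 - \<theta>) * c)" .
  have \<alpha>\<beta>: "0 < \<alpha>1" "0 < \<beta>1"
  proof -
    show "0 < \<alpha>1" using \<alpha>1 \<alpha>(1) by simp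
    obtain x where "x \<in> C" using C_nonempty by blast
    then show "0 < \<beta>1" using upF[of x] FG[of x] by (metis less_le_trans zero_less_mult_pos2)
  qed
  show ?thesis
    unfolding ratio_close_def
  proof (intro exI[of _ "1 / \<beta>1"] conjI ballI)
    fix x assume x: "x \<in> C"
    show "1 / \<beta>1 * sinkhorn_half C q \<rho> g x \<le> sinkhorn_half C q \<rho> f x"
      unfolding sinkhorn_half_def F_def[symmetric] G_def[symmetric]
      using upF[OF x] FG[of x] \<alpha>\<beta> by (simp add: field_simps)
    have "1 / F x \<le> 1 / (\<alpha>1 * G x)" using lowF[OF x] FG[of x] \<alpha>\<beta> by (intro divide_left_mono) auto
    also have "1 / \<alpha>1 \<le> 1 / \<beta>1 * (1 + (1 - \<theta>) * c)" using \<beta>1 \<alpha>\<beta> by (simp add: field_simps)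
    then have "1 / (\<alpha>1 * G x) \<le> 1 / \<beta>1 * (1 + (1 - \<theta>) * c) * (1 / G x)"
      using mult_right_mono[of "1 / \<alpha>1" "1 / \<beta>1 * (1 + (1 - \<theta>) * c)" "1 / G x"] FG[of x] by simp
    finally show "sinkhorn_half C q \<rho> f x \<le> 1 / \<beta>1 * (1 + (1 - m / M) * c) * sinkhorn_half C q \<rho> g x"
      unfolding sinkhorn_half_def F_def[symmetric] G_def[symmetric] \<theta>_def .
  qed (use \<alpha>\<beta> in simp)
qed

lemma ratio_close_exists:
  assumes f: "continuous_on UNIV f" "\<And>y. 0 < f y" and g: "continuous_on UNIV g" "\<And>y. 0 < g y"
  obtains c where "0 \<le> c" "ratio_close C c f g"
proof -
  obtain l u where l: "0 < l" "0 < u" "\<And>y. y \<in> C \<Longrightarrow> l \<le> f y" "\<And>y. y \<in> C \<Longrightarrow> f y \<le> u"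
    by (rule positive_bounds[OF f]) blast
  obtain l' u' where l': "0 < l'" "0 < u'" "\<And>y. y \<in> C \<Longrightarrow> l' \<le> g y" "\<And>y. y \<in> C \<Longrightarrow> g y \<le> u'"
    by (rule positive_bounds[OF g]) blast
  define c where "c = (u * u') / (l * l')"
  show thesis
  proof (rule that[of c])
    show c0: "0 \<le> c" using l l' by (simp add: c_def)
    show "ratio_close C c f g"
      unfolding ratio_close_def
    proof (intro exI[of _ "l / u'"] conjI ballI)
      fix x assume x: "x \<in> C"
      have "l / u' * g x \<le> l / u' * u'" using l l' x by (intro mult_left_mono) auto
      also have "\<dots> \<le> f x" using l l' x by simp
      finally show "l / u' * g x \<le> f x" .
      have "f x \<le> u" using l x by simp
      also have "\<dots> = l / u' * c * l'" using l l' by (simp add: c_def)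
      also have "\<dots> \<le> l / u' * (1 + c) * g x"
        using l l' x c0 by (intro mult_mono) (auto intro!: divide_right_mono mult_left_mono)
      finally show "f x \<le> l / u' * (1 + c) * g x" .
    qed (use l l' in simp)
  qed
qed

end

primrec sinkhorn_b ::
  "'a set \<Rightarrow> ('a \<times> 'a \<Rightarrow> real) \<Rightarrow> 'a measure \<Rightarrow> 'a measure \<Rightarrow> nat \<Rightarrow> 'a \<Rightarrow> real" where
  "sinkhorn_b C q \<mu>1 \<mu>2 0 = (\<lambda>_. 1)"
| "sinkhorn_b C q \<mu>1 \<mu>2 (Suc n) =
    sinkhorn_half C (\<lambda>(x, y). q (y, x)) \<mu>1 (sinkhorn_half C q \<mu>2 (sinkhorn_b C q \<mu>1 \<mu>2 n))"

definition sinkhorn_a ::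
  "'a set \<Rightarrow> ('a \<times> 'a \<Rightarrow> real) \<Rightarrow> 'a measure \<Rightarrow> 'a measure \<Rightarrow> nat \<Rightarrow> 'a \<Rightarrow> real" where
  "sinkhorn_a C q \<mu>1 \<mu>2 n = sinkhorn_half C q \<mu>2 (sinkhorn_b C q \<mu>1 \<mu>2 n)"

definition sinkhorn_error ::
  "'a set \<Rightarrow> ('a \<times> 'a \<Rightarrow> real) \<Rightarrow> 'a measure \<Rightarrow> 'a measure \<Rightarrow> nat \<Rightarrow> real" where
  "sinkhorn_error C q \<mu>1 \<mu>2 n = (\<integral>y. indicator C y *
     \<bar>sinkhorn_b C q \<mu>1 \<mu>2 n y / sinkhorn_b C q \<mu>1 \<mu>2 (Suc n) y - measure \<mu>1 C / measure \<mu>2 C\<bar> \<partial>\<mu>2)"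

context schroedinger_problem
begin

context
  fixes j :: nat
  assumes charged: "0 < measure \<mu>1 (K j)" "0 < measure \<mu>2 (K j)"
begin

interpretation k1: compact_kernel "K j" q \<mu>2
  by (intro compact_kernel.intro compact_K continuous_q q_pos M2.prob_space_axioms sets_\<mu>2 charged)

interpretation k2: compact_kernel "K j" "\<lambda>(x, y). q (y, x)" \<mu>1
proof -
  interpret S: schroedinger_problem K "\<lambda>(x, y). q (y, x)" \<mu>2 \<mu>1 by (rule swap)
  show "compact_kernel (K j) (\<lambda>(x, y). q (y, x)) \<mu>1"
    by (intro compact_kernel.intro compact_K S.continuous_q S.q_pos M1.prob_space_axioms sets_\<mu>1 charged)
qed

abbreviation "sa \<equiv> sinkhorn_a (K j) q \<mu>1 \<mu>2"
abbreviation "sb \<equiv> sinkhorn_b (K j) q \<mu>1 \<mu>2"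

lemma sinkhorn_b_regular: "continuous_on UNIV (sb n) \<and> (\<forall>y. 0 < sb n y)"
proof (induction n)
  case (Suc n)
  then have sb: "continuous_on UNIV (sb n)" "\<And>y. 0 < sb n y" by auto
  note half = k1.continuous_sinkhorn_half[OF sb] k1.sinkhorn_half_pos[OF sb]
  show ?case
    unfolding sinkhorn_b.simps
    by (intro conjI allI k2.continuous_sinkhorn_half k2.sinkhorn_half_pos half)
qed simp

lemma sinkhorn_a_regular: "continuous_on UNIV (sa n) \<and> (\<forall>y. 0 < sa n y)"
  unfolding sinkhorn_a_def using sinkhorn_b_regular[of n]
  by (intro conjI allI k1.continuous_sinkhorn_half k1.sinkhorn_half_pos) auto

lemma sinkhorn_measurable [measurable]: "sa n \<in> borel_measurable borel" "sb n \<in> borel_measurable borel"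
  using sinkhorn_a_regular sinkhorn_b_regular by (auto intro: borel_measurable_continuous_onI)

lemma sinkhorn_marginal1:
  "(\<integral>y. q (x, y) * ((ind j x * sa n x) * (ind j y * sb n y)) \<partial>\<mu>2) = ind j x"
proof -
  have "(\<integral>y. q (x, y) * ((ind j x * sa n x) * (ind j y * sb n y)) \<partial>\<mu>2) =
      (\<integral>y. (ind j x * sa n x) * (ind j y * (q (x, y) * sb n y)) \<partial>\<mu>2)"
    by (rule Bochner_Integration.integral_cong) auto
  also have "\<dots> = ind j x * (sa n x * (\<integral>y. ind j y * (q (x, y) * sb n y) \<partial>\<mu>2))" by simp
  also have "sa n x * (\<integral>y. ind j y * (q (x, y) * sb n y) \<partial>\<mu>2) = 1"
    using k1.denominator_pos[of "sb n" x] sinkhorn_b_regular[of n] by (simp add: sinkhorn_a_def sinkhorn_half_def)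
  finally show ?thesis by simp
qed

lemma sinkhorn_marginal2:
  "(\<integral>x. q (x, y) * ((ind j x * sa n x) * (ind j y * sb n y)) \<partial>\<mu>1) = ind j y * (sb n y / sb (Suc n) y)"
proof -
  have "(\<integral>x. q (x, y) * ((ind j x * sa n x) * (ind j y * sb n y)) \<partial>\<mu>1) =
      (\<integral>x. (ind j y * sb n y) * (ind j x * (q (x, y) * sa n x)) \<partial>\<mu>1)"
    by (rule Bochner_Integration.integral_cong) auto
  also have "\<dots> = ind j y * (sb n y * (\<integral>x. ind j x * (q (x, y) * sa n x) \<partial>\<mu>1))" by simp
  also have "sb n y * (\<integral>x. ind j x * (q (x, y) * sa n x) \<partial>\<mu>1) = sb n y / sb (Suc n) y"
    by (simp add: sinkhorn_a_def sinkhorn_half_def)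
  finally show ?thesis .
qed

lemma integrable_sa: "integrable \<mu>1 (\<lambda>x. ind j x * sa n x)"
  using k2.integrable_C sinkhorn_a_regular by blast

lemma integrable_sb: "integrable \<mu>2 (\<lambda>x. ind j x * sb n x)"
  using k1.integrable_C sinkhorn_b_regular by blast

lemma sinkhorn_admissible: "admissible (\<lambda>x. ind j x * sa n x) (\<lambda>x. ind j x * sb n x)"
proof -
  obtain m M where M: "0 < m" "m \<le> M" "\<And>x y. x \<in> K j \<Longrightarrow> y \<in> K j \<Longrightarrow> m \<le> q (x, y) \<and> q (x, y) \<le> M"
    using q_bounds[of j] by metis
  have pos: "0 < sa n x" "0 < sb n x" for x using sinkhorn_a_regular sinkhorn_b_regular by auto
  have "integrable \<pi> (\<lambda>(x, y). q (x, y) * ((ind j x * sa n x) * (ind j y * sb n y)))"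
  proof (rule Bochner_Integration.integrable_bound[where f="\<lambda>z. M * (case z of (x, y) \<Rightarrow> (ind j x * sa n x) * (ind j y * sb n y))"])
    show "integrable \<pi> (\<lambda>z. M * (case z of (x, y) \<Rightarrow> (ind j x * sa n x) * (ind j y * sb n y)))"
      by (rule integrable_mult_right[OF product_integral(1)[OF integrable_sa integrable_sb]])
    show "AE z in \<pi>. norm (case z of (x, y) \<Rightarrow> q (x, y) * ((ind j x * sa n x) * (ind j y * sb n y)))
        \<le> norm (M * (case z of (x, y) \<Rightarrow> (ind j x * sa n x) * (ind j y * sb n y)))"
    proof (rule AE_I2)
      fix z :: "'a \<times> 'a"
      obtain x y where z: "z = (x, y)" by force
      show "norm (case z of (x, y) \<Rightarrow> q (x, y) * ((ind j x * sa n x) * (ind j y * sb n y)))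
        \<le> norm (M * (case z of (x, y) \<Rightarrow> (ind j x * sa n x) * (ind j y * sb n y)))"
      proof (cases "x \<in> K j \<and> y \<in> K j")
        case True
        then have "\<bar>q (x, y)\<bar> \<le> \<bar>M\<bar>" using M(3)[of x y] q_pos[of "(x, y)"] by auto
        then have "\<bar>q (x, y)\<bar> * \<bar>sa n x * sb n y\<bar> \<le> \<bar>M\<bar> * \<bar>sa n x * sb n y\<bar>" by (rule mult_right_mono) simp
        then show ?thesis using True by (simp add: z abs_mult)
      next
        case False
        then have "ind j x = (0::real) \<or> ind j y = (0::real)" by auto
        then show ?thesis unfolding z prod.case by (elim disjE) simp_all
      qed
    qed
  qed measurable
  then show ?thesis using pos by (simp add: admissible_def less_imp_le)
qed

lemma sinkhorn_defect1: "defect1 (\<lambda>x. ind j x * sa n x) (\<lambda>x. ind j x * sb n x) = measure \<mu>1 (- K j)"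
proof -
  have "\<bar>ind j x - 1\<bar> = (indicator (- K j) x :: real)" for x by (simp add: indicator_def)
  then show ?thesis unfolding marginal_defect_def sinkhorn_marginal1 by simp
qed

lemma continuous_ratio: "continuous_on UNIV (\<lambda>y. sb n y / sb (Suc n) y)"
proof (rule continuous_on_divide)
  show "\<forall>y\<in>UNIV. sb (Suc n) y \<noteq> 0" using sinkhorn_b_regular[of "Suc n"] by (metis less_irrefl)
qed (use sinkhorn_b_regular in blast)+

lemma integrable_ratio: "integrable \<mu>2 (\<lambda>y. ind j y * (sb n y / sb (Suc n) y))"
  by (rule k1.integrable_C[OF continuous_ratio])

lemma sinkhorn_defect2: "defect2 (\<lambda>x. ind j x * sa n x) (\<lambda>x. ind j x * sb n x) \<le>
    sinkhorn_error (K j) q \<mu>1 \<mu>2 n + \<bar>measure \<mu>1 (K j) - measure \<mu>2 (K j)\<bar> + measure \<mu>2 (- K j)"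
proof -
  define c where "c = measure \<mu>1 (K j) / measure \<mu>2 (K j)"
  define r where "r y = sb n y / sb (Suc n) y" for y
  have r: "continuous_on UNIV r"
    unfolding r_def by (rule continuous_ratio)
  have i1: "integrable \<mu>2 (\<lambda>y. ind j y * \<bar>r y - c\<bar>)"
    by (intro k1.integrable_C continuous_intros r)
  have i2: "integrable \<mu>2 (\<lambda>y. ind j y * \<bar>c - 1\<bar>)" and i3: "integrable \<mu>2 (indicat_real (- K j))"
    by (auto simp: M2.emeasure_eq_measure)
  have "defect2 (\<lambda>x. ind j x * sa n x) (\<lambda>x. ind j x * sb n x) = (\<integral>y. \<bar>ind j y * r y - 1\<bar> \<partial>\<mu>2)"
    unfolding defect2_eq sinkhorn_marginal2 r_def ..
  also have "\<dots> \<le> (\<integral>y. ind j y * \<bar>r y - c\<bar> + ind j y * \<bar>c - 1\<bar> + indicator (- K j) y \<partial>\<mu>2)"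
  proof (rule integral_mono)
    show "integrable \<mu>2 (\<lambda>y. \<bar>ind j y * r y - 1\<bar>)"
      by (intro integrable_abs Bochner_Integration.integrable_diff k1.integrable_C r) auto
    show "integrable \<mu>2 (\<lambda>y. ind j y * \<bar>r y - c\<bar> + ind j y * \<bar>c - 1\<bar> + indicator (- K j) y)"
      by (intro Bochner_Integration.integrable_add i1 i2 i3)
  qed (auto simp: indicator_def)
  also have "\<dots> = (\<integral>y. ind j y * \<bar>r y - c\<bar> \<partial>\<mu>2) + measure \<mu>2 (K j) * \<bar>c - 1\<bar> + measure \<mu>2 (- K j)"
    using i1 i2 i3 by simp
  also have "measure \<mu>2 (K j) * \<bar>c - 1\<bar> = \<bar>measure \<mu>2 (K j) * (c - 1)\<bar>"
    by (simp add: abs_mult)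
  also have "measure \<mu>2 (K j) * (c - 1) = measure \<mu>1 (K j) - measure \<mu>2 (K j)"
    using charged(2) by (simp add: c_def field_simps)
  finally show ?thesis by (simp add: sinkhorn_error_def r_def c_def del: sinkhorn_b.simps)
qed

lemma sinkhorn_ratio_integral: "(\<integral>y. ind j y * (sb n y / sb (Suc n) y) \<partial>\<mu>2) = measure \<mu>1 (K j)"
proof -
  let ?H = "\<lambda>(x, y). q (x, y) * ((ind j x * sa n x) * (ind j y * sb n y))"
  have i: "integrable \<pi> ?H" using sinkhorn_admissible by (simp add: admissible_def)
  have "(\<integral>y. ind j y * (sb n y / sb (Suc n) y) \<partial>\<mu>2) = (\<integral>z. ?H z \<partial>\<pi>)"
    unfolding sinkhorn_marginal2[symmetric] by (rule integral_snd[OF i])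
  also have "\<dots> = (\<integral>x. ind j x \<partial>\<mu>1)"
    using integral_fst'[OF i] by (simp add: sinkhorn_marginal1)
  finally show ?thesis by simp
qed

lemma sinkhorn_error_small:
  assumes e: "0 < e"
  shows "\<exists>n. sinkhorn_error (K j) q \<mu>1 \<mu>2 n < e"
proof -
  obtain m M where m: "0 < m" "m \<le> M" "\<And>x y. x \<in> K j \<Longrightarrow> y \<in> K j \<Longrightarrow> m \<le> q (x, y)" "\<And>x y. x \<in> K j \<Longrightarrow> y \<in> K j \<Longrightarrow> q (x, y) \<le> M"
    using k1.kernel_bounds by metis
  define t where "t = 1 - m / M"
  have t: "0 \<le> t" "t < 1" using m by (auto simp: t_def)
  have reg: "continuous_on UNIV (sb n)" "0 < sb n y" "continuous_on UNIV (sa n)" "0 < sa n y" for n y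
    using sinkhorn_b_regular[of n] sinkhorn_a_regular[of n] by blast+
  obtain c where c: "0 \<le> c" "ratio_close (K j) c (sb 0) (sb (Suc 0))"
    by (rule k1.ratio_close_exists[of "sb 0" "sb (Suc 0)", OF reg(1)[of 0] reg(2)[of 0] reg(1)[of "Suc 0"] reg(2)[of "Suc 0"]])
  have m': "x \<in> K j \<Longrightarrow> y \<in> K j \<Longrightarrow> m \<le> (case (x, y) of (x, y) \<Rightarrow> q (y, x))"
    "x \<in> K j \<Longrightarrow> y \<in> K j \<Longrightarrow> (case (x, y) of (x, y) \<Rightarrow> q (y, x)) \<le> M" for x y
    unfolding prod.case by (rule m(3), assumption+, rule m(4), assumption+)
  have close: "ratio_close (K j) (t ^ (2 * n) * c) (sb n) (sb (Suc n))" for n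
  proof (induction n)
    case 0
    show ?case using c(2) by (simp only: mult_zero_right power_0 mult_1)
  next
    case (Suc n)
    have c1: "0 \<le> t ^ (2 * n) * c" using t(1) c(1) by (intro mult_nonneg_nonneg zero_le_power)
    have "ratio_close (K j) (t * (t ^ (2 * n) * c)) (sa n) (sa (Suc n))"
      unfolding t_def sinkhorn_a_def
      by (rule k1.ratio_close_contraction[where m=m and M=M, OF reg(1)[of n] reg(2)[of n] reg(1)[of "Suc n"] reg(2)[of "Suc n"]
          c1[unfolded t_def] Suc[unfolded t_def] m])
    have c2: "0 \<le> t * (t ^ (2 * n) * c)" using t(1) c1 by (rule mult_nonneg_nonneg)
    have step: "sb (Suc i) = sinkhorn_half (K j) (\<lambda>(x, y). q (y, x)) \<mu>1 (sa i)" for i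
      unfolding sinkhorn_b.simps(2) sinkhorn_a_def ..
    have "ratio_close (K j) (t * (t * (t ^ (2 * n) * c))) (sb (Suc n)) (sb (Suc (Suc n)))"
      unfolding t_def step
      by (rule k2.ratio_close_contraction[where m=m and M=M, OF reg(3)[of n] reg(4)[of n] reg(3)[of "Suc n"] reg(4)[of "Suc n"]
          c2[unfolded t_def] \<open>ratio_close (K j) (t * (t ^ (2 * n) * c)) (sa n) (sa (Suc n))\<close>[unfolded t_def] m(1,2) m'])
    moreover have "t * (t * (t ^ (2 * n) * c)) = t ^ (2 * Suc n) * c" by simp
    ultimately show ?case by (simp only:)
  qed
  have bound: "sinkhorn_error (K j) q \<mu>1 \<mu>2 n \<le> measure \<mu>1 (K j) * (t ^ (2 * n) * c)" for n
  proof -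
    define d where "d = t ^ (2 * n) * c"
    have d0: "0 \<le> d" using t c by (simp add: d_def)
    define r where "r y = sb n y / sb (Suc n) y" for y
    obtain \<alpha> where \<alpha>: "0 < \<alpha>" "\<And>y. y \<in> K j \<Longrightarrow> \<alpha> * sb (Suc n) y \<le> sb n y" "\<And>y. y \<in> K j \<Longrightarrow> sb n y \<le> \<alpha> * (1 + d) * sb (Suc n) y"
      using close[of n] unfolding ratio_close_def d_def[symmetric] by blast
    have r: "\<alpha> \<le> r y" "r y \<le> \<alpha> * (1 + d)" if "y \<in> K j" for y
    proof -
      have p: "0 < sb (Suc n) y" using sinkhorn_b_regular[of "Suc n"] by blast
      show "\<alpha> \<le> r y" "r y \<le> \<alpha> * (1 + d)"
        using \<alpha>(2,3)[OF that] unfolding r_def pos_le_divide_eq[OF p] pos_divide_le_eq[OF p] by simp_all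
    qed
    have ir: "integrable \<mu>2 (\<lambda>y. ind j y * r y)" "(\<integral>y. ind j y * r y \<partial>\<mu>2) = measure \<mu>1 (K j)"
      unfolding r_def by (rule integrable_ratio, rule sinkhorn_ratio_integral)
    have ic: "integrable \<mu>2 (\<lambda>y. ind j y * s)" "(\<integral>y. ind j y * s \<partial>\<mu>2) = measure \<mu>2 (K j) * s" for s :: real
      by (auto simp: M2.emeasure_eq_measure)
    have l: "measure \<mu>2 (K j) * \<alpha> \<le> measure \<mu>1 (K j)"
    proof -
      have "ind j y * \<alpha> \<le> ind j y * r y" for y
        using r(1)[of y] by (simp add: indicator_def)
      from integral_mono[OF ic(1) ir(1) this] show ?thesis by (simp only: ir(2) ic(2))
    qed
    have u: "measure \<mu>1 (K j) \<le> measure \<mu>2 (K j) * (\<alpha> * (1 + d))"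
    proof -
      have "ind j y * r y \<le> ind j y * (\<alpha> * (1 + d))" for y
        using r(2)[of y] by (simp add: indicator_def)
      from integral_mono[OF ir(1) ic(1) this] show ?thesis by (simp only: ir(2) ic(2))
    qed
    define s where "s = measure \<mu>1 (K j) / measure \<mu>2 (K j)"
    have s: "\<alpha> \<le> s" "s \<le> \<alpha> * (1 + d)"
      unfolding s_def pos_le_divide_eq[OF charged(2)] pos_divide_le_eq[OF charged(2)]
      using l u by (simp_all only: mult.commute)
    have "sinkhorn_error (K j) q \<mu>1 \<mu>2 n = (\<integral>y. ind j y * \<bar>r y - s\<bar> \<partial>\<mu>2)"
      by (simp add: sinkhorn_error_def r_def s_def del: sinkhorn_b.simps)
    also have "\<dots> \<le> (\<integral>y. ind j y * (\<alpha> * d) \<partial>\<mu>2)"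
    proof (rule integral_mono[OF _ ic(1)])
      have "integrable \<mu>2 (\<lambda>y. \<bar>ind j y * r y - ind j y * s\<bar>)"
        by (intro integrable_abs Bochner_Integration.integrable_diff ir ic)
      moreover have "\<bar>ind j y * r y - ind j y * s\<bar> = ind j y * \<bar>r y - s\<bar>" for y
        by (simp add: indicator_def)
      ultimately show "integrable \<mu>2 (\<lambda>y. ind j y * \<bar>r y - s\<bar>)" by simp
      fix y
      show "ind j y * \<bar>r y - s\<bar> \<le> ind j y * (\<alpha> * d)"
      proof (cases "y \<in> K j")
        case True
        have "\<bar>r y - s\<bar> \<le> \<alpha> * (1 + d) - \<alpha>" using r[OF True] s by linarith
        then show ?thesis using True by (simp add: algebra_simps)
      qed simp
    qed
    also have "\<dots> = (measure \<mu>2 (K j) * \<alpha>) * d" by (simp add: ic(2))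
    also have "\<dots> \<le> measure \<mu>1 (K j) * d" by (rule mult_right_mono[OF l d0])
    finally show ?thesis by (simp add: d_def)
  qed
  have "(\<lambda>n. measure \<mu>1 (K j) * ((t\<^sup>2) ^ n * c)) \<longlonglongrightarrow> measure \<mu>1 (K j) * (0 * c)"
    using t by (intro tendsto_intros LIMSEQ_power_zero) (simp add: abs_square_less_1)
  then have "\<forall>\<^sub>F n in sequentially. measure \<mu>1 (K j) * ((t\<^sup>2) ^ n * c) < e"
    by (rule order_tendstoD(2)) (use e in simp)
  then obtain n where n: "measure \<mu>1 (K j) * ((t\<^sup>2) ^ n * c) < e"
    using eventually_happens'[OF sequentially_bot] by blast
  have "sinkhorn_error (K j) q \<mu>1 \<mu>2 n < e"
    using le_less_trans[OF bound[of n, unfolded power_mult] n] .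
  then show ?thesis by blast
qed

end

end

section \<open>Continuous dependence on the data\<close>

lemma space_borel_of: "space (borel_of X) = topspace X"
  unfolding borel_of_def by (rule space_measure_of) (auto dest: openin_subset)

lemma sets_borel_of_openin: "openin X U \<Longrightarrow> U \<in> sets (borel_of X)"
  unfolding borel_of_def by (subst sets_measure_of) (auto dest: openin_subset)

lemma borel_of_continuous_map:
  assumes "continuous_map X euclidean f"
  shows "f \<in> borel_of X \<rightarrow>\<^sub>M borel"
proof (rule borel_measurableI)
  fix S :: "'b set" assume "open S"
  then have "openin X {x \<in> topspace X. f x \<in> S}"
    using assms by (simp add: continuous_map_def)
  moreover have "f -` S \<inter> space (borel_of X) = {x \<in> topspace X. f x \<in> S}"
    by (auto simp: space_borel_of)
  ultimately show "f -` S \<inter> space (borel_of X) \<in> sets (borel_of X)"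
    by (simp add: sets_borel_of_openin)
qed

lemma continuous_map_nhdsinI:
  fixes f :: "'x \<Rightarrow> 'y::topological_space"
  assumes "\<And>z. z \<in> topspace X \<Longrightarrow> (f \<longlongrightarrow> f z) (nhdsin X z)"
  shows "continuous_map X euclidean f"
  unfolding continuous_map_def
proof (intro conjI allI impI)
  fix U :: "'y set" assume "openin euclidean U"
  then have U: "open U" by simp
  show "openin X {x \<in> topspace X. f x \<in> U}"
  proof (subst openin_subopen, intro ballI)
    fix z assume z: "z \<in> {x \<in> topspace X. f x \<in> U}"
    then have "\<forall>\<^sub>F w in nhdsin X z. f w \<in> U"
      using assms U by (intro topological_tendstoD) auto
    then obtain V where "openin X V" "z \<in> V" "\<forall>w\<in>V. f w \<in> U"
      using z by (auto simp: eventually_nhdsin)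
    then show "\<exists>T. openin X T \<and> z \<in> T \<and> T \<subseteq> {x \<in> topspace X. f x \<in> U}"
      using openin_subset by (intro exI[of _ V]) blast
  qed
qed auto

lemma eventually_nhdsin_topspace: "\<forall>\<^sub>F w in nhdsin X z. w \<in> topspace X"
  unfolding eventually_nhdsin by (auto intro!: exI[of _ "topspace X"])

text \<open>
  On a closed set the indicator is a limit of continuous functions with values in \<open>[0, 1]\<close>, so
  the strong distance also controls integrals over closed sets.
\<close>

lemma strong_dist_closed:
  fixes g :: "'a::metric_space \<Rightarrow> real"
  assumes \<mu>: "\<mu> \<in> prob_measures" "\<mu>' \<in> prob_measures" and C: "closed C"
    and g: "continuous_on UNIV g" and B: "0 < B" "\<And>x. x \<in> C \<Longrightarrow> \<bar>g x\<bar> \<le> B"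
  shows "\<bar>(\<integral>x. indicator C x * g x \<partial>\<mu>) - (\<integral>x. indicator C x * g x \<partial>\<mu>')\<bar> \<le> B * strong_dist \<mu> \<mu>'"
proof (cases "C = {}")
  case True
  then show ?thesis
    using B(1) Metric_space.nonneg[OF Metric_space_strong_dist, of \<mu> \<mu>'] by simp
next
  case False
  define t where "t n x = max 0 (1 - real n * infdist x C)" for n x
  define h where "h x = max (- B) (min B (g x))" for x
  have h: "continuous_on UNIV h" "\<And>x. \<bar>h x\<bar> \<le> B"
    unfolding h_def using B(1) by (auto intro!: continuous_intros g)
  have t: "continuous_on UNIV (t n)" "0 \<le> t n x" "t n x \<le> 1" for n x
    unfolding t_def by (auto intro!: continuous_intros simp: infdist_nonneg)
  have tlim: "(\<lambda>n. t n x) \<longlonglongrightarrow> indicator C x" for x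
  proof (cases "x \<in> C")
    case True then show ?thesis by (simp add: t_def)
  next
    case x: False
    then have pos: "infdist x C > 0"
      using C False by (metis in_closed_iff_infdist_zero infdist_nonneg less_eq_real_def)
    obtain N where N: "1 / infdist x C < real N" using reals_Archimedean2 by blast
    have "t n x = 0" if "n \<ge> N" for n
    proof -
      have "1 / infdist x C \<le> real n" using N that by linarith
      then show ?thesis using pos by (simp add: field_simps t_def)
    qed
    then have "\<forall>\<^sub>F n in sequentially. t n x = 0"
      by (auto simp: eventually_sequentially)
    then show ?thesis using x by (simp add: tendsto_eventually)
  qed
  have lim: "(\<lambda>n. \<integral>x. t n x * h x \<partial>\<rho>) \<longlonglongrightarrow> (\<integral>x. indicator C x * g x \<partial>\<rho>)" if \<rho>: "\<rho> \<in> prob_measures" for \<rho>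
  proof -
    interpret prob_space \<rho> using \<rho> by (simp add: prob_measures_def)
    have s[measurable_cong]: "sets \<rho> = sets borel" using \<rho> by (simp add: prob_measures_def)
    have [measurable]: "C \<in> sets \<rho>" using C s by simp
    have [measurable]: "h \<in> borel_measurable borel" "t n \<in> borel_measurable borel" for n
      by (auto intro!: borel_measurable_continuous_onI h t)
    have "(\<lambda>n. \<integral>x. t n x * h x \<partial>\<rho>) \<longlonglongrightarrow> (\<integral>x. indicator C x * h x \<partial>\<rho>)"
    proof (rule integral_dominated_convergence[where w="\<lambda>_. B"])
      show "AE x in \<rho>. (\<lambda>n. t n x * h x) \<longlonglongrightarrow> indicator C x * h x"
        by (intro AE_I2 tendsto_mult tlim tendsto_const)
      show "AE x in \<rho>. norm (t n x * h x) \<le> B" for n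
      proof (rule AE_I2)
        fix x
        have "\<bar>t n x\<bar> * \<bar>h x\<bar> \<le> 1 * B" using t(2)[of n x] t(3)[of n x] h(2)[of x] by (intro mult_mono) auto
        then show "norm (t n x * h x) \<le> B" by (simp add: abs_mult)
      qed
    qed auto
    moreover have "indicator C x * h x = indicator C x * g x" for x
      using B(2)[of x] by (cases "x \<in> C") (simp_all add: h_def)
    ultimately show ?thesis by simp
  qed
  have le: "(\<integral>x. t n x * h x \<partial>\<mu>) - (\<integral>x. t n x * h x \<partial>\<mu>') \<le> B * strong_dist \<mu> \<mu>'"
    if s: "\<mu> \<in> prob_measures" "\<mu>' \<in> prob_measures" for n \<mu> \<mu>'
  proof -
    have "(\<integral>x. t n x * h x / B \<partial>\<mu>) - (\<integral>x. t n x * h x / B \<partial>\<mu>') \<le> strong_dist \<mu> \<mu>'"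
    proof (rule strong_dist_upper[OF s])
      show "continuous_on UNIV (\<lambda>x. t n x * h x / B)" using B(1) by (intro continuous_intros t h) auto
      show "\<forall>x. \<bar>t n x * h x / B\<bar> \<le> 1"
      proof
        fix x
        have "\<bar>t n x\<bar> * \<bar>h x\<bar> \<le> 1 * B" using t(2)[of n x] t(3)[of n x] h(2)[of x] by (intro mult_mono) auto
        then show "\<bar>t n x * h x / B\<bar> \<le> 1" using B(1) by (simp add: abs_mult)
      qed
    qed
    then have "((\<integral>x. t n x * h x \<partial>\<mu>) - (\<integral>x. t n x * h x \<partial>\<mu>')) / B \<le> strong_dist \<mu> \<mu>'"
      by (simp add: diff_divide_distrib)
    then show ?thesis using B(1) by (simp add: pos_divide_le_eq mult.commute)
  qed
  have sym: "strong_dist \<mu>' \<mu> = strong_dist \<mu> \<mu>'"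
    by (rule Metric_space.commute[OF Metric_space_strong_dist])
  show ?thesis
  proof (rule tendsto_upperbound[OF _ _ sequentially_bot])
    show "(\<lambda>n. \<bar>(\<integral>x. t n x * h x \<partial>\<mu>) - (\<integral>x. t n x * h x \<partial>\<mu>')\<bar>) \<longlonglongrightarrow>
        \<bar>(\<integral>x. indicator C x * g x \<partial>\<mu>) - (\<integral>x. indicator C x * g x \<partial>\<mu>')\<bar>"
      by (intro tendsto_intros lim \<mu>)
    show "\<forall>\<^sub>F n in sequentially. \<bar>(\<integral>x. t n x * h x \<partial>\<mu>) - (\<integral>x. t n x * h x \<partial>\<mu>')\<bar> \<le> B * strong_dist \<mu> \<mu>'"
    proof (rule always_eventually, rule allI)
      fix n show "\<bar>(\<integral>x. t n x * h x \<partial>\<mu>) - (\<integral>x. t n x * h x \<partial>\<mu>')\<bar> \<le> B * strong_dist \<mu> \<mu>'"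
        using le[OF \<mu>, of n] le[OF \<mu>(2,1), of n] unfolding sym by (simp add: abs_le_iff)
    qed
  qed
qed

lemma uniform_limit_integral:
  fixes G :: "'x \<Rightarrow> 't \<Rightarrow> 'a::metric_space \<Rightarrow> real" and \<rho> :: "'x \<Rightarrow> 'a measure"
  assumes z: "z \<in> topspace X" and \<rho>: "\<And>w. w \<in> topspace X \<Longrightarrow> \<rho> w \<in> prob_measures"
    and lim\<rho>: "((\<lambda>w. strong_dist (\<rho> w) (\<rho> z)) \<longlongrightarrow> 0) (nhdsin X z)"
    and C: "compact C"
    and G: "\<And>w t. w \<in> topspace X \<Longrightarrow> t \<in> T \<Longrightarrow> continuous_on UNIV (G w t)"
    and limG: "uniform_limit (T \<times> C) (\<lambda>w (t, y). G w t y) (\<lambda>(t, y). G z t y) (nhdsin X z)"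
    and bdd: "bounded ((\<lambda>(t, y). G z t y) ` (T \<times> C))"
  shows "uniform_limit T (\<lambda>w t. \<integral>y. indicator C y * G w t y \<partial>\<rho> w) (\<lambda>t. \<integral>y. indicator C y * G z t y \<partial>\<rho> z) (nhdsin X z)"
proof (rule uniform_limitI)
  fix e :: real assume e: "0 < e"
  obtain B where B: "0 < B" "\<And>t y. t \<in> T \<Longrightarrow> y \<in> C \<Longrightarrow> \<bar>G z t y\<bar> \<le> B"
  proof -
    obtain b where "\<forall>w\<in>(\<lambda>(t, y). G z t y) ` (T \<times> C). norm w \<le> b"
      using bdd unfolding bounded_iff by blast
    then have "\<bar>G z t y\<bar> \<le> max b 1" if "t \<in> T" "y \<in> C" for t y
      using that by (force simp: le_max_iff_disj)
    then show thesis by (intro that[of "max b 1"]) auto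
  qed
  have C': "closed C" using C by (rule compact_imp_closed)
  have int: "integrable (\<rho> w) (\<lambda>y. indicator C y * g y)" if w: "w \<in> topspace X" and g: "continuous_on UNIV g" for w and g :: "'a \<Rightarrow> real"
  proof -
    interpret prob_space "\<rho> w" using \<rho>[OF w] by (simp add: prob_measures_def)
    have [measurable_cong]: "sets (\<rho> w) = sets borel" using \<rho>[OF w] by (simp add: prob_measures_def)
    have [measurable]: "C \<in> sets borel" "g \<in> borel_measurable borel"
      using C' g by (auto intro: borel_measurable_continuous_onI)
    have "bounded (g ` C)"
      by (rule compact_imp_bounded[OF compact_continuous_image[OF continuous_on_subset[OF g subset_UNIV] C]])
    then obtain b where b: "\<And>y. y \<in> C \<Longrightarrow> \<bar>g y\<bar> \<le> b" unfolding bounded_iff by force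
    show ?thesis
      by (rule integrable_const_bound[where B="\<bar>b\<bar>"]) (use b in \<open>fastforce simp: indicator_def intro!: AE_I2\<close>, measurable)
  qed
  have "\<forall>\<^sub>F w in nhdsin X z. \<forall>p\<in>T \<times> C. dist (case p of (t, y) \<Rightarrow> G w t y) (case p of (t, y) \<Rightarrow> G z t y) < e / 2"
    using uniform_limitD[OF limG, of "e / 2"] e by simp
  moreover have "\<forall>\<^sub>F w in nhdsin X z. strong_dist (\<rho> w) (\<rho> z) < e / (2 * B)"
    by (rule order_tendstoD(2)[OF lim\<rho>]) (use e B in simp)
  ultimately show "\<forall>\<^sub>F w in nhdsin X z. \<forall>t\<in>T. dist (\<integral>y. indicator C y * G w t y \<partial>\<rho> w) (\<integral>y. indicator C y * G z t y \<partial>\<rho> z) < e"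
    using eventually_nhdsin_topspace
  proof eventually_elim
    case (elim w)
    show ?case
    proof
      fix t assume t: "t \<in> T"
      interpret prob_space "\<rho> w" using \<rho>[OF elim(3)] by (simp add: prob_measures_def)
      have i: "integrable (\<rho> w) (\<lambda>y. indicator C y * G w t y)" "integrable (\<rho> w) (\<lambda>y. indicator C y * G z t y)"
        using int[OF elim(3)] G[OF elim(3) t] G[OF z t] by blast+
      have "\<bar>(\<integral>y. indicator C y * G w t y \<partial>\<rho> w) - (\<integral>y. indicator C y * G z t y \<partial>\<rho> w)\<bar> =
          \<bar>\<integral>y. indicator C y * G w t y - indicator C y * G z t y \<partial>\<rho> w\<bar>"
        by (simp only: Bochner_Integration.integral_diff[OF i])
      also have "\<dots> \<le> (\<integral>y. \<bar>indicator C y * G w t y - indicator C y * G z t y\<bar> \<partial>\<rho> w)"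
        by (rule integral_abs_bound)
      also have "\<dots> \<le> (\<integral>y. e / 2 \<partial>\<rho> w)"
      proof (rule integral_mono[OF integrable_abs[OF Bochner_Integration.integrable_diff[OF i]]])
        fix y show "\<bar>indicator C y * G w t y - indicator C y * G z t y\<bar> \<le> e / 2"
          using elim(1) t e by (cases "y \<in> C") (auto simp: dist_real_def intro: less_imp_le)
      qed simp
      also have "\<dots> = e / 2" by (simp add: prob_space)
      finally have 1: "\<bar>(\<integral>y. indicator C y * G w t y \<partial>\<rho> w) - (\<integral>y. indicator C y * G z t y \<partial>\<rho> w)\<bar> \<le> e / 2" .
      have "\<bar>(\<integral>y. indicator C y * G z t y \<partial>\<rho> w) - (\<integral>y. indicator C y * G z t y \<partial>\<rho> z)\<bar> \<le> B * strong_dist (\<rho> w) (\<rho> z)"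
        by (rule strong_dist_closed[OF \<rho>[OF elim(3)] \<rho>[OF z] C' G[OF z t] B(1) B(2)[OF t]])
      also have "\<dots> < B * (e / (2 * B))"
        using elim(2) B(1) by (rule mult_strict_left_mono)
      also have "\<dots> = e / 2" using B(1) by simp
      finally show "dist (\<integral>y. indicator C y * G w t y \<partial>\<rho> w) (\<integral>y. indicator C y * G z t y \<partial>\<rho> z) < e"
        using 1 unfolding dist_real_def by linarith
    qed
  qed
qed

lemma (in schroedinger_problem) in_prob_measures: "\<mu>1 \<in> prob_measures" "\<mu>2 \<in> prob_measures"
  by (auto simp: prob_measures_def sets_\<mu>1 sets_\<mu>2 M1.prob_space_axioms M2.prob_space_axioms)

locale data_family = compact_cover K
  for K :: "nat \<Rightarrow> 'a::metric_space set" +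
  fixes X :: "'x topology" and Q :: "'x \<Rightarrow> 'a \<times> 'a \<Rightarrow> real" and m1 m2 :: "'x \<Rightarrow> 'a measure" and k :: nat
  assumes problem: "z \<in> topspace X \<Longrightarrow> schroedinger_problem K (Q z) (m1 z) (m2 z)"
    and charged1: "z \<in> topspace X \<Longrightarrow> 0 < measure (m1 z) (K k)"
    and charged2: "z \<in> topspace X \<Longrightarrow> 0 < measure (m2 z) (K k)"
    and Q_limit: "z \<in> topspace X \<Longrightarrow> uniform_limit (K n \<times> K n) Q (Q z) (nhdsin X z)"
    and m1_limit: "z \<in> topspace X \<Longrightarrow> ((\<lambda>w. strong_dist (m1 w) (m1 z)) \<longlongrightarrow> 0) (nhdsin X z)"
    and m2_limit: "z \<in> topspace X \<Longrightarrow> ((\<lambda>w. strong_dist (m2 w) (m2 z)) \<longlongrightarrow> 0) (nhdsin X z)"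
begin

lemma swap_family: "data_family K X (\<lambda>z (x, y). Q z (y, x)) m2 m1 k"
proof (intro data_family.intro data_family_axioms.intro compact_cover_axioms)
  fix z n assume z: "z \<in> topspace X"
  show "schroedinger_problem K (\<lambda>(x, y). Q z (y, x)) (m2 z) (m1 z)"
    by (rule schroedinger_problem.swap[OF problem[OF z]])
  show "uniform_limit (K n \<times> K n) (\<lambda>z (x, y). Q z (y, x)) (\<lambda>(x, y). Q z (y, x)) (nhdsin X z)"
    unfolding split_beta' by (rule uniform_limit_compose'[OF Q_limit[OF z, of n]]) auto
qed (use charged1 charged2 m1_limit m2_limit in auto)

definition depends_continuously :: "nat \<Rightarrow> ('x \<Rightarrow> 'a \<Rightarrow> real) \<Rightarrow> bool" where
  "depends_continuously j F \<longleftrightarrow>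
     (\<forall>z\<in>topspace X. continuous_on UNIV (F z) \<and> uniform_limit (K j) F (F z) (nhdsin X z))"

lemma depends_continuously_mono: "depends_continuously N F \<Longrightarrow> j \<le> N \<Longrightarrow> depends_continuously j F"
  unfolding depends_continuously_def using uniform_limit_on_subset mono_K by blast

lemma bounded_image_K: "continuous_on UNIV (g :: 'a \<Rightarrow> real) \<Longrightarrow> bounded (g ` K j)"
  by (rule compact_imp_bounded[OF compact_continuous_image[OF continuous_on_subset compact_K]]) auto

lemma depends_continuously_mult:
  "depends_continuously j F \<Longrightarrow> depends_continuously j G \<Longrightarrow> depends_continuously j (\<lambda>z y. F z y * G z y)"
  unfolding depends_continuously_def
  by (auto intro!: uniform_lim_mult continuous_intros bounded_image_K)

lemma depends_continuously_divide:
  assumes F: "depends_continuously j F" and G: "depends_continuously j G"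
    and pos: "\<And>z y. z \<in> topspace X \<Longrightarrow> 0 < G z y"
  shows "depends_continuously j (\<lambda>z y. F z y / G z y)"
  unfolding depends_continuously_def
proof (intro ballI conjI)
  fix z assume z: "z \<in> topspace X"
  have c: "continuous_on UNIV (F z)" "continuous_on UNIV (G z)"
    and l: "uniform_limit (K j) F (F z) (nhdsin X z)" "uniform_limit (K j) G (G z) (nhdsin X z)"
    using F G z by (auto simp: depends_continuously_def)
  have nz: "\<forall>y\<in>UNIV. G z y \<noteq> 0" using pos[OF z] by (metis less_irrefl)
  show "continuous_on UNIV (\<lambda>y. F z y / G z y)" by (rule continuous_on_divide[OF c nz])
  obtain b where b: "0 < b" "\<And>y. y \<in> K j \<Longrightarrow> b \<le> norm (G z y)"
  proof (cases "K j = {}")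
    case False
    have "continuous_on (K j) (G z)" using c(2) continuous_on_subset by blast
    then obtain y0 where "y0 \<in> K j" "\<forall>y\<in>K j. G z y0 \<le> G z y"
      using continuous_attains_inf[OF compact_K False] by blast
    then show thesis using that[of "G z y0"] pos[OF z] by (metis order_trans abs_ge_self real_norm_def)
  qed (use that[of 1] in auto)
  show "uniform_limit (K j) (\<lambda>z y. F z y / G z y) (\<lambda>y. F z y / G z y) (nhdsin X z)"
    by (rule uniform_lim_divide[OF l bounded_image_K[OF c(1)] b(2) b(1)])
qed

lemma depends_continuously_abs_diff:
  assumes "depends_continuously j F" "depends_continuously j G"
  shows "depends_continuously j (\<lambda>z y. \<bar>F z y - G z y\<bar>)"
  unfolding depends_continuously_def
proof (intro ballI conjI)
  fix z assume z: "z \<in> topspace X"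
  show "continuous_on UNIV (\<lambda>y. \<bar>F z y - G z y\<bar>)"
    using assms z by (auto simp: depends_continuously_def intro!: continuous_intros)
  have "uniform_limit (K j) (\<lambda>z y. F z y - G z y) (\<lambda>y. F z y - G z y) (nhdsin X z)"
    using assms z by (auto simp: depends_continuously_def intro!: uniform_limit_minus)
  then show "uniform_limit (K j) (\<lambda>z y. \<bar>F z y - G z y\<bar>) (\<lambda>y. \<bar>F z y - G z y\<bar>) (nhdsin X z)"
    unfolding uniform_limit_iff
    by (elim all_forward imp_forward) (auto simp: dist_real_def elim!: eventually_mono)
qed

lemma depends_continuously_const:
  assumes "continuous_map X euclidean c"
  shows "depends_continuously j (\<lambda>z y. c z)"
  unfolding depends_continuously_def
proof (intro ballI conjI uniform_limitI)
  fix z e assume z: "z \<in> topspace X" and e: "0 < (e::real)"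
  have "openin X {w \<in> topspace X. c w \<in> ball (c z) e}"
    using assms by (auto simp: continuous_map_def)
  then have "\<forall>\<^sub>F w in nhdsin X z. c w \<in> ball (c z) e"
    using z e by (auto simp: eventually_nhdsin intro!: exI[of _ "{w \<in> topspace X. c w \<in> ball (c z) e}"])
  then show "\<forall>\<^sub>F w in nhdsin X z. \<forall>y\<in>K j. dist (c w) (c z) < e"
    by eventually_elim (simp add: dist_commute)
qed auto

lemma prob_m2: "z \<in> topspace X \<Longrightarrow> m2 z \<in> prob_measures"
  using schroedinger_problem.in_prob_measures(2)[OF problem] .

lemma continuous_integral2:
  assumes F: "depends_continuously j F"
  shows "continuous_map X euclidean (\<lambda>z. \<integral>y. ind j y * F z y \<partial>m2 z)"
proof (rule continuous_map_nhdsinI)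
  fix z assume z: "z \<in> topspace X"
  have F': "continuous_on UNIV (F w)" "uniform_limit (K j) F (F w) (nhdsin X w)" if "w \<in> topspace X" for w
    using F that by (auto simp: depends_continuously_def)
  have "uniform_limit {()} (\<lambda>w t. \<integral>y. ind j y * F w y \<partial>m2 w) (\<lambda>t. \<integral>y. ind j y * F z y \<partial>m2 z) (nhdsin X z)"
  proof (rule uniform_limit_integral[OF z prob_m2 m2_limit[OF z] compact_K])
    show "uniform_limit ({()} \<times> K j) (\<lambda>w (t, y). F w y) (\<lambda>(t, y). F z y) (nhdsin X z)"
      unfolding split_beta' by (rule uniform_limit_compose'[OF F'(2)[OF z]]) auto
    have "(\<lambda>(t, y). F z y) ` ({()} \<times> K j) = F z ` K j" by force
    then show "bounded ((\<lambda>(t, y). F z y) ` ({()} \<times> K j))" using bounded_image_K[OF F'(1)[OF z]] by simp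
  qed (use F' in auto)
  then show "((\<lambda>w. \<integral>y. ind j y * F w y \<partial>m2 w) \<longlongrightarrow> (\<integral>y. ind j y * F z y \<partial>m2 z)) (nhdsin X z)"
    by (auto simp: uniform_limit_iff tendsto_iff)
qed

lemma compact_kernel2:
  assumes z: "z \<in> topspace X" and N: "k \<le> N"
  shows "compact_kernel (K N) (Q z) (m2 z)"
proof -
  interpret schroedinger_problem K "Q z" "m1 z" "m2 z" by (rule problem[OF z])
  have "measure (m2 z) (K k) \<le> measure (m2 z) (K N)"
    by (intro M2.finite_measure_mono mono_K N) (simp add: sets_\<mu>2)
  then show ?thesis
    using charged2[OF z]
    by (intro compact_kernel.intro compact_K continuous_q q_pos M2.prob_space_axioms sets_\<mu>2) simp
qed

lemma depends_continuously_sinkhorn_half: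
  assumes F: "depends_continuously N F" and pos: "\<And>z y. z \<in> topspace X \<Longrightarrow> 0 < F z y" and N: "k \<le> N"
  shows "depends_continuously N (\<lambda>z. sinkhorn_half (K N) (Q z) (m2 z) (F z))"
    and "z \<in> topspace X \<Longrightarrow> 0 < sinkhorn_half (K N) (Q z) (m2 z) (F z) x"
proof -
  have F': "continuous_on UNIV (F w)" "uniform_limit (K N) F (F w) (nhdsin X w)" if "w \<in> topspace X" for w
    using F that by (auto simp: depends_continuously_def)
  note kern = compact_kernel2[OF _ N]
  have one: "depends_continuously N (\<lambda>z y. 1)"
    unfolding depends_continuously_def by (auto intro!: uniform_limit_const)
  have "depends_continuously N (\<lambda>z x. \<integral>y. ind N y * (Q z (x, y) * F z y) \<partial>m2 z)"
    unfolding depends_continuously_def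
  proof (intro ballI conjI)
    fix z assume z: "z \<in> topspace X"
    interpret compact_kernel "K N" "Q z" "m2 z" by (rule kern[OF z])
    show "continuous_on UNIV (\<lambda>x. \<integral>y. ind N y * (Q z (x, y) * F z y) \<partial>m2 z)"
      by (rule continuous_denominator[OF F'(1)[OF z]])
    have bQ: "bounded (Q z ` (K N \<times> K N))"
      by (rule compact_imp_bounded[OF compact_continuous_image[OF continuous_on_subset[OF continuous_q subset_UNIV] compact_Times[OF compact_K compact_K]]])
    have bF: "bounded ((\<lambda>p. F z (snd p)) ` (K N \<times> K N))"
      by (rule bounded_subset[OF bounded_image_K[OF F'(1)[OF z], of N]]) auto
    have lF: "uniform_limit (K N \<times> K N) (\<lambda>w p. F w (snd p)) (\<lambda>p. F z (snd p)) (nhdsin X z)"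
      by (rule uniform_limit_compose'[OF F'(2)[OF z]]) auto
    have l: "uniform_limit (K N \<times> K N) (\<lambda>w p. Q w p * F w (snd p)) (\<lambda>p. Q z p * F z (snd p)) (nhdsin X z)"
      by (rule uniform_lim_mult[OF Q_limit[OF z] lF bQ bF])
    show "uniform_limit (K N) (\<lambda>z x. \<integral>y. ind N y * (Q z (x, y) * F z y) \<partial>m2 z) (\<lambda>x. \<integral>y. ind N y * (Q z (x, y) * F z y) \<partial>m2 z) (nhdsin X z)"
    proof (rule uniform_limit_integral[OF z prob_m2 m2_limit[OF z] compact_K])
      fix w x assume w: "w \<in> topspace X"
      show "continuous_on UNIV (\<lambda>y. Q w (x, y) * F w y)"
        by (rule compact_kernel.continuous_section[OF kern[OF w] F'(1)[OF w]])
    next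
      show "uniform_limit (K N \<times> K N) (\<lambda>w (x, y). Q w (x, y) * F w y) (\<lambda>(x, y). Q z (x, y) * F z y) (nhdsin X z)"
        using l by (simp add: split_beta')
      have "continuous_on UNIV (\<lambda>p. Q z p * F z (snd p))"
        by (intro continuous_intros continuous_q continuous_on_compose2[OF F'(1)[OF z]]) auto
      then have "continuous_on (K N \<times> K N) (\<lambda>p. Q z p * F z (snd p))"
        by (rule continuous_on_subset[OF _ subset_UNIV])
      then have "bounded ((\<lambda>p. Q z p * F z (snd p)) ` (K N \<times> K N))"
        by (rule compact_imp_bounded[OF compact_continuous_image]) (rule compact_Times[OF compact_K compact_K])
      then show "bounded ((\<lambda>(x, y). Q z (x, y) * F z y) ` (K N \<times> K N))" by (simp add: split_beta')
    qed
  qed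
  from depends_continuously_divide[OF one this]
  show "depends_continuously N (\<lambda>z. sinkhorn_half (K N) (Q z) (m2 z) (F z))"
    unfolding sinkhorn_half_def using compact_kernel.denominator_pos[OF kern F'(1) pos] by blast
  show "z \<in> topspace X \<Longrightarrow> 0 < sinkhorn_half (K N) (Q z) (m2 z) (F z) x"
    by (rule compact_kernel.sinkhorn_half_pos[OF kern F'(1) pos])
qed

end

context data_family
begin

interpretation S: data_family K X "\<lambda>z (x, y). Q z (y, x)" m2 m1 k
  by (rule swap_family)

lemmas continuous_integral1 = S.continuous_integral2

abbreviation "SB N n z \<equiv> sinkhorn_b (K N) (Q z) (m1 z) (m2 z) n"
abbreviation "SA N n z \<equiv> sinkhorn_a (K N) (Q z) (m1 z) (m2 z) n"

lemma SB_regular: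
  assumes N: "k \<le> N"
  shows "depends_continuously N (SB N n) \<and> (\<forall>z\<in>topspace X. \<forall>y. 0 < SB N n z y)"
proof (induction n)
  case 0
  show ?case unfolding depends_continuously_def by (auto intro!: uniform_limit_const)
next
  case (Suc n)
  then have F: "depends_continuously N (SB N n)" "\<And>z y. z \<in> topspace X \<Longrightarrow> 0 < SB N n z y" by auto
  note G = depends_continuously_sinkhorn_half[OF F N]
  note H = S.depends_continuously_sinkhorn_half[OF G N]
  show ?case unfolding sinkhorn_b.simps(2) by (intro conjI ballI allI H)
qed

lemma SA_regular:
  assumes N: "k \<le> N"
  shows "depends_continuously N (SA N n)" "z \<in> topspace X \<Longrightarrow> 0 < SA N n z x"
proof -
  have F: "depends_continuously N (SB N n)" "\<And>z y. z \<in> topspace X \<Longrightarrow> 0 < SB N n z y"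
    using SB_regular[OF N] by auto
  note G = depends_continuously_sinkhorn_half[OF F N]
  show "depends_continuously N (SA N n)" "z \<in> topspace X \<Longrightarrow> 0 < SA N n z x"
    unfolding sinkhorn_a_def by (rule G, assumption?)+
qed

lemma continuous_measure_K:
  "continuous_map X euclidean (\<lambda>z. measure (m1 z) (K j))" "continuous_map X euclidean (\<lambda>z. measure (m2 z) (K j))"
proof -
  have one: "depends_continuously j (\<lambda>z y. 1)"
    unfolding depends_continuously_def by (auto intro!: uniform_limit_const)
  have sp: "space (m1 z) = UNIV \<and> space (m2 z) = UNIV" if "z \<in> topspace X" for z
    using schroedinger_problem.space_\<mu>[OF problem[OF that]] by simp
  show "continuous_map X euclidean (\<lambda>z. measure (m1 z) (K j))"
    by (rule continuous_map_eq[OF continuous_integral1[OF one]]) (use sp in simp)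
  show "continuous_map X euclidean (\<lambda>z. measure (m2 z) (K j))"
    by (rule continuous_map_eq[OF continuous_integral2[OF one]]) (use sp in simp)
qed

end

context data_family
begin

definition steps :: "nat \<Rightarrow> 'x \<Rightarrow> nat" where
  "steps i z = (LEAST n. sinkhorn_error (K (i + k)) (Q z) (m1 z) (m2 z) n < 1 / real (Suc i))"

definition A :: "nat \<Rightarrow> 'x \<Rightarrow> 'a \<Rightarrow> real" where
  "A i z x = ind (i + k) x * SA (i + k) (steps i z) z x"

definition B :: "nat \<Rightarrow> 'x \<Rightarrow> 'a \<Rightarrow> real" where
  "B i z y = ind (i + k) y * SB (i + k) (steps i z) z y"

definition scale :: "nat \<Rightarrow> 'x \<Rightarrow> real" where
  "scale i z = sqrt ((\<integral>y. ind k y * B i z y \<partial>m2 z) / (\<integral>x. ind k x * A i z x \<partial>m1 z))"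

context
  fixes z assumes z: "z \<in> topspace X"
begin

interpretation P: schroedinger_problem K "Q z" "m1 z" "m2 z" by (rule problem[OF z])

lemma charged_mono: "k \<le> N \<Longrightarrow> 0 < measure (m1 z) (K N)" "k \<le> N \<Longrightarrow> 0 < measure (m2 z) (K N)"
proof -
  assume N: "k \<le> N"
  have "measure (m1 z) (K k) \<le> measure (m1 z) (K N)" "measure (m2 z) (K k) \<le> measure (m2 z) (K N)"
    by (intro P.M1.finite_measure_mono P.M2.finite_measure_mono mono_K N; simp add: P.sets_\<mu>1 P.sets_\<mu>2)+
  then show "0 < measure (m1 z) (K N)" "0 < measure (m2 z) (K N)"
    using charged1[OF z] charged2[OF z] by linarith+
qed

lemmas charged_shift = charged_mono[OF le_add2]

lemma steps_error: "sinkhorn_error (K (i + k)) (Q z) (m1 z) (m2 z) (steps i z) < 1 / real (Suc i)"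
  unfolding steps_def by (rule LeastI_ex) (rule P.sinkhorn_error_small[OF charged_shift]; simp)

lemma mass_AB_pos: "0 < (\<integral>x. ind k x * A i z x \<partial>m1 z)" "0 < (\<integral>y. ind k y * B i z y \<partial>m2 z)"
proof -
  interpret k2: compact_kernel "K k" "Q z" "m2 z" by (rule compact_kernel2[OF z order_refl])
  interpret k1: compact_kernel "K k" "\<lambda>(x, y). Q z (y, x)" "m1 z"
    by (rule data_family.compact_kernel2[OF swap_family z order_refl])
  have e: "ind k x * (ind (i + k) x * f x) = ind k x * (f x :: real)" for x f
    using mono_K[of k "i + k"] by (auto simp: indicator_def)
  show "0 < (\<integral>x. ind k x * A i z x \<partial>m1 z)"
    unfolding A_def e using P.sinkhorn_a_regular[OF charged_shift] by (intro k1.integral_C_pos) auto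
  show "0 < (\<integral>x. ind k x * B i z x \<partial>m2 z)"
    unfolding B_def e using P.sinkhorn_b_regular[OF charged_shift] by (intro k2.integral_C_pos) auto
qed

lemma scale_pos: "0 < scale i z"
  unfolding scale_def using mass_AB_pos by simp

lemma approximate_scaling_sinkhorn:
  "approximate_scaling K (Q z) (m1 z) (m2 z) (\<lambda>i x. scale i z * A i z x) (\<lambda>i y. B i z y / scale i z) k"
proof (intro approximate_scaling.intro approximate_scaling_axioms.intro P.schroedinger_problem_axioms)
  let ?a = "\<lambda>i x. scale i z * A i z x" and ?b = "\<lambda>i y. B i z y / scale i z"
  have ab: "?a i x * ?b i y = A i z x * B i z y" for i x y
    using scale_pos[of i] by simp
  have AB: "A i z = (\<lambda>x. ind (i + k) x * SA (i + k) (steps i z) z x)"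
    "B i z = (\<lambda>x. ind (i + k) x * SB (i + k) (steps i z) z x)" for i
    by (auto simp: A_def B_def)
  have adm: "P.admissible (A i z) (B i z)" for i
    unfolding AB by (rule P.sinkhorn_admissible[OF charged_shift])
  show "P.admissible (?a i) (?b i)" for i
    using adm[of i] scale_pos[of i] unfolding P.admissible_def ab by (auto intro!: mult_nonneg_nonneg divide_nonneg_pos)
  show "integrable (m1 z) (?a i)" for i
    unfolding AB by (rule integrable_mult_right[OF P.integrable_sa[OF charged_shift]])
  show "integrable (m2 z) (?b i)" for i
    unfolding AB by (rule integrable_divide_zero[OF P.integrable_sb[OF charged_shift]])
  show "0 < measure (m1 z) (K k)" "0 < measure (m2 z) (K k)"
    by (rule charged1[OF z], rule charged2[OF z])
  show "(\<integral>x. ind k x * ?a i x \<partial>m1 z) = (\<integral>x. ind k x * ?b i x \<partial>m2 z)" for i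
  proof -
    let ?IA = "\<integral>x. ind k x * A i z x \<partial>m1 z" and ?IB = "\<integral>y. ind k y * B i z y \<partial>m2 z"
    have "(\<integral>x. ind k x * ?a i x \<partial>m1 z) = (\<integral>x. scale i z * (ind k x * A i z x) \<partial>m1 z)"
      by (rule Bochner_Integration.integral_cong) auto
    then have "(\<integral>x. ind k x * ?a i x \<partial>m1 z) = scale i z * ?IA"
      by simp
    moreover have "(\<integral>x. ind k x * ?b i x \<partial>m2 z) = ?IB / scale i z" by simp
    moreover have "scale i z * scale i z = ?IB / ?IA"
      unfolding scale_def using mass_AB_pos[of i] by (intro real_sqrt_mult_self[THEN trans]) simp
    then have "scale i z * ?IA = ?IB / scale i z"
      using scale_pos[of i] mass_AB_pos[of i] by (simp add: field_simps)
    ultimately show ?thesis by simp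
  qed
  have d1: "P.defect1 (?a i) (?b i) = measure (m1 z) (- K (i + k))" for i
    using P.sinkhorn_defect1[OF charged_shift] unfolding marginal_defect_def ab unfolding AB .
  show "(\<lambda>i. P.defect1 (?a i) (?b i)) \<longlonglongrightarrow> 0"
    unfolding d1 by (rule LIMSEQ_ignore_initial_segment[OF tendsto_measure_K(2)[OF P.M1.prob_space_axioms P.sets_\<mu>1]])
  have d2: "P.defect2 (?a i) (?b i) \<le> 1 / real (Suc i) +
      \<bar>measure (m1 z) (K (i + k)) - measure (m2 z) (K (i + k))\<bar> + measure (m2 z) (- K (i + k))" for i
  proof -
    have "P.defect2 (?a i) (?b i) = P.defect2 (A i z) (B i z)"
      unfolding P.defect2_eq ab ..
    also have "\<dots> \<le> sinkhorn_error (K (i + k)) (Q z) (m1 z) (m2 z) (steps i z) +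
        \<bar>measure (m1 z) (K (i + k)) - measure (m2 z) (K (i + k))\<bar> + measure (m2 z) (- K (i + k))"
      unfolding AB by (rule P.sinkhorn_defect2[OF charged_shift])
    finally show ?thesis using steps_error[of i] by linarith
  qed
  have "(\<lambda>i. 1 / real (Suc i) + \<bar>measure (m1 z) (K (i + k)) - measure (m2 z) (K (i + k))\<bar> + measure (m2 z) (- K (i + k)))
      \<longlonglongrightarrow> 0 + \<bar>1 - 1\<bar> + 0"
    by (intro tendsto_intros LIMSEQ_Suc[OF lim_const_over_n] LIMSEQ_ignore_initial_segment
        tendsto_measure_K P.M1.prob_space_axioms P.sets_\<mu>1 P.M2.prob_space_axioms P.sets_\<mu>2)
  then have "(\<lambda>i. 1 / real (Suc i) + \<bar>measure (m1 z) (K (i + k)) - measure (m2 z) (K (i + k))\<bar> + measure (m2 z) (- K (i + k))) \<longlonglongrightarrow> 0"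
    by simp
  then show "(\<lambda>i. P.defect2 (?a i) (?b i)) \<longlonglongrightarrow> 0"
    by (rule Lim_null_comparison[rotated]) (use d2 in \<open>simp add: marginal_defect_nonneg\<close>)
qed

lemma solution_exists:
  "\<exists>\<nu>1 \<nu>2. schroedinger_solution (Q z) (m1 z) (m2 z) \<nu>1 \<nu>2 \<and> emeasure \<nu>1 (K k) = emeasure \<nu>2 (K k)"
proof -
  interpret approximate_scaling K "Q z" "m1 z" "m2 z" "\<lambda>i x. scale i z * A i z x" "\<lambda>i y. B i z y / scale i z" k
    by (rule approximate_scaling_sinkhorn)
  obtain \<alpha> \<beta> where "locally_converges \<alpha> \<beta>" by (rule obtain_limit)
  then show ?thesis using limit_solution limit_normalized by blast
qed

lemma tendsto_solution_integral:
  assumes sol: "schroedinger_solution (Q z) (m1 z) (m2 z) \<nu>1 \<nu>2" "emeasure \<nu>1 (K k) = emeasure \<nu>2 (K k)"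
    and f: "continuous_on UNIV f"
  shows "(\<lambda>i. \<integral>x. ind j x * (f x * (scale i z * A i z x)) \<partial>m1 z) \<longlonglongrightarrow> (\<integral>x. ind j x * f x \<partial>\<nu>1)"
    and "(\<lambda>i. \<integral>y. ind j y * (f y * (B i z y / scale i z)) \<partial>m2 z) \<longlonglongrightarrow> (\<integral>x. ind j x * f x \<partial>\<nu>2)"
proof -
  interpret approximate_scaling K "Q z" "m1 z" "m2 z" "\<lambda>i x. scale i z * A i z x" "\<lambda>i y. B i z y / scale i z" k
    by (rule approximate_scaling_sinkhorn)
  obtain \<alpha> \<beta> where lc: "locally_converges \<alpha> \<beta>" by (rule obtain_limit)
  then have [measurable]: "\<alpha> \<in> borel_measurable borel" "\<beta> \<in> borel_measurable borel"
    and nonneg: "\<And>x. 0 \<le> \<alpha> x" "\<And>x. 0 \<le> \<beta> x" by (auto simp: locally_converges_def)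
  have \<nu>: "\<nu>1 = density (m1 z) (\<lambda>x. ennreal (\<alpha> x))" "\<nu>2 = density (m2 z) (\<lambda>x. ennreal (\<beta> x))"
    using P.solution_unique[OF sol(1) limit_solution[OF lc] sol(2) limit_normalized[OF lc] charged] by auto
  have [measurable]: "f \<in> borel_measurable borel" by (rule borel_measurable_continuous_onI[OF f])
  obtain C where C: "\<And>x. x \<in> K j \<Longrightarrow> \<bar>f x\<bar> \<le> C"
    using bounded_image_K[OF f, of j] unfolding bounded_iff by force
  have "(\<integral>x. ind j x * f x \<partial>\<nu>1) = (\<integral>x. ind j x * (f x * \<alpha> x) \<partial>m1 z)"
    unfolding \<nu> by (subst integral_density) (use nonneg in \<open>auto intro!: Bochner_Integration.integral_cong\<close>)
  then show "(\<lambda>i. \<integral>x. ind j x * (f x * (scale i z * A i z x)) \<partial>m1 z) \<longlonglongrightarrow> (\<integral>x. ind j x * f x \<partial>\<nu>1)"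
    using tendsto_local_integral(1)[OF lc _ C] by simp
  have "(\<integral>x. ind j x * f x \<partial>\<nu>2) = (\<integral>x. ind j x * (f x * \<beta> x) \<partial>m2 z)"
    unfolding \<nu> by (subst integral_density) (use nonneg in \<open>auto intro!: Bochner_Integration.integral_cong\<close>)
  then show "(\<lambda>i. \<integral>y. ind j y * (f y * (B i z y / scale i z)) \<partial>m2 z) \<longlonglongrightarrow> (\<integral>x. ind j x * f x \<partial>\<nu>2)"
    using tendsto_local_integral2(1)[OF lc _ C] by simp
qed

end

lemma measurable_sinkhorn_error:
  assumes N: "k \<le> N"
  shows "(\<lambda>z. sinkhorn_error (K N) (Q z) (m1 z) (m2 z) n) \<in> borel_measurable (borel_of X)"
  unfolding sinkhorn_error_def
proof -
  have SB: "depends_continuously N (SB N n)" "depends_continuously N (SB N (Suc n))"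
    and pos: "\<And>z y. z \<in> topspace X \<Longrightarrow> 0 < SB N (Suc n) z y"
    using SB_regular[OF N] by blast+
  have "measure (m2 z) (K N) \<noteq> 0" if "z \<in> topspace X" for z
    using charged_mono(2)[OF that N] by simp
  then have c: "continuous_map X euclidean (\<lambda>z. measure (m1 z) (K N) / measure (m2 z) (K N))"
    by (intro continuous_map_real_divide continuous_measure_K)
  have d: "depends_continuously N (\<lambda>z y. SB N n z y / SB N (Suc n) z y)"
    by (rule depends_continuously_divide[OF SB]) (rule pos)
  show "(\<lambda>z. \<integral>y. ind N y * \<bar>SB N n z y / SB N (Suc n) z y - measure (m1 z) (K N) / measure (m2 z) (K N)\<bar> \<partial>m2 z)
      \<in> borel_measurable (borel_of X)"
    by (rule borel_of_continuous_map[OF continuous_integral2[OF depends_continuously_abs_diff[OF d depends_continuously_const[OF c]]]])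
qed

lemma measurable_steps [measurable]: "steps i \<in> borel_of X \<rightarrow>\<^sub>M count_space UNIV"
proof -
  have [measurable]: "(\<lambda>z. sinkhorn_error (K (i + k)) (Q z) (m1 z) (m2 z) n) \<in> borel_measurable (borel_of X)" for n
    by (rule measurable_sinkhorn_error) simp
  show ?thesis unfolding steps_def[abs_def] by measurable
qed

lemma measurable_integral_AB:
  assumes f: "depends_continuously j f" and j: "j \<le> i + k"
  shows "(\<lambda>z. \<integral>x. ind j x * (f z x * A i z x) \<partial>m1 z) \<in> borel_measurable (borel_of X)"
    and "(\<lambda>z. \<integral>y. ind j y * (f z y * B i z y) \<partial>m2 z) \<in> borel_measurable (borel_of X)"
proof -
  have e: "ind j x * (g x * (ind (i + k) x * h x)) = ind j x * (g x * h x :: real)" for x g h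
    using mono_K[OF j] by (auto simp: indicator_def)
  have "(\<lambda>z. \<integral>x. ind j x * (f z x * SA (i + k) n z x) \<partial>m1 z) \<in> borel_measurable (borel_of X)" for n
    by (intro borel_of_continuous_map continuous_integral1 depends_continuously_mult f
        depends_continuously_mono[OF SA_regular(1) j]) simp
  from measurable_compose_countable[OF this measurable_steps[of i]]
  show "(\<lambda>z. \<integral>x. ind j x * (f z x * A i z x) \<partial>m1 z) \<in> borel_measurable (borel_of X)"
    unfolding A_def e .
  have "(\<lambda>z. \<integral>x. ind j x * (f z x * SB (i + k) n z x) \<partial>m2 z) \<in> borel_measurable (borel_of X)" for n
    by (intro borel_of_continuous_map continuous_integral2 depends_continuously_mult f
        depends_continuously_mono[OF _ j]) (use SB_regular[of "i + k"] in simp)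
  from measurable_compose_countable[OF this measurable_steps[of i]]
  show "(\<lambda>z. \<integral>x. ind j x * (f z x * B i z x) \<partial>m2 z) \<in> borel_measurable (borel_of X)"
    unfolding B_def e .
qed

lemma measurable_scale [measurable]: "scale i \<in> borel_measurable (borel_of X)"
proof -
  have one: "depends_continuously k (\<lambda>z y. 1)"
    unfolding depends_continuously_def by (auto intro!: uniform_limit_const)
  have [measurable]: "(\<lambda>z. \<integral>x. ind k x * A i z x \<partial>m1 z) \<in> borel_measurable (borel_of X)"
    "(\<lambda>z. \<integral>x. ind k x * B i z x \<partial>m2 z) \<in> borel_measurable (borel_of X)"
    using measurable_integral_AB[OF one, of i] by simp_all
  show ?thesis unfolding scale_def[abs_def] by measurable
qed

lemma measurable_solution_integral:
  assumes sol: "\<And>z. z \<in> topspace X \<Longrightarrow> schroedinger_solution (Q z) (m1 z) (m2 z) (\<nu>1 z) (\<nu>2 z)"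
    "\<And>z. z \<in> topspace X \<Longrightarrow> emeasure (\<nu>1 z) (K k) = emeasure (\<nu>2 z) (K k)"
    and f: "depends_continuously j f"
  shows "(\<lambda>z. \<integral>x. ind j x * f z x \<partial>\<nu>1 z) \<in> borel_measurable (borel_of X)" (is ?thesis1)
    and "(\<lambda>z. \<integral>x. ind j x * f z x \<partial>\<nu>2 z) \<in> borel_measurable (borel_of X)" (is ?thesis2)
proof -
  have cf: "continuous_on UNIV (f z)" if "z \<in> topspace X" for z
    using f that by (simp add: depends_continuously_def)
  show ?thesis1
  proof (rule borel_measurable_LIMSEQ_real)
    fix z assume "z \<in> space (borel_of X)"
    then have z: "z \<in> topspace X" by (simp add: space_borel_of)
    show "(\<lambda>i. \<integral>x. ind j x * (f z x * (scale (i + j) z * A (i + j) z x)) \<partial>m1 z) \<longlonglongrightarrow> (\<integral>x. ind j x * f z x \<partial>\<nu>1 z)"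
      by (rule LIMSEQ_ignore_initial_segment[OF tendsto_solution_integral(1)[OF z sol(1)[OF z] sol(2)[OF z] cf[OF z]]])
  next
    fix i
    have [measurable]: "(\<lambda>z. \<integral>x. ind j x * (f z x * A (i + j) z x) \<partial>m1 z) \<in> borel_measurable (borel_of X)"
      by (rule measurable_integral_AB[OF f]) simp
    have "(\<lambda>z. scale (i + j) z * (\<integral>x. ind j x * (f z x * A (i + j) z x) \<partial>m1 z)) \<in> borel_measurable (borel_of X)"
      by measurable
    then show "(\<lambda>z. \<integral>x. ind j x * (f z x * (scale (i + j) z * A (i + j) z x)) \<partial>m1 z) \<in> borel_measurable (borel_of X)"
      by (simp add: mult.left_commute[of _ "scale _ _"])
  qed
  show ?thesis2
  proof (rule borel_measurable_LIMSEQ_real)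
    fix z assume "z \<in> space (borel_of X)"
    then have z: "z \<in> topspace X" by (simp add: space_borel_of)
    show "(\<lambda>i. \<integral>x. ind j x * (f z x * (B (i + j) z x / scale (i + j) z)) \<partial>m2 z) \<longlonglongrightarrow> (\<integral>x. ind j x * f z x \<partial>\<nu>2 z)"
      by (rule LIMSEQ_ignore_initial_segment[OF tendsto_solution_integral(2)[OF z sol(1)[OF z] sol(2)[OF z] cf[OF z]]])
  next
    fix i
    have [measurable]: "(\<lambda>z. \<integral>x. ind j x * (f z x * B (i + j) z x) \<partial>m2 z) \<in> borel_measurable (borel_of X)"
      by (rule measurable_integral_AB[OF f]) simp
    have "(\<lambda>z. (\<integral>x. ind j x * (f z x * B (i + j) z x) \<partial>m2 z) / scale (i + j) z) \<in> borel_measurable (borel_of X)"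
      by measurable
    then show "(\<lambda>z. \<integral>x. ind j x * (f z x * (B (i + j) z x / scale (i + j) z)) \<partial>m2 z) \<in> borel_measurable (borel_of X)"
      by simp
  qed
qed

end

section \<open>Measurability of the solution\<close>

lemma measurable_borel_of_subtopology:
  assumes f: "f \<in> borel_of (subtopology X S) \<rightarrow>\<^sub>M N"
  shows "f \<in> restrict_space (borel_of X) S \<rightarrow>\<^sub>M N"
proof -
  have sp: "space (restrict_space (borel_of X) S) = topspace (subtopology X S)"
    by (auto simp: space_restrict_space space_borel_of)
  have "(\<lambda>x. x) \<in> restrict_space (borel_of X) S \<rightarrow>\<^sub>M borel_of (subtopology X S)"
    unfolding borel_of_def[of "subtopology X S"]
  proof (rule measurable_measure_of)
    show "{U. openin (subtopology X S) U} \<subseteq> Pow (topspace (subtopology X S))"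
      using openin_subset[of "subtopology X S"] by blast
    show "(\<lambda>x. x) \<in> space (restrict_space (borel_of X) S) \<rightarrow> topspace (subtopology X S)"
      unfolding sp by simp
    fix U assume "U \<in> {U. openin (subtopology X S) U}"
    then obtain V where V: "openin X V" "U = V \<inter> S" by (auto simp: openin_subtopology)
    have "(\<lambda>x. x) -` U \<inter> space (restrict_space (borel_of X) S) = S \<inter> V"
      using V openin_subset[OF V(1)] by (auto simp: sp)
    also have "\<dots> \<in> sets (restrict_space (borel_of X) S)"
      using sets_borel_of_openin[OF V(1)] by (auto simp: sets_restrict_space)
    finally show "(\<lambda>x. x) -` U \<inter> space (restrict_space (borel_of X) S) \<in> sets (restrict_space (borel_of X) S)" .
  qed
  from measurable_compose[OF this f] show ?thesis .
qed

lemma eventually_nhdsin_continuous: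
  assumes "continuous_map X Y f" "z \<in> topspace X" "openin Y U" "f z \<in> U"
  shows "\<forall>\<^sub>F w in nhdsin X z. f w \<in> U"
proof -
  have "openin X {x \<in> topspace X. f x \<in> U}"
    using assms(1,3) by (auto simp: continuous_map_def)
  then show ?thesis
    using assms(2,4) by (auto simp: eventually_nhdsin intro!: exI[of _ "{x \<in> topspace X. f x \<in> U}"])
qed

lemma openin_ucc_ball:
  fixes q :: "'b::topological_space \<Rightarrow> real"
  assumes C: "compact C" and q: "continuous_on UNIV q"
  shows "openin ucc_topology {p \<in> cont_functions. \<forall>y\<in>C. \<bar>p y - q y\<bar> < e}"
  unfolding openin_ucc_topology ucc_open_def
proof (intro conjI ballI)
  fix p assume p: "p \<in> {p \<in> cont_functions. \<forall>y\<in>C. \<bar>p y - q y\<bar> < e}"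
  have "\<exists>d>0. \<forall>y\<in>C. \<bar>p y - q y\<bar> \<le> e - d"
  proof (cases "C = {}")
    case False
    have "continuous_on C (\<lambda>y. \<bar>p y - q y\<bar>)"
      using p q by (intro continuous_intros) (auto simp: cont_functions_def intro: continuous_on_subset)
    then obtain y0 where "y0 \<in> C" "\<forall>y\<in>C. \<bar>p y - q y\<bar> \<le> \<bar>p y0 - q y0\<bar>"
      using continuous_attains_sup[OF C False] by blast
    then show ?thesis using p by (intro exI[of _ "e - \<bar>p y0 - q y0\<bar>"]) auto
  qed (auto intro: exI[of _ 1])
  then obtain d where d: "0 < d" "\<And>y. y \<in> C \<Longrightarrow> \<bar>p y - q y\<bar> \<le> e - d" by blast
  have "{r \<in> cont_functions. \<forall>y\<in>C. \<bar>r y - p y\<bar> < d} \<subseteq> {r \<in> cont_functions. \<forall>y\<in>C. \<bar>r y - q y\<bar> < e}"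
  proof safe
    fix r y assume "\<forall>y\<in>C. \<bar>r y - p y\<bar> < d" "y \<in> C"
    then have "\<bar>r y - p y\<bar> < d" by blast
    then show "\<bar>r y - q y\<bar> < e" using d(2)[OF \<open>y \<in> C\<close>] by linarith
  qed
  then show "\<exists>K e'. compact K \<and> 0 < e' \<and> {r \<in> cont_functions. \<forall>z\<in>K. \<bar>r z - p z\<bar> < e'}
      \<subseteq> {p \<in> cont_functions. \<forall>y\<in>C. \<bar>p y - q y\<bar> < e}"
    using C d(1) by blast
qed auto

lemma uniform_limit_ucc:
  assumes f: "continuous_map X ucc_topology f" and z: "z \<in> topspace X" and C: "compact C"
  shows "uniform_limit C f (f z) (nhdsin X z)"
proof (rule uniform_limitI)
  fix e :: real assume e: "0 < e"
  have fz: "f z \<in> cont_functions"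
    using f z by (auto simp: continuous_map_def topspace_ucc_topology)
  then have "openin ucc_topology {p \<in> cont_functions. \<forall>y\<in>C. \<bar>p y - f z y\<bar> < e}"
    by (intro openin_ucc_ball C) (simp add: cont_functions_def)
  from eventually_nhdsin_continuous[OF f z this]
  have "\<forall>\<^sub>F w in nhdsin X z. f w \<in> {p \<in> cont_functions. \<forall>y\<in>C. \<bar>p y - f z y\<bar> < e}"
    using fz e by simp
  then show "\<forall>\<^sub>F w in nhdsin X z. \<forall>y\<in>C. dist (f w y) (f z y) < e"
    by eventually_elim (simp add: dist_real_def)
qed

lemma topspace_strong_topology: "topspace (strong_topology :: 'a::metric_space measure topology) = prob_measures"
  unfolding strong_topology_def by (rule Metric_space.topspace_mtopology[OF Metric_space_strong_dist])

lemma strong_dist_limit: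
  fixes f :: "'x \<Rightarrow> 'a::metric_space measure"
  assumes f: "continuous_map X strong_topology f" and z: "z \<in> topspace X"
  shows "((\<lambda>w. strong_dist (f w) (f z)) \<longlongrightarrow> 0) (nhdsin X z)"
proof -
  interpret Metric_space "prob_measures :: 'a measure set" strong_dist by (rule Metric_space_strong_dist)
  have fz: "f z \<in> prob_measures"
    using f z by (auto simp: continuous_map_def topspace_strong_topology)
  show ?thesis
  proof (rule tendstoI)
    fix e :: real assume e: "0 < e"
    have "\<forall>\<^sub>F w in nhdsin X z. f w \<in> mball (f z) e"
      by (rule eventually_nhdsin_continuous[OF f z]) (use fz e in \<open>auto simp: strong_topology_def\<close>)
    then show "\<forall>\<^sub>F w in nhdsin X z. dist (strong_dist (f w) (f z)) 0 < e"
      by eventually_elim (simp add: commute)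
  qed
qed

lemma continuous_map_measure_closed:
  fixes f :: "'x \<Rightarrow> 'a::metric_space measure"
  assumes f: "continuous_map X strong_topology f" and C: "closed C"
  shows "continuous_map X euclidean (\<lambda>z. measure (f z) C)"
proof (rule continuous_map_nhdsinI)
  fix z assume z: "z \<in> topspace X"
  have p: "f w \<in> prob_measures" if "w \<in> topspace X" for w
    using f that by (auto simp: continuous_map_def topspace_strong_topology)
  have m: "(\<integral>x. indicator C x * 1 \<partial>f w) = measure (f w) C" if "w \<in> topspace X" for w
    using p[OF that] sets_eq_imp_space_eq[of "f w" borel] by (auto simp: prob_measures_def)
  have "\<forall>\<^sub>F w in nhdsin X z. norm (measure (f w) C - measure (f z) C) \<le> strong_dist (f w) (f z)"
    using eventually_nhdsin_topspace
  proof eventually_elim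
    case (elim w)
    show ?case
      using strong_dist_closed[OF p[OF elim] p[OF z] C, of "\<lambda>_. 1" 1] unfolding m[OF elim] m[OF z] by simp
  qed
  from LIM_zero_cancel[OF Lim_null_comparison[OF this strong_dist_limit[OF f z]]]
  show "((\<lambda>w. measure (f w) C) \<longlongrightarrow> measure (f z) C) (nhdsin X z)" .
qed

context data_family
begin

lemma depends_continuously_section:
  assumes x: "\<And>z. z \<in> topspace X \<Longrightarrow> x z \<in> K l" and lim: "\<And>z. z \<in> topspace X \<Longrightarrow> (x \<longlongrightarrow> x z) (nhdsin X z)"
  shows "depends_continuously j (\<lambda>z y. Q z (x z, y))"
  unfolding depends_continuously_def
proof (intro ballI conjI)
  fix z assume z: "z \<in> topspace X"
  interpret P: schroedinger_problem K "Q z" "m1 z" "m2 z" by (rule problem[OF z])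
  show "continuous_on UNIV (\<lambda>y. Q z (x z, y))"
    by (intro continuous_on_compose2[OF P.continuous_q] continuous_intros) auto
  define L where "L = max l j"
  have L: "K l \<subseteq> K L" "K j \<subseteq> K L" unfolding L_def by (rule mono_K, simp)+
  have uc: "uniformly_continuous_on (K L \<times> K L) (Q z)"
    by (rule compact_uniformly_continuous[OF continuous_on_subset[OF P.continuous_q subset_UNIV] compact_Times[OF compact_K compact_K]])
  show "uniform_limit (K j) (\<lambda>z y. Q z (x z, y)) (\<lambda>y. Q z (x z, y)) (nhdsin X z)"
  proof (rule uniform_limitI)
    fix e :: real assume e: "0 < e"
    obtain d where d: "0 < d" "\<And>p p'. p \<in> K L \<times> K L \<Longrightarrow> p' \<in> K L \<times> K L \<Longrightarrow> dist p' p < d \<Longrightarrow> dist (Q z p') (Q z p) < e / 2"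
      using uc e unfolding uniformly_continuous_on_def by (metis half_gt_zero)
    have "\<forall>\<^sub>F w in nhdsin X z. dist (x w) (x z) < d" by (rule tendstoD[OF lim[OF z] d(1)])
    moreover have "\<forall>\<^sub>F w in nhdsin X z. \<forall>p\<in>K L \<times> K L. dist (Q w p) (Q z p) < e / 2"
      using uniform_limitD[OF Q_limit[OF z, of L], of "e / 2"] e by simp
    ultimately show "\<forall>\<^sub>F w in nhdsin X z. \<forall>y\<in>K j. dist (Q w (x w, y)) (Q z (x z, y)) < e"
      using eventually_nhdsin_topspace
    proof eventually_elim
      case (elim w)
      show ?case
      proof
        fix y assume y: "y \<in> K j"
        have p: "(x w, y) \<in> K L \<times> K L" "(x z, y) \<in> K L \<times> K L" using x[OF elim(3)] x[OF z] y L by auto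
        have "dist (Q w (x w, y)) (Q z (x w, y)) < e / 2" using elim(2) p(1) by blast
        moreover have "dist (Q z (x w, y)) (Q z (x z, y)) < e / 2"
          by (rule d(2)[OF p(2,1)]) (use elim(1) in \<open>simp add: dist_Pair_Pair\<close>)
        ultimately show "dist (Q w (x w, y)) (Q z (x z, y)) < e"
          unfolding dist_real_def by linarith
      qed
    qed
  qed
qed

end

context schroedinger_problem
begin

lemma solution_finite_compact1:
  assumes sol: "schroedinger_solution q \<mu>1 \<mu>2 \<nu>1 \<nu>2" and ch: "0 < measure \<mu>2 (K k)" and C: "compact C"
  shows "emeasure \<nu>1 C < \<infinity>"
proof -
  interpret C: compact_cover "\<lambda>n. K n \<union> C"
    by unfold_locales (use compact_K C mono_K UN_K in \<open>auto intro!: compact_Un\<close>)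
  interpret E: schroedinger_problem "\<lambda>n. K n \<union> C" q \<mu>1 \<mu>2
    by (intro schroedinger_problem.intro schroedinger_problem_axioms.intro C.compact_cover_axioms
        M1.prob_space_axioms M2.prob_space_axioms sets_\<mu>1 sets_\<mu>2 continuous_q q_pos)
  have "measure \<mu>2 (K k) \<le> measure \<mu>2 (K k \<union> C)"
    using C.K_borel[of k] by (intro M2.finite_measure_mono) (auto simp: sets_\<mu>2)
  then have fin: "emeasure \<nu>1 (K k \<union> C) < \<infinity>"
    using ch by (intro E.solution_finite1[OF sol]) simp
  have "emeasure \<nu>1 C \<le> emeasure \<nu>1 (K k \<union> C)"
    using sol C.K_borel[of k] by (intro emeasure_mono) (auto simp: schroedinger_solution_def)
  then show ?thesis using fin by (rule le_less_trans)
qed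

lemma solution_section_pos:
  assumes sol: "schroedinger_solution q \<mu>1 \<mu>2 \<nu>1 \<nu>2" and ch: "0 < measure \<mu>2 (K k)"
  shows "(\<integral>\<^sup>+y. ennreal (q (x, y)) \<partial>\<nu>2) \<noteq> 0"
proof
  assume z: "(\<integral>\<^sup>+y. ennreal (q (x, y)) \<partial>\<nu>2) = 0"
  have [measurable_cong]: "sets \<nu>2 = sets borel" using sol by (simp add: schroedinger_solution_def)
  have sp: "space \<nu>2 = UNIV"
    using sol sets_eq_imp_space_eq[of \<nu>2 borel] by (simp add: schroedinger_solution_def)
  have "AE y in \<nu>2. ennreal (q (x, y)) = 0"
    using z by (subst (asm) nn_integral_0_iff_AE) auto
  then have "AE y in \<nu>2. y \<notin> K k"
    by eventually_elim (metis ennreal_eq_0_iff not_le q_pos)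
  then have "emeasure \<nu>2 (K k) = 0"
    by (subst (asm) AE_iff_measurable[of "K k"]) (auto simp: sp)
  then show False using solution_charged2[OF sol ch] by simp
qed

end

context schroedinger_problem
begin

interpretation S: schroedinger_problem K "\<lambda>(x, y). q (y, x)" \<mu>2 \<mu>1
  by (rule swap)

lemma solution_finite_compact2:
  assumes sol: "schroedinger_solution q \<mu>1 \<mu>2 \<nu>1 \<nu>2" and ch: "0 < measure \<mu>1 (K k)" and C: "compact C"
  shows "emeasure \<nu>2 C < \<infinity>"
  by (rule S.solution_finite_compact1[OF solution_swap[OF sol] ch C])

lemma solution_section_pos2:
  assumes sol: "schroedinger_solution q \<mu>1 \<mu>2 \<nu>1 \<nu>2" and ch: "0 < measure \<mu>1 (K k)"
  shows "(\<integral>\<^sup>+y. ennreal (q (y, x)) \<partial>\<nu>1) \<noteq> 0"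
  using S.solution_section_pos[OF solution_swap[OF sol] ch, of x] by simp

end

lemma topspace_data_topology:
  "topspace (data_topology :: (('a::metric_space \<times> 'a \<Rightarrow> real) \<times> 'a measure \<times> 'a measure) topology) =
    {q. continuous_on UNIV q \<and> (\<forall>z. 0 < q z)} \<times> prob_measures \<times> prob_measures"
  unfolding data_topology_def positive_ucc_topology_def
  by (auto simp: topspace_ucc_topology topspace_strong_topology cont_functions_def)

lemma continuous_map_data:
  fixes p :: "'x \<Rightarrow> ('a::metric_space \<times> 'a \<Rightarrow> real) \<times> 'a measure \<times> 'a measure"
  assumes p: "continuous_map X data_topology p"
  shows "continuous_map X ucc_topology (\<lambda>z. fst (p z))"
    and "continuous_map X strong_topology (\<lambda>z. fst (snd (p z)))"
    and "continuous_map X strong_topology (\<lambda>z. snd (snd (p z)))"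
proof -
  have 1: "continuous_map X positive_ucc_topology (\<lambda>z. fst (p z))"
    and 2: "continuous_map X (prod_topology strong_topology strong_topology) (\<lambda>z. snd (p z))"
    using p unfolding data_topology_def continuous_map_pairwise by (auto simp: comp_def)
  show "continuous_map X ucc_topology (\<lambda>z. fst (p z))"
    using 1 unfolding positive_ucc_topology_def continuous_map_in_subtopology by simp
  show "continuous_map X strong_topology (\<lambda>z. fst (snd (p z)))" "continuous_map X strong_topology (\<lambda>z. snd (snd (p z)))"
    using 2 unfolding continuous_map_pairwise by (auto simp: comp_def)
qed

text \<open>The sets \<open>A n\<close> with \<open>n \<ge> 1\<close> are re-indexed from \<open>0\<close>.\<close>

locale exhausted_space =
  fixes A :: "nat \<Rightarrow> 'a::metric_space set"
  assumes exhaustion: "compact_exhaustion A"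
begin

abbreviation "K n \<equiv> A (Suc n)"

sublocale compact_cover "\<lambda>n. K n"
proof
  show "compact (K n)" for n using exhaustion by (simp add: compact_exhaustion_def)
  show "m \<le> n \<Longrightarrow> K m \<subseteq> K n" for m n
    using exhaustion by (auto simp: compact_exhaustion_def mono_on_def)
  have "x \<in> (\<Union>n. K n)" for x
  proof -
    have "x \<in> (\<Union>n\<in>{1..}. A n)" using exhaustion unfolding compact_exhaustion_def by blast
    then obtain n where "1 \<le> n" "x \<in> A n" unfolding UN_iff atLeast_iff by blast
    then show ?thesis by (intro UN_I[of "n - 1"]) simp_all
  qed
  then show "(\<Union>n. K n) = UNIV" by blast
qed

lemma problem_data:
  assumes "d \<in> topspace data_topology"
  shows "schroedinger_problem K (fst d) (fst (snd d)) (snd (snd d))"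
  using assms unfolding topspace_data_topology
  by (intro schroedinger_problem.intro schroedinger_problem_axioms.intro compact_cover_axioms)
    (auto simp: prob_measures_def)

definition index :: "('a \<times> 'a \<Rightarrow> real) \<times> 'a measure \<times> 'a measure \<Rightarrow> nat" where
  "index d = first_charged_index A (fst (snd d)) (snd (snd d))"

lemma index_charged:
  assumes d: "d \<in> topspace data_topology"
  shows "1 \<le> index d" "0 < measure (fst (snd d)) (A (index d))" "0 < measure (snd (snd d)) (A (index d))"
proof -
  interpret schroedinger_problem "\<lambda>n. K n" "fst d" "fst (snd d)" "snd (snd d)" by (rule problem_data[OF d])
  have "(\<lambda>n. measure (fst (snd d)) (K n) * measure (snd (snd d)) (K n)) \<longlonglongrightarrow> 1 * 1"
    by (intro tendsto_mult tendsto_measure_K M1.prob_space_axioms M2.prob_space_axioms sets_\<mu>1 sets_\<mu>2)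
  then have "\<forall>\<^sub>F n in sequentially. 0 < measure (fst (snd d)) (K n) * measure (snd (snd d)) (K n)"
    by (rule order_tendstoD(1)) simp
  then obtain n where "0 < measure (fst (snd d)) (K n) * measure (snd (snd d)) (K n)"
    using eventually_happens'[OF sequentially_bot] by blast
  then have "1 \<le> Suc n \<and> measure (fst (snd d)) (A (Suc n)) * measure (snd (snd d)) (A (Suc n)) > 0" by simp
  then have *: "1 \<le> index d \<and> measure (fst (snd d)) (A (index d)) * measure (snd (snd d)) (A (index d)) > 0"
    unfolding index_def first_charged_index_def by (rule LeastI)
  then show "1 \<le> index d" by simp
  show "0 < measure (fst (snd d)) (A (index d))" "0 < measure (snd (snd d)) (A (index d))"
    using * by (auto simp: zero_less_mult_iff dest: order_antisym[OF measure_nonneg] simp: not_less[symmetric])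
qed

lemma data_family_piece:
  assumes p: "continuous_map Z data_topology p"
    and S: "\<And>z. z \<in> S \<Longrightarrow> z \<in> topspace Z \<Longrightarrow> index (p z) = Suc k"
  shows "data_family K (subtopology Z S) (\<lambda>z. fst (p z)) (\<lambda>z. fst (snd (p z))) (\<lambda>z. snd (snd (p z))) k"
proof (intro data_family.intro data_family_axioms.intro compact_cover_axioms)
  let ?X = "subtopology Z S"
  have pX: "continuous_map ?X data_topology p" using p by (rule continuous_map_from_subtopology)
  note c = continuous_map_data[OF pX]
  fix z assume z: "z \<in> topspace ?X"
  have d: "p z \<in> topspace data_topology" using pX z by (auto simp: continuous_map_def)
  have i: "index (p z) = Suc k" using z S by auto
  show "schroedinger_problem K (fst (p z)) (fst (snd (p z))) (snd (snd (p z)))" by (rule problem_data[OF d])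
  show "0 < measure (fst (snd (p z))) (K k)" "0 < measure (snd (snd (p z))) (K k)"
    using index_charged(2,3)[OF d] unfolding i .
  show "uniform_limit (K n \<times> K n) (\<lambda>z. fst (p z)) (fst (p z)) (nhdsin ?X z)" for n
    by (rule uniform_limit_ucc[OF c(1) z compact_Times[OF compact_K compact_K]])
  show "((\<lambda>w. strong_dist (fst (snd (p w))) (fst (snd (p z)))) \<longlongrightarrow> 0) (nhdsin ?X z)"
    by (rule strong_dist_limit[OF c(2) z])
  show "((\<lambda>w. strong_dist (snd (snd (p w))) (snd (snd (p z)))) \<longlongrightarrow> 0) (nhdsin ?X z)"
    by (rule strong_dist_limit[OF c(3) z])
qed

abbreviation "nu i d \<equiv> schroedinger_nu A i (fst d) (fst (snd d)) (snd (snd d))"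

lemma nu_solution:
  assumes d: "d \<in> topspace data_topology"
  shows "schroedinger_solution (fst d) (fst (snd d)) (snd (snd d)) (nu 1 d) (nu 2 d)"
    and "emeasure (nu 1 d) (A (index d)) = emeasure (nu 2 d) (A (index d))"
proof -
  interpret P: schroedinger_problem "\<lambda>n. K n" "fst d" "fst (snd d)" "snd (snd d)" by (rule problem_data[OF d])
  obtain k where k: "index d = Suc k" using index_charged(1)[OF d] by (cases "index d") auto
  have "data_family K (subtopology data_topology {d}) (\<lambda>z. fst z) (\<lambda>z. fst (snd z)) (\<lambda>z. snd (snd z)) k"
    using data_family_piece[of data_topology "\<lambda>z. z" "{d}" k] k by simp
  from data_family.solution_exists[OF this, of d] d
  obtain \<nu>1 \<nu>2 where \<nu>: "schroedinger_solution (fst d) (fst (snd d)) (snd (snd d)) \<nu>1 \<nu>2"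
    "emeasure \<nu>1 (A (index d)) = emeasure \<nu>2 (A (index d))"
    unfolding k by auto
  have "schroedinger_pair A (fst d) (fst (snd d)) (snd (snd d)) = (\<nu>1, \<nu>2)"
    unfolding schroedinger_pair_def index_def[symmetric]
  proof (rule the_equality)
    show "case (\<nu>1, \<nu>2) of (\<nu>1, \<nu>2) \<Rightarrow> schroedinger_solution (fst d) (fst (snd d)) (snd (snd d)) \<nu>1 \<nu>2 \<and>
        emeasure \<nu>1 (A (index d)) = emeasure \<nu>2 (A (index d))"
      using \<nu> by simp
    fix r assume r: "case r of (\<nu>1, \<nu>2) \<Rightarrow> schroedinger_solution (fst d) (fst (snd d)) (snd (snd d)) \<nu>1 \<nu>2 \<and>
        emeasure \<nu>1 (A (index d)) = emeasure \<nu>2 (A (index d))"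
    obtain \<nu>1' \<nu>2' where r': "r = (\<nu>1', \<nu>2')" by force
    show "r = (\<nu>1, \<nu>2)"
      using P.solution_unique[of \<nu>1' \<nu>2' \<nu>1 \<nu>2 k] r \<nu> index_charged(2,3)[OF d] unfolding r' k by simp
  qed
  then show "schroedinger_solution (fst d) (fst (snd d)) (snd (snd d)) (nu 1 d) (nu 2 d)"
    "emeasure (nu 1 d) (A (index d)) = emeasure (nu 2 d) (A (index d))"
    using \<nu> by (simp_all add: schroedinger_nu_def)
qed

lemma nu_sets: "d \<in> topspace data_topology \<Longrightarrow> i \<in> {1, 2} \<Longrightarrow> sets (nu i d) = sets borel"
  using nu_solution(1)[of d] by (auto simp: schroedinger_solution_def)

lemma nu_finite_compact:
  assumes d: "d \<in> topspace data_topology" and C: "compact C" and i: "i \<in> {1, 2}"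
  shows "emeasure (nu i d) C < \<infinity>"
proof -
  interpret P: schroedinger_problem "\<lambda>n. K n" "fst d" "fst (snd d)" "snd (snd d)" by (rule problem_data[OF d])
  obtain k where k: "index d = Suc k" using index_charged(1)[OF d] by (cases "index d") auto
  note ch = index_charged(2,3)[OF d, unfolded k]
  show ?thesis
    using i P.solution_finite_compact1[OF nu_solution(1)[OF d] ch(2) C]
      P.solution_finite_compact2[OF nu_solution(1)[OF d] ch(1) C] by auto
qed

lemma nu_integrable_on_compact:
  fixes f :: "'a \<Rightarrow> real"
  assumes d: "d \<in> topspace data_topology" and i: "i \<in> {1, 2}"
    and f: "continuous_on UNIV f" and C: "compact C" and supp: "\<And>x. x \<notin> C \<Longrightarrow> g x = 0" and g: "\<And>x. x \<in> C \<Longrightarrow> g x = f x"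
  shows "integrable (nu i d) g"
proof -
  have "bounded (f ` C)"
    by (rule compact_imp_bounded[OF compact_continuous_image[OF continuous_on_subset[OF f subset_UNIV] C]])
  then obtain b where b: "\<forall>w\<in>f ` C. norm w \<le> b" unfolding bounded_iff by blast
  have s [measurable_cong]: "sets (nu i d) = sets borel" by (rule nu_sets[OF d i])
  have [measurable]: "C \<in> sets borel" using C compact_imp_closed borel_closed by blast
  have [measurable]: "f \<in> borel_measurable borel" by (rule borel_measurable_continuous_onI[OF f])
  have g': "g = (\<lambda>x. indicator C x * f x)" using supp g by (auto simp: indicator_def fun_eq_iff)
  show ?thesis
  proof (rule integrableI_bounded_set[where A=C and B=b])
    show "C \<in> sets (nu i d)" by measurable
    show "g \<in> borel_measurable (nu i d)" unfolding g' by measurable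
    show "emeasure (nu i d) C < \<infinity>" by (rule nu_finite_compact[OF d C i])
    show "AE x in nu i d. x \<in> C \<longrightarrow> norm (g x) \<le> b" using g b by (intro AE_I2) auto
    show "AE x in nu i d. x \<notin> C \<longrightarrow> g x = 0" using supp by (intro AE_I2) auto
  qed
qed

lemma C0_integrable:
  assumes "d \<in> topspace data_topology" "i \<in> {1, 2}" "f \<in> C0_functions"
  shows "integrable (nu i d) f"
proof (rule nu_integrable_on_compact[where f=f and C="closure {x. f x \<noteq> 0}"])
  show "x \<notin> closure {x. f x \<noteq> 0} \<Longrightarrow> f x = 0" for x
    using closure_subset[of "{x. f x \<noteq> 0}"] by blast
qed (use assms in \<open>auto simp: C0_functions_def\<close>)

lemma measurable_index:
  assumes p: "continuous_map Z data_topology p"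
  shows "(\<lambda>z. index (p z)) \<in> borel_of Z \<rightarrow>\<^sub>M count_space UNIV"
proof -
  note c = continuous_map_data[OF p]
  have m: "(\<lambda>z. measure (fst (snd (p z))) (A n)) \<in> borel_measurable (borel_of Z)"
    "(\<lambda>z. measure (snd (snd (p z))) (A n)) \<in> borel_measurable (borel_of Z)" if "1 \<le> n" for n
  proof -
    have "closed (A n)" using compact_K[of "n - 1"] that by (simp add: compact_imp_closed)
    then show "(\<lambda>z. measure (fst (snd (p z))) (A n)) \<in> borel_measurable (borel_of Z)"
      "(\<lambda>z. measure (snd (snd (p z))) (A n)) \<in> borel_measurable (borel_of Z)"
      using c(2,3) by (intro borel_of_continuous_map continuous_map_measure_closed; simp)+
  qed
  have "Measurable.pred (borel_of Z) (\<lambda>z. 1 \<le> n \<and> 0 < measure (fst (snd (p z))) (A n) * measure (snd (snd (p z))) (A n))" for n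
  proof (cases "1 \<le> n")
    case True
    note [measurable] = m[OF True]
    show ?thesis by measurable
  qed simp
  then show ?thesis unfolding index_def first_charged_index_def by measurable
qed

lemma measurable_pieces:
  assumes p: "continuous_map Z data_topology p"
    and B: "\<And>l. {z \<in> topspace Z. z \<in> B l} \<in> sets (borel_of Z)" and UB: "\<And>z. z \<in> topspace Z \<Longrightarrow> \<exists>l::nat. z \<in> B l"
    and f: "\<And>k l. f \<in> borel_of (subtopology Z (B l \<inter> {z. index (p z) = Suc k})) \<rightarrow>\<^sub>M N"
  shows "f \<in> borel_of Z \<rightarrow>\<^sub>M N"
proof (rule measurable_piecewise_restrict[where C="(\<lambda>(l, k). B l \<inter> {z. index (p z) = Suc k}) ` UNIV"])
  show "countable ((\<lambda>(l, k). B l \<inter> {z. index (p z) = Suc k}) ` (UNIV :: (nat \<times> nat) set))" by simp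
  fix \<Omega> assume "\<Omega> \<in> (\<lambda>(l, k). B l \<inter> {z. index (p z) = Suc k}) ` (UNIV :: (nat \<times> nat) set)"
  then obtain l k where \<Omega>: "\<Omega> = B l \<inter> {z. index (p z) = Suc k}" by auto
  have "(\<lambda>z. index (p z)) -` {Suc k} \<inter> space (borel_of Z) \<in> sets (borel_of Z)"
    by (rule measurable_sets[OF measurable_index[OF p]]) simp
  moreover have "\<Omega> \<inter> space (borel_of Z) = {z \<in> topspace Z. z \<in> B l} \<inter> ((\<lambda>z. index (p z)) -` {Suc k} \<inter> space (borel_of Z))"
    by (auto simp: \<Omega> space_borel_of)
  ultimately show "\<Omega> \<inter> space (borel_of Z) \<in> sets (borel_of Z)" using B[of l] by auto
  show "f \<in> restrict_space (borel_of Z) \<Omega> \<rightarrow>\<^sub>M N"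
    unfolding \<Omega> by (rule measurable_borel_of_subtopology[OF f])
next
  show "space (borel_of Z) \<subseteq> \<Union> ((\<lambda>(l, k). B l \<inter> {z. index (p z) = Suc k}) ` (UNIV :: (nat \<times> nat) set))"
  proof
    fix z assume "z \<in> space (borel_of Z)"
    then have z: "z \<in> topspace Z" by (simp add: space_borel_of)
    then obtain l where "z \<in> B l" using UB by blast
    have "p z \<in> topspace data_topology" using p z by (auto simp: continuous_map_def)
    then obtain k where "index (p z) = Suc k" using index_charged(1) by (metis not_one_le_zero not0_implies_Suc)
    then show "z \<in> \<Union> ((\<lambda>(l, k). B l \<inter> {z. index (p z) = Suc k}) ` (UNIV :: (nat \<times> nat) set))"
      using \<open>z \<in> B l\<close> by (intro UN_I[of "(l, k)"]) auto
  qed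
qed

lemma measurable_C0_integral:
  assumes f: "f \<in> C0_functions" and i: "i \<in> {1, 2}"
  shows "(\<lambda>d. \<integral>x. f x \<partial>nu i d) \<in> borel_of data_topology \<rightarrow>\<^sub>M borel"
proof (rule measurable_pieces[where p="\<lambda>d. d" and B="\<lambda>_. UNIV"])
  show "{d \<in> topspace data_topology. d \<in> UNIV} \<in> sets (borel_of (data_topology :: (('a \<times> 'a \<Rightarrow> real) \<times> 'a measure \<times> 'a measure) topology))"
    by (auto intro!: sets_borel_of_openin)
  fix k :: nat
  let ?X = "subtopology data_topology (UNIV \<inter> {d. index d = Suc k})"
  interpret data_family "\<lambda>n. K n" ?X "\<lambda>d. fst d" "\<lambda>d. fst (snd d)" "\<lambda>d. snd (snd d)" k
    by (rule data_family_piece[where p="\<lambda>d. d"]) auto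
  have fc: "continuous_on UNIV f" using f by (simp add: C0_functions_def)
  have dep: "depends_continuously j (\<lambda>d. f)" for j
    unfolding depends_continuously_def using fc by (auto intro!: uniform_limit_const)
  have X: "d \<in> topspace data_topology" "index d = Suc k" if "d \<in> topspace ?X" for d using that by auto
  have sol: "schroedinger_solution (fst d) (fst (snd d)) (snd (snd d)) (nu 1 d) (nu 2 d)"
    "emeasure (nu 1 d) (K k) = emeasure (nu 2 d) (K k)" if "d \<in> topspace ?X" for d
    using nu_solution[OF X(1)[OF that]] X(2)[OF that] by auto
  have meas: "(\<lambda>d. \<integral>x. ind j x * f x \<partial>nu i d) \<in> borel_measurable (borel_of ?X)" for j
  proof (cases "i = 1")
    case True
    show ?thesis
      unfolding True by (rule measurable_solution_integral(1)[of "\<lambda>d. nu 1 d" "\<lambda>d. nu 2 d", OF sol dep])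
  next
    case False
    then have i2: "i = 2" using i by blast
    show ?thesis
      unfolding i2 by (rule measurable_solution_integral(2)[of "\<lambda>d. nu 1 d" "\<lambda>d. nu 2 d", OF sol dep])
  qed
  show "(\<lambda>d. \<integral>x. f x \<partial>nu i d) \<in> borel_measurable (borel_of ?X)"
  proof (rule borel_measurable_LIMSEQ_real[OF _ meas])
    fix d assume "d \<in> space (borel_of ?X)"
    then have d: "d \<in> topspace data_topology" by (intro X(1)) (simp only: space_borel_of)
    have s: "sets (nu i d) = sets borel" by (rule nu_sets[OF d i])
    note [measurable_cong] = s
    have int: "integrable (nu i d) f" by (rule C0_integrable[OF d i f])
    have [measurable]: "f \<in> borel_measurable borel" by (rule borel_measurable_continuous_onI[OF fc])
    show "(\<lambda>j. \<integral>x. ind j x * f x \<partial>nu i d) \<longlonglongrightarrow> (\<integral>x. f x \<partial>nu i d)"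
    proof (rule integral_dominated_convergence[where w="\<lambda>x. \<bar>f x\<bar>"])
      show "AE x in nu i d. (\<lambda>j. ind j x * f x) \<longlonglongrightarrow> f x"
      proof (rule AE_I2)
        fix x
        obtain n where "x \<in> K n" using UN_K by blast
        then have "ind j x * f x = f x" if "n \<le> j" for j
          using mono_K[OF that] by (auto simp: indicator_def)
        then show "(\<lambda>j. ind j x * f x) \<longlonglongrightarrow> f x"
          by (intro tendsto_eventually) (auto simp: eventually_sequentially)
      qed
      show "AE x in nu i d. norm (ind j x * f x) \<le> \<bar>f x\<bar>" for j
        by (intro AE_I2) (simp add: indicator_def)
    qed (use int in auto)
  qed
qed auto

lemma nn_integral_eq_SUP:
  assumes d: "d \<in> topspace data_topology" and i: "i \<in> {1, 2}"
    and g: "continuous_on UNIV g" "\<And>y. 0 \<le> g y"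
  shows "(\<integral>\<^sup>+y. ennreal (g y) \<partial>nu i d) = (SUP j. ennreal (\<integral>y. ind j y * g y \<partial>nu i d))"
proof -
  have [measurable_cong]: "sets (nu i d) = sets borel" by (rule nu_sets[OF d i])
  have [measurable]: "g \<in> borel_measurable borel" by (rule borel_measurable_continuous_onI[OF g(1)])
  have inc: "incseq (\<lambda>j y. ennreal (ind j y * g y))"
  proof (intro incseq_SucI le_funI ennreal_leI)
    fix j y show "ind j y * g y \<le> ind (Suc j) y * g y"
      using mono_K[of j "Suc j"] g(2)[of y] by (auto simp: indicator_def)
  qed
  have e: "(\<integral>\<^sup>+y. ennreal (ind j y * g y) \<partial>nu i d) = ennreal (\<integral>y. ind j y * g y \<partial>nu i d)" for j
  proof (rule nn_integral_eq_integral)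
    show "integrable (nu i d) (\<lambda>y. ind j y * g y)"
      by (rule nu_integrable_on_compact[OF d i g(1) compact_K[of j]]) auto
  qed (simp add: g(2))
  have "(SUP j. ennreal (ind j y * g y)) = ennreal (g y)" for y
  proof (rule antisym)
    show "(SUP j. ennreal (ind j y * g y)) \<le> ennreal (g y)"
      using g(2)[of y] by (intro SUP_least ennreal_leI) (simp add: indicator_def)
    obtain n where "y \<in> K n" using UN_K by blast
    then show "ennreal (g y) \<le> (SUP j. ennreal (ind j y * g y))"
      by (intro SUP_upper2[of n]) auto
  qed
  then have "(\<integral>\<^sup>+y. ennreal (g y) \<partial>nu i d) = (\<integral>\<^sup>+y. (SUP j. ennreal (ind j y * g y)) \<partial>nu i d)" by simp
  also have "\<dots> = (SUP j. \<integral>\<^sup>+y. ennreal (ind j y * g y) \<partial>nu i d)"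
    by (rule nn_integral_monotone_convergence_SUP[OF inc]) measurable
  also have "\<dots> = (SUP j. ennreal (\<integral>y. ind j y * g y \<partial>nu i d))"
    by (simp only: e)
  finally show ?thesis .
qed

lemma measurable_section_integral:
  "(\<lambda>z. \<integral>\<^sup>+y. ennreal (fst (snd z) (fst z, y)) \<partial>nu 2 (snd z)) \<in> borel_of (prod_topology euclidean data_topology) \<rightarrow>\<^sub>M borel" (is ?thesis1)
  "(\<lambda>z. \<integral>\<^sup>+y. ennreal (fst (snd z) (y, fst z)) \<partial>nu 1 (snd z)) \<in> borel_of (prod_topology euclidean data_topology) \<rightarrow>\<^sub>M borel" (is ?thesis2)
proof -
  let ?Z = "prod_topology (euclidean :: 'a topology) (data_topology :: (('a \<times> 'a \<Rightarrow> real) \<times> 'a measure \<times> 'a measure) topology)"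
  have B: "{z \<in> topspace ?Z. z \<in> {z. fst z \<in> K l}} \<in> sets (borel_of ?Z)" for l
  proof -
    have "fst \<in> borel_of ?Z \<rightarrow>\<^sub>M borel" by (rule borel_of_continuous_map[OF continuous_map_fst])
    from measurable_sets[OF this K_borel[of l]] show ?thesis
      by (simp add: space_borel_of vimage_def Int_def conj_commute)
  qed
  have UB: "\<exists>l. z \<in> {z. fst z \<in> K l}" if "z \<in> topspace ?Z" for z using UN_K by blast
  have piece: "(\<lambda>z. \<integral>\<^sup>+y. ennreal (fst (snd z) (fst z, y)) \<partial>nu 2 (snd z)) \<in> borel_of (subtopology ?Z ({z. fst z \<in> K l} \<inter> {z. index (snd z) = Suc k})) \<rightarrow>\<^sub>M borel"
    "(\<lambda>z. \<integral>\<^sup>+y. ennreal (fst (snd z) (y, fst z)) \<partial>nu 1 (snd z)) \<in> borel_of (subtopology ?Z ({z. fst z \<in> K l} \<inter> {z. index (snd z) = Suc k})) \<rightarrow>\<^sub>M borel"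
    for k l
  proof -
    let ?X = "subtopology ?Z ({z. fst z \<in> K l} \<inter> {z. index (snd z) = Suc k})"
    interpret F: data_family "\<lambda>n. K n" ?X "\<lambda>z. fst (snd z)" "\<lambda>z. fst (snd (snd z))" "\<lambda>z. snd (snd (snd z))" k
      by (rule data_family_piece[where p=snd, OF continuous_map_snd]) auto
    interpret S: data_family "\<lambda>n. K n" ?X "\<lambda>z (x, y). fst (snd z) (y, x)" "\<lambda>z. snd (snd (snd z))" "\<lambda>z. fst (snd (snd z))" k
      by (rule F.swap_family)
    have X: "snd z \<in> topspace data_topology" "index (snd z) = Suc k" "fst z \<in> K l" if "z \<in> topspace ?X" for z
      using that by auto
    have lim: "(fst \<longlongrightarrow> fst z) (nhdsin ?X z)" if z: "z \<in> topspace ?X" for z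
    proof (rule topological_tendstoI)
      fix U :: "'a set" assume "open U" "fst z \<in> U"
      then show "\<forall>\<^sub>F w in nhdsin ?X z. fst w \<in> U"
        by (intro eventually_nhdsin_continuous[OF _ z, of euclidean] continuous_map_from_subtopology continuous_map_fst) auto
    qed
    have sol: "schroedinger_solution (fst (snd z)) (fst (snd (snd z))) (snd (snd (snd z))) (nu 1 (snd z)) (nu 2 (snd z))"
      "emeasure (nu 1 (snd z)) (K k) = emeasure (nu 2 (snd z)) (K k)" if "z \<in> topspace ?X" for z
      using nu_solution[OF X(1)[OF that]] X(2)[OF that] by auto
    have dep1: "F.depends_continuously j (\<lambda>z y. fst (snd z) (fst z, y))" for j
      by (rule F.depends_continuously_section[OF X(3) lim])
    have dep2: "F.depends_continuously j (\<lambda>z y. fst (snd z) (y, fst z))" for j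
      using S.depends_continuously_section[OF X(3) lim, of j] by simp
    have [measurable]: "(\<lambda>z. \<integral>y. ind j y * fst (snd z) (fst z, y) \<partial>nu 2 (snd z)) \<in> borel_measurable (borel_of ?X)"
      "(\<lambda>z. \<integral>y. ind j y * fst (snd z) (y, fst z) \<partial>nu 1 (snd z)) \<in> borel_measurable (borel_of ?X)" for j
      by (rule F.measurable_solution_integral(2)[OF sol dep1], assumption+)
        (rule F.measurable_solution_integral(1)[OF sol dep2], assumption+)
    have e1: "(\<integral>\<^sup>+y. ennreal (fst (snd z) (fst z, y)) \<partial>nu 2 (snd z)) = (SUP j. ennreal (\<integral>y. ind j y * fst (snd z) (fst z, y) \<partial>nu 2 (snd z)))"
      and e2: "(\<integral>\<^sup>+y. ennreal (fst (snd z) (y, fst z)) \<partial>nu 1 (snd z)) = (SUP j. ennreal (\<integral>y. ind j y * fst (snd z) (y, fst z) \<partial>nu 1 (snd z)))"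
      if z: "z \<in> space (borel_of ?X)" for z
    proof -
      have zX: "z \<in> topspace ?X" using z by (simp only: space_borel_of)
      interpret P: schroedinger_problem "\<lambda>n. K n" "fst (snd z)" "fst (snd (snd z))" "snd (snd (snd z))"
        by (rule problem_data[OF X(1)[OF zX]])
      have c: "continuous_on UNIV (\<lambda>y. fst (snd z) (fst z, y))" "continuous_on UNIV (\<lambda>y. fst (snd z) (y, fst z))"
        by (intro continuous_on_compose2[OF P.continuous_q] continuous_intros; simp)+
      show "(\<integral>\<^sup>+y. ennreal (fst (snd z) (fst z, y)) \<partial>nu 2 (snd z)) = (SUP j. ennreal (\<integral>y. ind j y * fst (snd z) (fst z, y) \<partial>nu 2 (snd z)))"
        by (rule nn_integral_eq_SUP[OF X(1)[OF zX] _ c(1) less_imp_le[OF P.q_pos]]) simp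
      show "(\<integral>\<^sup>+y. ennreal (fst (snd z) (y, fst z)) \<partial>nu 1 (snd z)) = (SUP j. ennreal (\<integral>y. ind j y * fst (snd z) (y, fst z) \<partial>nu 1 (snd z)))"
        by (rule nn_integral_eq_SUP[OF X(1)[OF zX] _ c(2) less_imp_le[OF P.q_pos]]) simp
    qed
    show "(\<lambda>z. \<integral>\<^sup>+y. ennreal (fst (snd z) (fst z, y)) \<partial>nu 2 (snd z)) \<in> borel_of ?X \<rightarrow>\<^sub>M borel"
      by (rule measurable_cong[THEN iffD2], erule e1) measurable
    show "(\<lambda>z. \<integral>\<^sup>+y. ennreal (fst (snd z) (y, fst z)) \<partial>nu 1 (snd z)) \<in> borel_of ?X \<rightarrow>\<^sub>M borel"
      by (rule measurable_cong[THEN iffD2], erule e2) measurable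
  qed
  show ?thesis1 by (rule measurable_pieces[OF continuous_map_snd B UB piece(1)])
  show ?thesis2 by (rule measurable_pieces[OF continuous_map_snd B UB piece(2)])
qed

lemma section_integral_pos:
  assumes d: "d \<in> topspace data_topology"
  shows "(\<integral>\<^sup>+y. ennreal (fst d (x, y)) \<partial>nu 2 d) \<noteq> 0" "(\<integral>\<^sup>+y. ennreal (fst d (y, x)) \<partial>nu 1 d) \<noteq> 0"
proof -
  interpret P: schroedinger_problem "\<lambda>n. K n" "fst d" "fst (snd d)" "snd (snd d)" by (rule problem_data[OF d])
  obtain k where k: "index d = Suc k" using index_charged(1)[OF d] by (cases "index d") auto
  note ch = index_charged(2,3)[OF d, unfolded k]
  show "(\<integral>\<^sup>+y. ennreal (fst d (x, y)) \<partial>nu 2 d) \<noteq> 0" by (rule P.solution_section_pos[OF nu_solution(1)[OF d] ch(2)])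
  show "(\<integral>\<^sup>+y. ennreal (fst d (y, x)) \<partial>nu 1 d) \<noteq> 0" by (rule P.solution_section_pos2[OF nu_solution(1)[OF d] ch(1)])
qed

end

lemma measurable_log_ennreal [measurable]: "log_ennreal \<in> borel \<rightarrow>\<^sub>M borel"
  unfolding log_ennreal_def[abs_def] by measurable

lemma log_ennreal_eq_minf_iff: "log_ennreal r = - \<infinity> \<longleftrightarrow> r = 0"
  by (simp add: log_ennreal_def)

theorem corollary2p1:
  fixes A :: "nat \<Rightarrow> 'a::metric_space set" and i :: nat
  assumes "compact_exhaustion A"
    and "i \<in> {1, 2}"
  shows "(\<forall>f\<in>C0_functions.
            (\<forall>(q, \<mu>1, \<mu>2) \<in> topspace data_topology. integrable (schroedinger_nu A i q \<mu>1 \<mu>2) f) \<and>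
            (\<lambda>(q, \<mu>1, \<mu>2). \<integral>x. f x \<partial>schroedinger_nu A i q \<mu>1 \<mu>2) \<in> borel_of data_topology \<rightarrow>\<^sub>M borel) \<and>
         (\<lambda>(x, q, \<mu>1, \<mu>2). schroedinger_u A i x q \<mu>1 \<mu>2)
            \<in> borel_of (prod_topology euclidean data_topology) \<rightarrow>\<^sub>M restrict_space borel (- {-\<infinity>})"
proof -
  interpret exhausted_space A by unfold_locales (rule assms(1))
  let ?Z = "prod_topology (euclidean :: 'a topology) (data_topology :: (('a \<times> 'a \<Rightarrow> real) \<times> 'a measure \<times> 'a measure) topology)"
  have u: "(\<lambda>(x, q, \<mu>1, \<mu>2). schroedinger_u A i x q \<mu>1 \<mu>2) = (\<lambda>z. log_ennreal
      (if i = 1 then \<integral>\<^sup>+y. ennreal (fst (snd z) (fst z, y)) \<partial>nu 2 (snd z)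
       else \<integral>\<^sup>+y. ennreal (fst (snd z) (y, fst z)) \<partial>nu 1 (snd z)))"
    by (auto simp: schroedinger_u_def fun_eq_iff)
  have "(\<lambda>z. if i = 1 then \<integral>\<^sup>+y. ennreal (fst (snd z) (fst z, y)) \<partial>nu 2 (snd z)
       else \<integral>\<^sup>+y. ennreal (fst (snd z) (y, fst z)) \<partial>nu 1 (snd z)) \<in> borel_of ?Z \<rightarrow>\<^sub>M borel"
    using measurable_section_integral by (cases "i = 1") simp_all
  from measurable_compose[OF this measurable_log_ennreal]
  have "(\<lambda>(x, q, \<mu>1, \<mu>2). schroedinger_u A i x q \<mu>1 \<mu>2) \<in> borel_of ?Z \<rightarrow>\<^sub>M borel"
    unfolding u .
  moreover have "(\<lambda>(x, q, \<mu>1, \<mu>2). schroedinger_u A i x q \<mu>1 \<mu>2) \<in> space (borel_of ?Z) \<rightarrow> - {- \<infinity>}"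
  proof
    fix z assume "z \<in> space (borel_of ?Z)"
    then have "snd z \<in> topspace data_topology" by (auto simp: space_borel_of)
    then show "(case z of (x, q, \<mu>1, \<mu>2) \<Rightarrow> schroedinger_u A i x q \<mu>1 \<mu>2) \<in> - {- \<infinity>}"
      using section_integral_pos[of "snd z" "fst z"]
      by (auto simp: schroedinger_u_def log_ennreal_eq_minf_iff split: prod.split)
  qed
  ultimately have "(\<lambda>(x, q, \<mu>1, \<mu>2). schroedinger_u A i x q \<mu>1 \<mu>2)
      \<in> borel_of ?Z \<rightarrow>\<^sub>M restrict_space borel (- {-\<infinity>})"
    by (intro measurable_restrict_space2)
  moreover have "\<forall>(q, \<mu>1, \<mu>2) \<in> topspace data_topology. integrable (schroedinger_nu A i q \<mu>1 \<mu>2) f" if "f \<in> C0_functions" for f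
    using C0_integrable[OF _ assms(2) that] by fastforce
  moreover have "(\<lambda>(q, \<mu>1, \<mu>2). \<integral>x. f x \<partial>schroedinger_nu A i q \<mu>1 \<mu>2) \<in> borel_of data_topology \<rightarrow>\<^sub>M borel" if "f \<in> C0_functions" for f
    using measurable_C0_integral[OF that assms(2)] by (simp add: split_beta')
  ultimately show ?thesis by blast
qed

end
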